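(* Let $q_0\in(0,1)$ and let $f:[0,\infty)\to[0,1]$ be nonincreasing with $0<\sup\{a: f(a)>0\}<\infty$. Then $\lambda_{q_0 f}>\lambda_f$, where $q_0 f$ denotes the connection function $r\mapsto q_0 f(r)$.
   Context: For $\lambda>0$, $\mathscr{P}_\lambda$ is a homogeneous Poisson point process of intensity $\lambda$ in $\mathbb{R}^2$. Given a connection function $g:[0,\infty)\to[0,1]$, the random connection model $RCM(\lambda,g)$ is the random graph with vertex set $\mathscr{P}_\lambda$ in which each pair of vertices $x,y$ is joined by an edge with probability $g(|x-y|)$, independently of all other pairs. When $0<\int_0^\infty r g(r)\,dr<\infty$ there is a critical intensity $\lambda_g\in(0,\infty)$ such that for $\lambda>\lambda_g$ the graph $RCM(\lambda,g)$ a.s. has an infinite connected component and for $\lambda<\lambda_g$ a.s. it has none. *)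

theory Defs
  imports "HOL-Probability.Probability" "HOL-Library.Countable"
begin

text \<open>Concrete construction of the random connection model RCM(lambda, g) in the plane.
  The plane is tiled by unit squares indexed by (int x int).  Square s carries N s points,
  N s ~ Poisson(lambda) independently; the k-th point of square s is uniform in that square
  (all independent).  This yields a homogeneous Poisson process of intensity lambda.
  Vertices are labels (s,k) with k < N s.  Each unordered pair of labels gets an independent
  Uniform[0,1] mark U; the pair {v,w} is an edge iff its mark is < g(|X v - X w|),
  i.e. with probability g(|X v - X w|), independently.\<close>

type_synonym label = "(int \<times> int) \<times> nat"

definition unit_square :: "int \<times> int \<Rightarrow> (real \<times> real) set" where
  "unit_square s = {real_of_int (fst s) .. real_of_int (fst s) + 1}
                   \<times> {real_of_int (snd s) .. real_of_int (snd s) + 1}"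

definition RCM_space :: "real \<Rightarrow>
    ((int \<times> int \<Rightarrow> nat) \<times> (label \<Rightarrow> real \<times> real) \<times> (label \<times> label \<Rightarrow> real)) measure" where
  "RCM_space lam =
     (PiM UNIV (\<lambda>_. measure_pmf (poisson_pmf lam)))
     \<Otimes>\<^sub>M ((PiM UNIV (\<lambda>v. uniform_measure lborel (unit_square (fst v))))
     \<Otimes>\<^sub>M (PiM UNIV (\<lambda>_. uniform_measure lborel {0..1::real})))"

definition RCM_active :: "(int \<times> int \<Rightarrow> nat) \<times> (label \<Rightarrow> real \<times> real) \<times> (label \<times> label \<Rightarrow> real)
    \<Rightarrow> label \<Rightarrow> bool" where
  "RCM_active \<omega> v = (snd v < fst \<omega> (fst v))"

definition upair_key :: "label \<Rightarrow> label \<Rightarrow> label \<times> label" where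
  "upair_key v w = (if to_nat v \<le> to_nat w then (v, w) else (w, v))"

definition RCM_edge :: "(real \<Rightarrow> real) \<Rightarrow>
    (int \<times> int \<Rightarrow> nat) \<times> (label \<Rightarrow> real \<times> real) \<times> (label \<times> label \<Rightarrow> real)
    \<Rightarrow> label \<Rightarrow> label \<Rightarrow> bool" where
  "RCM_edge g \<omega> v w =
     (RCM_active \<omega> v \<and> RCM_active \<omega> w \<and> v \<noteq> w \<and>
      snd (snd \<omega>) (upair_key v w) < g (dist (fst (snd \<omega>) v) (fst (snd \<omega>) w)))"

definition RCM_percolates :: "(real \<Rightarrow> real) \<Rightarrow>
    (int \<times> int \<Rightarrow> nat) \<times> (label \<Rightarrow> real \<times> real) \<times> (label \<times> label \<Rightarrow> real) \<Rightarrow> bool" where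
  "RCM_percolates g \<omega> =
     (\<exists>v. RCM_active \<omega> v \<and> infinite {w. (RCM_edge g \<omega>)\<^sup>*\<^sup>* v w})"

definition RCM_critical :: "(real \<Rightarrow> real) \<Rightarrow> real" where
  "RCM_critical g =
     Sup {lam. 0 < lam \<and>
              measure (RCM_space lam) {\<omega> \<in> space (RCM_space lam). RCM_percolates g \<omega>} = 0}"

end

theory Submission
  imports Defs
begin

text \<open>
  Realise the edge thinning by q as follows: an edge survives iff two independent half-edges,
  each open with probability \<open>sqrt q\<close>, are both open. A vertex all of whose half-edges are closed
  is isolated and may be deleted; if every square holds at most K points, such deletions are
  independent with probability \<open>eta\<close> exponentially small in K, so they thin the Poisson process.
  Squares with more than K points are treated separately. The influence of such a dense square
  is dominated by an \<^emph>\<open>emulator\<close>: one point in every small cell of a neighbourhood, with all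
  relevant marks below \<open>f r0\<close>. An extra Poisson process whose intensity is a small multiple of
  \<open>eta\<close> produces emulators independently with probability at least exponentially small in K,
  which for large K exceeds the probability of a dense square, because the latter decays faster
  than any exponential.
  Hence absence of percolation of \<open>RCM(lam (1 - eta / 2), f)\<close> implies absence for \<open>RCM(lam, q f)\<close>.
  Finiteness and positivity of the critical values come from a 3x3 renormalisation and from
  counting paths of occupied squares.
\<close>

section \<open>Independence by disjoint coordinates\<close>

text \<open>The choices of parameters look circular. Independent killing with a probability bounded
  below requires a cap K on the occupation of a square; a larger K makes \<open>eta\<close> smaller;
  and \<open>eta\<close> limits the intensity available for emulators, which must be more frequent
  than squares above the cap. The circle closes because the number of cells of an emulator does not
  depend on K and the number of its marks is linear in K: its probability is at least a constant
  times \<open>\<rho> ^ K\<close>, while the Poisson tail is at most a constant times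
  \<open>(\<rho> / 2) ^ K\<close>. Half of the killed intensity pays for the emulators and the other
  half is the gain, hence \<open>1 - eta / 2\<close>. The gain must be uniform in lam on a compact
  interval: null intensities for f come arbitrarily close to the critical value from below, and one
  of them divided by a fixed factor less than 1 passes it. In the renormalisation and in the
  coupling, connectivity is expressed by a component-valued function that is constant along edges,
  so that no paths have to be spliced.\<close>

definition depends_on :: "'i set \<Rightarrow> (('i \<Rightarrow> 'b) \<Rightarrow> 'c) \<Rightarrow> bool" where
  "depends_on J Y \<longleftrightarrow> (\<forall>\<omega> \<omega>'. (\<forall>i\<in>J. \<omega> i = \<omega>' i) \<longrightarrow> Y \<omega> = Y \<omega>')"

lemma depends_onI: "(\<And>\<omega> \<omega>'. (\<And>i. i \<in> J \<Longrightarrow> \<omega> i = \<omega>' i) \<Longrightarrow> Y \<omega> = Y \<omega>') \<Longrightarrow> depends_on J Y"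
  unfolding depends_on_def by blast

lemma depends_onD: "depends_on J Y \<Longrightarrow> (\<And>i. i \<in> J \<Longrightarrow> \<omega> i = \<omega>' i) \<Longrightarrow> Y \<omega> = Y \<omega>'"
  unfolding depends_on_def by blast

lemma depends_on_family:
  "(\<And>j. depends_on (J j) (Y j)) \<Longrightarrow> depends_on (\<Union>j. J j) (\<lambda>\<omega> j. Y j \<omega>)"
  by (rule depends_onI, rule ext, rule depends_onD[of "J _"]) auto

lemma depends_on_pair:
  "depends_on J Y \<Longrightarrow> depends_on J' Z \<Longrightarrow> depends_on (J \<union> J') (\<lambda>\<omega>. (Y \<omega>, Z \<omega>))"
  unfolding depends_on_def by blast

lemma depends_on_compose: "depends_on J Y \<Longrightarrow> depends_on J (\<lambda>\<omega>. h (Y \<omega>))"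
  unfolding depends_on_def by metis

lemma depends_on_eq: "depends_on J Y \<Longrightarrow> depends_on J (\<lambda>\<omega>. Y \<omega> = n)"
  unfolding depends_on_def by metis

text \<open>With \<open>UNIV\<close> as index set the points are total functions, and subsets of
  coordinates enter only through \<open>depends_on\<close>.\<close>

locale univ_product =
  fixes M :: "'i \<Rightarrow> 'b measure"
  assumes prob_M: "\<And>i. prob_space (M i)"
begin

abbreviation \<Omega> :: "('i \<Rightarrow> 'b) measure" where "\<Omega> \<equiv> PiM UNIV M"

sublocale product_prob_space M UNIV
proof -
  interpret A: prob_space "M i" for i by (rule prob_M)
  show "product_prob_space M" by unfold_locales
qed

text \<open>A fixed point w of the space fills the coordinates outside J. Composing Y with this
  extension gives a measurable function of the J-coordinates alone, and \<open>depends_on\<close>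
  says that the filling is invisible.\<close>

lemma depends_on_factor:
  assumes Y: "Y \<in> measurable \<Omega> N" and dep: "depends_on J Y"
  obtains Y' where "Y' \<in> measurable (PiM J M) N" "\<And>\<omega>. \<omega> \<in> space \<Omega> \<Longrightarrow> Y' (restrict \<omega> J) = Y \<omega>"
proof -
  obtain w where w: "w \<in> space \<Omega>" using P.not_empty by blast
  define E where "E = (\<lambda>x i. if i \<in> J then x i else w i)"
  have "E \<in> measurable (PiM J M) \<Omega>"
    unfolding E_def
  proof (rule measurable_PiM_single')
    show "(\<lambda>\<omega>. if i \<in> J then \<omega> i else w i) \<in> PiM J M \<rightarrow>\<^sub>M M i" for i
    proof (cases "i \<in> J")
      case False
      have "w i \<in> space (M i)" using w by (auto simp: space_PiM)
      then show ?thesis using False by simp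
    qed simp
    show "(\<lambda>\<omega> i. if i \<in> J then \<omega> i else w i) \<in> space (PiM J M) \<rightarrow> (\<Pi>\<^sub>E i\<in>UNIV. space (M i))"
      using w by (auto simp: space_PiM PiE_iff)
  qed
  then have "(\<lambda>x. Y (E x)) \<in> measurable (PiM J M) N" using Y by simp
  moreover have "Y (E (restrict \<omega> J)) = Y \<omega>" for \<omega>
    by (rule depends_onD[OF dep]) (auto simp: E_def)
  ultimately show thesis using that by blast
qed

lemma indep_coordinates: "P.indep_vars M (\<lambda>i \<omega>. \<omega> i) UNIV"
proof (subst P.indep_vars_iff_distr_eq_PiM)
  show "(UNIV :: 'i set) \<noteq> {}" by simp
  show "(\<lambda>\<omega>. \<omega> i) \<in> \<Omega> \<rightarrow>\<^sub>M M i" for i by simp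
  have "distr \<Omega> \<Omega> (\<lambda>x. \<lambda>i\<in>UNIV. x i) = \<Omega>"
    unfolding restrict_UNIV by (rule distr_id2) simp
  also have "\<dots> = (\<Pi>\<^sub>M i\<in>UNIV. distr \<Omega> (M i) (\<lambda>\<omega>. \<omega> i))"
    by (intro PiM_cong refl) (simp add: PiM_component)
  finally show "distr \<Omega> \<Omega> (\<lambda>x. \<lambda>i\<in>UNIV. x i) = (\<Pi>\<^sub>M i\<in>UNIV. distr \<Omega> (M i) (\<lambda>\<omega>. \<omega> i))" .
qed

text \<open>Restrictions of the coordinate process to disjoint blocks are independent, and each
  \<open>Y j\<close> factors through its block. Every independence claim below thereby becomes a
  disjointness check of coordinate sets.\<close>

lemma indep_vars_depends_on:
  assumes disj: "disjoint_family_on J I"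
    and Y: "\<And>j. j \<in> I \<Longrightarrow> Y j \<in> measurable \<Omega> (N j)"
    and dep: "\<And>j. j \<in> I \<Longrightarrow> depends_on (J j) (Y j)"
  shows "P.indep_vars N Y I"
proof -
  have "\<exists>Y'. Y' \<in> measurable (PiM (J j) M) (N j) \<and> (\<forall>\<omega>\<in>space \<Omega>. Y' (restrict \<omega> (J j)) = Y j \<omega>)"
    if "j \<in> I" for j
    using depends_on_factor[OF Y[OF that] dep[OF that]] by metis
  then obtain Y' where Y': "\<And>j. j \<in> I \<Longrightarrow> Y' j \<in> measurable (PiM (J j) M) (N j)"
    "\<And>j \<omega>. j \<in> I \<Longrightarrow> \<omega> \<in> space \<Omega> \<Longrightarrow> Y' j (restrict \<omega> (J j)) = Y j \<omega>"
    by metis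
  have 1: "P.indep_vars (\<lambda>j. PiM (J j) M) (\<lambda>j \<omega>. restrict (\<lambda>i. \<omega> i) (J j)) I"
    by (rule P.indep_vars_restrict[OF indep_coordinates _ disj]) simp
  have 2: "P.indep_vars N (\<lambda>j \<omega>. Y' j (restrict \<omega> (J j))) I"
    using P.indep_vars_compose2[OF 1, of Y' N] Y'(1) by simp
  \<comment> \<open>The factored maps equal \<open>Y j\<close> only on
    \<open>space \<Omega>\<close>, so independence is transported through the generated sets rather
    than by rewriting the functions.\<close>
  have eq: "{(\<lambda>\<omega>. Y' j (restrict \<omega> (J j))) -` A \<inter> space \<Omega> |A. A \<in> sets (N j)} =
      {Y j -` A \<inter> space \<Omega> |A. A \<in> sets (N j)}" if "j \<in> I" for j
  proof -
    have "(\<lambda>\<omega>. Y' j (restrict \<omega> (J j))) -` A \<inter> space \<Omega> = Y j -` A \<inter> space \<Omega>" for A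
      using Y'(2)[OF that] by auto
    then show ?thesis by simp
  qed
  have 3: "P.indep_sets (\<lambda>j. {(\<lambda>\<omega>. Y' j (restrict \<omega> (J j))) -` A \<inter> space \<Omega> |A. A \<in> sets (N j)}) I"
    using 2 unfolding P.indep_vars_def2 by blast
  have "P.indep_sets (\<lambda>j. {Y j -` A \<inter> space \<Omega> |A. A \<in> sets (N j)}) I"
    by (rule iffD1[OF P.indep_sets_cong[OF refl eq] 3])
  then show ?thesis
    unfolding P.indep_vars_def2 using Y by blast
qed

lemma distr_family:
  fixes Y :: "'j \<Rightarrow> ('i \<Rightarrow> 'b) \<Rightarrow> 'c"
  assumes "disjoint_family J"
    and Y: "\<And>j. Y j \<in> measurable \<Omega> (N j)"
    and "\<And>j. depends_on (J j) (Y j)"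
  shows "distr \<Omega> (PiM UNIV N) (\<lambda>\<omega> j. Y j \<omega>) = PiM UNIV (\<lambda>j. distr \<Omega> (N j) (Y j))"
proof -
  have "P.indep_vars N Y UNIV"
  proof (rule indep_vars_depends_on)
    show "disjoint_family J" "Y j \<in> \<Omega> \<rightarrow>\<^sub>M N j" "depends_on (J j) (Y j)" for j
      by (fact assms)+
  qed
  then have "distr \<Omega> (PiM UNIV N) (\<lambda>\<omega>. \<lambda>j\<in>UNIV. Y j \<omega>) = PiM UNIV (\<lambda>j. distr \<Omega> (N j) (Y j))"
    using P.indep_vars_iff_distr_eq_PiM[OF UNIV_not_empty, of Y N, OF Y] by (rule iffD1[rotated])
  then show ?thesis by (simp only: restrict_UNIV)
qed

text \<open>The counterpart of \<open>distr_family\<close> for two variables whose value types may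
  differ; it later joins counts, positions and marks into one triple.\<close>

lemma distr_pair:
  assumes disj: "J \<inter> J' = {}"
    and Y: "Y \<in> measurable \<Omega> N" and depY: "depends_on J Y"
    and Z: "Z \<in> measurable \<Omega> N'" and depZ: "depends_on J' Z"
  shows "distr \<Omega> (N \<Otimes>\<^sub>M N') (\<lambda>\<omega>. (Y \<omega>, Z \<omega>)) = distr \<Omega> N Y \<Otimes>\<^sub>M distr \<Omega> N' Z"
proof -
  obtain Y' where Y': "Y' \<in> measurable (PiM J M) N"
    "\<And>\<omega>. \<omega> \<in> space \<Omega> \<Longrightarrow> Y' (restrict \<omega> J) = Y \<omega>"
    using depends_on_factor[OF Y depY] by metis
  obtain Z' where Z': "Z' \<in> measurable (PiM J' M) N'"
    "\<And>\<omega>. \<omega> \<in> space \<Omega> \<Longrightarrow> Z' (restrict \<omega> J') = Z \<omega>"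
    using depends_on_factor[OF Z depZ] by metis
  let ?rJ = "\<lambda>\<omega>. restrict \<omega> J" and ?rJ' = "\<lambda>\<omega>. restrict \<omega> J'"
  have mJ: "?rJ \<in> measurable \<Omega> (PiM J M)" "?rJ' \<in> measurable \<Omega> (PiM J' M)"
    by (auto intro!: measurable_restrict)
  have "P.indep_var (PiM J M) (\<lambda>\<omega>. restrict (\<lambda>i. \<omega> i) J) (PiM J' M) (\<lambda>\<omega>. restrict (\<lambda>i. \<omega> i) J')"
    by (rule P.indep_var_restrict[OF indep_coordinates disj]) auto
  then have eq: "distr \<Omega> (PiM J M \<Otimes>\<^sub>M PiM J' M) (\<lambda>\<omega>. (?rJ \<omega>, ?rJ' \<omega>)) =
      distr \<Omega> (PiM J M) ?rJ \<Otimes>\<^sub>M distr \<Omega> (PiM J' M) ?rJ'"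
    by (simp add: P.indep_var_distribution_eq)
  have Y_eq: "distr \<Omega> N Y = distr (distr \<Omega> (PiM J M) ?rJ) N Y'"
    by (subst distr_distr[OF Y'(1) mJ(1)]) (auto intro!: distr_cong simp: Y'(2))
  have Z_eq: "distr \<Omega> N' Z = distr (distr \<Omega> (PiM J' M) ?rJ') N' Z'"
    by (subst distr_distr[OF Z'(1) mJ(2)]) (auto intro!: distr_cong simp: Z'(2))
  interpret D': prob_space "distr \<Omega> N' Z" by (rule P.prob_space_distr[OF Z])
  interpret D1: prob_space "distr \<Omega> (PiM J M) ?rJ" by (rule P.prob_space_distr[OF mJ(1)])
  interpret D2: prob_space "distr \<Omega> (PiM J' M) ?rJ'" by (rule P.prob_space_distr[OF mJ(2)])
  have "distr \<Omega> N Y \<Otimes>\<^sub>M distr \<Omega> N' Z =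
      distr (distr \<Omega> (PiM J M) ?rJ \<Otimes>\<^sub>M distr \<Omega> (PiM J' M) ?rJ') (N \<Otimes>\<^sub>M N') (\<lambda>(x, y). (Y' x, Z' y))"
    unfolding Y_eq Z_eq
    by (rule pair_measure_distr) (use Y' Z' D'.sigma_finite_measure_axioms in \<open>auto simp:
        Z_eq[symmetric]\<close>)
  also have "\<dots> = distr \<Omega> (N \<Otimes>\<^sub>M N') (\<lambda>\<omega>. (Y \<omega>, Z \<omega>))"
    unfolding eq[symmetric]
    using Y'(1) Z'(1) mJ
    by (subst distr_distr) (auto intro!: distr_cong simp: Y'(2) Z'(2))
  finally show ?thesis by simp
qed

lemma prob_ball_depends_on:
  assumes fin: "finite F" and disj: "disjoint_family_on J F"
    and Y: "\<And>j. j \<in> F \<Longrightarrow> Measurable.pred \<Omega> (Y j)"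
    and dep: "\<And>j. j \<in> F \<Longrightarrow> depends_on (J j) (Y j)"
  shows "P.prob {\<omega> \<in> space \<Omega>. \<forall>j\<in>F. Y j \<omega>} = (\<Prod>j\<in>F. P.prob {\<omega> \<in> space \<Omega>. Y j \<omega>})"
proof (cases "F = {}")
  case False
  have ind: "P.indep_vars (\<lambda>_. count_space UNIV) Y F"
    by (rule indep_vars_depends_on[OF disj Y dep])
  have "P.prob (\<Inter>j\<in>F. Y j -` {True} \<inter> space \<Omega>) = (\<Prod>j\<in>F. P.prob (Y j -` {True} \<inter> space \<Omega>))"
    by (rule P.indep_varsD[OF ind False fin]) auto
  moreover have "(\<Inter>j\<in>F. Y j -` {True} \<inter> space \<Omega>) = {\<omega> \<in> space \<Omega>. \<forall>j\<in>F. Y j \<omega>}"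
    using False by auto
  moreover have "Y j -` {True} \<inter> space \<Omega> = {\<omega> \<in> space \<Omega>. Y j \<omega>}" for j by auto
  ultimately show ?thesis by simp
qed (simp add: P.prob_space)

lemma prob_conj_depends_on:
  assumes disj: "J \<inter> J' = {}"
    and "Measurable.pred \<Omega> Y" "depends_on J Y" "Measurable.pred \<Omega> Z" "depends_on J' Z"
  shows "P.prob {\<omega> \<in> space \<Omega>. Y \<omega> \<and> Z \<omega>} = P.prob {\<omega> \<in> space \<Omega>. Y \<omega>} * P.prob {\<omega> \<in> space \<Omega>. Z \<omega>}"
proof -
  have "P.prob {\<omega> \<in> space \<Omega>. \<forall>b\<in>UNIV. (if b then Y else Z) \<omega>} =
      (\<Prod>b\<in>UNIV. P.prob {\<omega> \<in> space \<Omega>. (if b then Y else Z) \<omega>})"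
    by (rule prob_ball_depends_on[where J = "\<lambda>b. if b then J else J'"])
      (use assms in \<open>auto simp: disjoint_family_on_def\<close>)
  moreover have "{\<omega> \<in> space \<Omega>. \<forall>b\<in>UNIV. (if b then Y else Z) \<omega>} = {\<omega> \<in> space \<Omega>. Y \<omega> \<and> Z \<omega>}"
    by (auto split: if_splits)
  ultimately show ?thesis by (simp add: UNIV_bool mult.commute)
qed

lemma prob_not:
  assumes "Measurable.pred \<Omega> Y"
  shows "P.prob {\<omega> \<in> space \<Omega>. \<not> Y \<omega>} = 1 - P.prob {\<omega> \<in> space \<Omega>. Y \<omega>}"
proof -
  have "{\<omega> \<in> space \<Omega>. \<not> Y \<omega>} = space \<Omega> - {\<omega> \<in> space \<Omega>. Y \<omega>}" by auto
  moreover have "P.prob (space \<Omega> - {\<omega> \<in> space \<Omega>. Y \<omega>}) = 1 - P.prob {\<omega> \<in> space \<Omega>. Y \<omega>}"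
    by (rule P.prob_compl) (use assms in measurable)
  ultimately show ?thesis by simp
qed

lemma prob_coordinate:
  assumes "A \<in> sets (M i)"
  shows "P.prob {\<omega> \<in> space \<Omega>. \<omega> i \<in> A} = measure (M i) A"
proof -
  have "measure (distr \<Omega> (M i) (\<lambda>\<omega>. \<omega> i)) A = measure (M i) A"
    by (simp add: PiM_component)
  moreover have "(\<lambda>\<omega>. \<omega> i) -` A \<inter> space \<Omega> = {\<omega> \<in> space \<Omega>. \<omega> i \<in> A}" by auto
  ultimately show ?thesis using assms by (simp add: measure_distr)
qed

lemma AE_coordinate: "AE x in M i. R x \<Longrightarrow> AE \<omega> in \<Omega>. R (\<omega> i)"
  by (rule AE_component) auto

end

section \<open>Connection graphs and the subcritical regime\<close>

text \<open>\<open>gkey\<close>, \<open>gedge\<close> and \<open>gperc\<close> generalise the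
  notions of the model to any countable vertex type and an explicit vertex set, because the
  comparison graph of the coupling lives on the labels \<open>lab\<close> and is moved to
  \<open>label\<close> only by relabelling.\<close>

definition gkey :: "'l::countable \<Rightarrow> 'l \<Rightarrow> 'l \<times> 'l" where
  "gkey v w = (if to_nat v \<le> to_nat w then (v, w) else (w, v))"

definition gedge :: "(real \<Rightarrow> real) \<Rightarrow> 'l::countable set \<Rightarrow> ('l \<Rightarrow> real \<times> real) \<Rightarrow> ('l \<times> 'l \<Rightarrow> real)
    \<Rightarrow> 'l \<Rightarrow> 'l \<Rightarrow> bool" where
  "gedge g V X U v w \<longleftrightarrow> v \<in> V \<and> w \<in> V \<and> v \<noteq> w \<and> U (gkey v w) < g (dist (X v) (X w))"

definition gperc :: "(real \<Rightarrow> real) \<Rightarrow> 'l::countable set \<Rightarrow> ('l \<Rightarrow> real \<times> real) \<Rightarrow> ('l \<times> 'l \<Rightarrow> real) \<Rightarrow>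
    bool" where
  "gperc g V X U \<longleftrightarrow> (\<exists>v\<in>V. infinite {w. (gedge g V X U)\<^sup>*\<^sup>* v w})"

lemma gkey_commute: "gkey v w = gkey w v"
  by (auto simp: gkey_def)

lemma gkey_cases: "gkey v w = (v, w) \<or> gkey v w = (w, v)"
  by (auto simp: gkey_def)

lemma gkey_eq_iff: "gkey v w = gkey v' w' \<longleftrightarrow> v = v' \<and> w = w' \<or> v = w' \<and> w = v'"
proof
  show "gkey v w = gkey v' w' \<Longrightarrow> v = v' \<and> w = w' \<or> v = w' \<and> w = v'"
    using gkey_cases[of v w] gkey_cases[of v' w'] by auto
qed (auto simp: gkey_commute)

lemma gkey_idem: "gkey (fst (gkey v w)) (snd (gkey v w)) = gkey v w"
  by (auto simp: gkey_def)

lemma gedge_sym: "gedge g V X U v w \<Longrightarrow> gedge g V X U w v"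
  by (auto simp: gedge_def gkey_commute dist_commute)

lemma RCM_edge_gedge:
  "RCM_edge g \<omega> = gedge g {v. snd v < fst \<omega> (fst v)} (fst (snd \<omega>)) (snd (snd \<omega>))"
  by (intro ext) (auto simp: RCM_edge_def gedge_def RCM_active_def upair_key_def gkey_def)

lemma RCM_percolates_gperc:
  "RCM_percolates g \<omega> = gperc g {v. snd v < fst \<omega> (fst v)} (fst (snd \<omega>)) (snd (snd \<omega>))"
  by (auto simp: RCM_percolates_def gperc_def RCM_edge_gedge RCM_active_def)

text \<open>Replaces infinitude by countable quantifiers, which makes percolation accessible to
  measurability proofs.\<close>

lemma infinite_countable_iff: "infinite (A :: 'l::countable set) \<longleftrightarrow> (\<forall>n. \<exists>w. w \<in> A \<and> n \<le> to_nat w)"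
proof -
  have "finite (to_nat ` A) \<longleftrightarrow> finite A" by (rule finite_image_iff) (auto simp: inj_on_def)
  then have "infinite A \<longleftrightarrow> (\<forall>m. \<exists>n\<ge>m. n \<in> to_nat ` A)"
    using infinite_nat_iff_unbounded_le[of "to_nat ` A"] by simp
  also have "\<dots> \<longleftrightarrow> (\<forall>n. \<exists>w. w \<in> A \<and> n \<le> to_nat w)" by blast
  finally show ?thesis .
qed

text \<open>Reachability is a countable union over path lengths, and every step is a countable union
  over the intermediate vertex.\<close>

lemma pred_rtranclp [measurable (raw)]:
  fixes E :: "'a \<Rightarrow> 'l::countable \<Rightarrow> 'l \<Rightarrow> bool"
  assumes [measurable]: "\<And>v w. Measurable.pred M (\<lambda>\<omega>. E \<omega> v w)"
  shows "Measurable.pred M (\<lambda>\<omega>. (E \<omega>)\<^sup>*\<^sup>* v w)"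
proof -
  have [measurable]: "Measurable.pred M (\<lambda>\<omega>. (E \<omega> ^^ n) v w)" for n w
  proof (induction n arbitrary: w)
    case (Suc n)
    have [measurable]: "Measurable.pred M (\<lambda>\<omega>. (E \<omega> ^^ n) v u)" for u by (rule Suc.IH)
    have eq: "(\<lambda>\<omega>. (E \<omega> ^^ Suc n) v w) = (\<lambda>\<omega>. \<exists>u. (E \<omega> ^^ n) v u \<and> E \<omega> u w)"
      by (auto simp: relcompp.simps)
    show ?case unfolding eq by measurable
  qed simp
  show ?thesis unfolding rtranclp_power by measurable
qed

definition antitone_nonneg :: "(real \<Rightarrow> real) \<Rightarrow> bool" where
  "antitone_nonneg g \<longleftrightarrow> (\<forall>r s. 0 \<le> r \<longrightarrow> r \<le> s \<longrightarrow> g s \<le> g r)"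

text \<open>Connection functions are unconstrained on negative arguments; the truncation at 0 yields
  a function that is monotone on the whole line and agrees with g at every distance.\<close>

lemma antitone_nonneg_measurable:
  assumes "antitone_nonneg g"
  shows "(\<lambda>r. g (max 0 r)) \<in> borel_measurable borel"
proof -
  have "mono (\<lambda>r. - g (max 0 r))"
    using assms by (auto simp: mono_def antitone_nonneg_def)
  then have "(\<lambda>r. - g (max 0 r)) \<in> borel_measurable borel" by (rule borel_measurable_mono)
  then have "(\<lambda>r. - (- g (max 0 r))) \<in> borel_measurable borel" by (rule borel_measurable_uminus)
  then show ?thesis by simp
qed

text \<open>Measurability is demanded only for positions of labels in W and for keys of distinct
  labels in W, so that the lemma also applies to products over a proper index set, as in
  \<open>relabel_null\<close>.\<close>

lemma pred_gperc:
  fixes V :: "'a \<Rightarrow> 'l::countable set"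
  assumes g: "antitone_nonneg g"
    and [measurable]: "\<And>v. Measurable.pred M (\<lambda>\<omega>. v \<in> V \<omega>)"
    and W: "\<And>\<omega>. V \<omega> \<subseteq> W"
    and X: "\<And>v. v \<in> W \<Longrightarrow> (\<lambda>\<omega>. X \<omega> v) \<in> borel_measurable M"
    and U: "\<And>v w. v \<in> W \<Longrightarrow> w \<in> W \<Longrightarrow> v \<noteq> w \<Longrightarrow> (\<lambda>\<omega>. U \<omega> (gkey v w)) \<in> borel_measurable M"
  shows "Measurable.pred M (\<lambda>\<omega>. gperc g (V \<omega>) (X \<omega>) (U \<omega>))"
proof -
  have [measurable]: "Measurable.pred M (\<lambda>\<omega>. gedge g (V \<omega>) (X \<omega>) (U \<omega>) v w)" for v w
  proof (cases "v \<in> W \<and> w \<in> W \<and> v \<noteq> w")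
    case True
    have [measurable]: "(\<lambda>\<omega>. X \<omega> v) \<in> borel_measurable M" "(\<lambda>\<omega>. X \<omega> w) \<in> borel_measurable M"
      "(\<lambda>\<omega>. U \<omega> (gkey v w)) \<in> borel_measurable M"
      using X U True by auto
    note [measurable] = antitone_nonneg_measurable[OF g]
    have eq: "g (dist (X \<omega> v) (X \<omega> w)) = g (max 0 (dist (X \<omega> v) (X \<omega> w)))" for \<omega> by simp
    have [measurable]: "(\<lambda>\<omega>. g (dist (X \<omega> v) (X \<omega> w))) \<in> borel_measurable M"
      unfolding eq by measurable
    show ?thesis unfolding gedge_def by measurable
  next
    case False
    then have "(\<lambda>\<omega>. gedge g (V \<omega>) (X \<omega>) (U \<omega>) v w) = (\<lambda>_. False)"
      using W by (auto simp: gedge_def)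
    then show ?thesis by simp
  qed
  show ?thesis
    unfolding gperc_def infinite_countable_iff Bex_def mem_Collect_eq by measurable
qed

section \<open>Uniform positions and marks; percolation as an event of
  \<open>RCM_space\<close>\<close>

abbreviation square_unif :: "int \<times> int \<Rightarrow> (real \<times> real) measure" where
  "square_unif s \<equiv> uniform_measure lborel (unit_square s)"

abbreviation unif01 :: "real measure" where
  "unif01 \<equiv> uniform_measure lborel {0..1}"

lemma emeasure_unit_square: "emeasure lborel (unit_square s) = 1"
proof -
  have "emeasure (lborel \<Otimes>\<^sub>M lborel) (unit_square s) =
      emeasure lborel {real_of_int (fst s)..real_of_int (fst s) + 1} *
          emeasure lborel {real_of_int (snd s)..real_of_int (snd s) + 1}"
    unfolding unit_square_def by (rule lborel.emeasure_pair_measure_Times) auto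
  then show ?thesis by (simp add: lborel_prod)
qed

lemma unit_square_borel [measurable]: "unit_square s \<in> sets borel"
  unfolding unit_square_def by (simp add: borel_Times)

lemma prob_square_unif: "prob_space (square_unif s)"
  by (rule prob_space_uniform_measure) (simp_all add: emeasure_unit_square)

lemma prob_unif01: "prob_space unif01"
  by (rule prob_space_uniform_measure) simp_all

lemma AE_square_unif: "AE x in square_unif s. x \<in> unit_square s"
  by (rule AE_uniform_measureI) auto

lemma AE_unif01: "AE x in unif01. 0 \<le> x"
  by (rule AE_uniform_measureI) auto

lemma prob_RCM_space: "prob_space (RCM_space lam)"
  unfolding RCM_space_def
  by (intro prob_space_pair prob_space_PiM prob_square_unif prob_unif01 measure_pmf.prob_space_axioms)

lemma pred_RCM_percolates:
  assumes "antitone_nonneg g"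
  shows "Measurable.pred (RCM_space lam) (RCM_percolates g)"
proof -
  have [measurable]: "(\<lambda>\<omega>. fst \<omega> s) \<in> RCM_space lam \<rightarrow>\<^sub>M count_space UNIV" for s
    unfolding RCM_space_def by (rule measurable_compose[OF measurable_fst]) simp
  have "(\<lambda>\<omega>. fst (snd \<omega>) v) \<in> RCM_space lam \<rightarrow>\<^sub>M square_unif (fst v)" for v :: label
    unfolding RCM_space_def
    by (rule measurable_compose[OF measurable_snd], rule measurable_compose[OF measurable_fst]) simp
  then have X: "(\<lambda>\<omega>. fst (snd \<omega>) v) \<in> borel_measurable (RCM_space lam)" for v :: label
    by (subst measurable_cong_sets[of _ _ _ "square_unif (fst v)"]) simp_all
  have "(\<lambda>\<omega>. snd (snd \<omega>) e) \<in> RCM_space lam \<rightarrow>\<^sub>M unif01" for e :: "label \<times> label"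
    unfolding RCM_space_def
    by (rule measurable_compose[OF measurable_snd], rule measurable_compose[OF measurable_snd]) simp
  then have U: "(\<lambda>\<omega>. snd (snd \<omega>) e) \<in> borel_measurable (RCM_space lam)" for e :: "label \<times> label"
    by (subst measurable_cong_sets[of _ _ _ "unif01"]) simp_all
  show ?thesis
    unfolding RCM_percolates_gperc
    by (rule pred_gperc[OF assms, where W = UNIV]) (auto intro: X U)
qed

lemma RCM_null_iff_AE:
  assumes "antitone_nonneg g"
  shows "measure (RCM_space lam) {\<omega> \<in> space (RCM_space lam). RCM_percolates g \<omega>} = 0 \<longleftrightarrow>
    (AE \<omega> in RCM_space lam. \<not> RCM_percolates g \<omega>)"
proof -
  interpret prob_space "RCM_space lam" by (rule prob_RCM_space)
  have [measurable]: "Measurable.pred (RCM_space lam) (RCM_percolates g)"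
    by (rule pred_RCM_percolates[OF assms])
  have "prob {\<omega> \<in> space (RCM_space lam). RCM_percolates g \<omega>} = 0 \<longleftrightarrow>
      (AE \<omega> in RCM_space lam. \<omega> \<notin> {\<omega> \<in> space (RCM_space lam). RCM_percolates g \<omega>})"
    by (rule prob_eq_0) measurable
  also have "\<dots> \<longleftrightarrow> (AE \<omega> in RCM_space lam. \<not> RCM_percolates g \<omega>)"
    by (rule AE_cong) auto
  finally show ?thesis .
qed

lemma AE_fst:
  assumes "AE x in M. P x" "prob_space N"
  shows "AE x in M \<Otimes>\<^sub>M N. P (fst x)"
proof -
  interpret N: prob_space N by fact
  have "AE x in distr (M \<Otimes>\<^sub>M N) M fst. P x"
    using assms(1) by (subst N.distr_pair_fst)
  then show ?thesis by (rule AE_distrD[OF measurable_fst])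
qed

lemma AE_snd:
  assumes "AE x in N. P x" "prob_space M" "prob_space N"
  shows "AE x in M \<Otimes>\<^sub>M N. P (snd x)"
proof -
  interpret M: prob_space M by fact
  interpret N: prob_space N by fact
  interpret NM: pair_sigma_finite N M ..
  have "AE x in distr (M \<Otimes>\<^sub>M N) (N \<Otimes>\<^sub>M M) (\<lambda>(x, y). (y, x)). P (fst x)"
    using AE_fst[OF assms(1,2)] by (subst NM.distr_pair_swap[symmetric])
  then have "AE x in M \<Otimes>\<^sub>M N. P (fst (case x of (x, y) \<Rightarrow> (y, x)))"
    by (rule AE_distrD[rotated]) simp
  then show ?thesis by (simp add: case_prod_beta)
qed

section \<open>Counting paths of occupied squares\<close>

definition near :: "int \<Rightarrow> int \<times> int \<Rightarrow> int \<times> int \<Rightarrow> bool" where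
  "near R s t \<longleftrightarrow> \<bar>fst s - fst t\<bar> \<le> R \<and> \<bar>snd s - snd t\<bar> \<le> R"

lemma near_sym: "near R s t \<longleftrightarrow> near R t s"
  by (auto simp: near_def)

lemma near_Times: "{t. near R s t} = {fst s - R..fst s + R} \<times> {snd s - R..snd s + R}"
  by (auto simp: near_def)

lemma finite_near [simp]: "finite {t. near R s t}"
  by (simp add: near_Times)

lemma card_near: "0 \<le> R \<Longrightarrow> card {t. near R s t} = nat (2 * R + 1) ^ 2"
  by (simp add: near_Times card_cartesian_product power2_eq_square)

text \<open>The summand 1 in the bound on R is the side length: a point may lie anywhere in its
  square.\<close>

lemma dist_square_near:
  assumes "x \<in> unit_square s" "y \<in> unit_square t" "dist x y \<le> A" "A + 1 \<le> real_of_int R"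
  shows "near R s t"
proof -
  have "\<bar>fst x - fst y\<bar> \<le> A" "\<bar>snd x - snd y\<bar> \<le> A"
    using dist_fst_le[of x y] dist_snd_le[of x y] assms(3) by (auto simp: dist_real_def)
  then have "\<bar>real_of_int (fst s - fst t)\<bar> \<le> real_of_int R" "\<bar>real_of_int (snd s - snd t)\<bar> \<le>
      real_of_int R"
    using assms(1,2,4) by (auto simp: unit_square_def mem_Times_iff)
  then show ?thesis unfolding near_def by linarith
qed


text \<open>The most recent square is the head of the list, and n counts steps, so these lists have
  length \<open>Suc n\<close>.\<close>

fun square_paths :: "int \<Rightarrow> nat \<Rightarrow> int \<times> int \<Rightarrow> (int \<times> int) list set" where
  "square_paths R 0 s = {[s]}"
| "square_paths R (Suc n) s = (\<Union>p\<in>square_paths R n s. (\<lambda>t. t # p) ` {t. near R (hd p) t})"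

lemma finite_square_paths [simp]: "finite (square_paths R n s)"
  by (induction n) auto

lemma card_square_paths: "0 \<le> R \<Longrightarrow> card (square_paths R n s) \<le> (nat (2 * R + 1) ^ 2) ^ n"
proof (induction n)
  case (Suc n)
  have "card (square_paths R (Suc n) s) \<le> (\<Sum>p\<in>square_paths R n s. card ((\<lambda>t. t # p) ` {t. near R (hd p)
      t}))"
    unfolding square_paths.simps by (rule card_UN_le) simp
  also have "\<dots> \<le> (\<Sum>p\<in>square_paths R n s. nat (2 * R + 1) ^ 2)"
    by (intro sum_mono) (metis card_image_le[OF finite_near] card_near[OF Suc.prems])
  also have "\<dots> = card (square_paths R n s) * nat (2 * R + 1) ^ 2" by simp
  also have "\<dots> \<le> (nat (2 * R + 1) ^ 2) ^ n * nat (2 * R + 1) ^ 2" using Suc by simp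
  finally show ?case by (simp add: mult.commute)
qed simp

lemma length_square_paths: "p \<in> square_paths R n s \<Longrightarrow> length p = Suc n"
  by (induction n arbitrary: p) auto

lemma square_paths_of_fun:
  assumes "h 0 = s" "\<And>i. i < n \<Longrightarrow> near R (h i) (h (Suc i))"
  shows "map h (rev [0..<Suc n]) \<in> square_paths R n s"
  using assms(2)
proof (induction n)
  case (Suc n)
  have "map h (rev [0..<Suc n]) \<in> square_paths R n s" using Suc by simp
  moreover have "hd (map h (rev [0..<Suc n])) = h n" by (simp add: hd_map)
  moreover have "near R (h n) (h (Suc n))" using Suc.prems by simp
  ultimately show ?case by force
qed (simp add: assms(1))

text \<open>Only finitely many squares can be reached in fewer than n steps, so some reachable t
  needs at least n. A shortest path to t never repeats a square, since a repetition could be cut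
  out, and its first n steps are the required h.\<close>

lemma infinite_reachable_path:
  assumes E: "\<And>s t. E s t \<Longrightarrow> near R s t"
    and inf: "infinite {t. E\<^sup>*\<^sup>* s t}"
  shows "\<exists>h. h 0 = s \<and> (\<forall>i<n. E (h i) (h (Suc i))) \<and> inj_on h {..n}"
proof -
  have fin: "finite {t. (E ^^ k) s t}" for k
  proof (induction k)
    case (Suc k)
    have "{t. (E ^^ Suc k) s t} \<subseteq> (\<Union>u\<in>{u. (E ^^ k) s u}. {t. near R u t})"
      using E by (auto simp: relcompp.simps)
    then show ?case by (rule finite_subset) (use Suc in auto)
  qed simp
  have "\<not> {t. E\<^sup>*\<^sup>* s t} \<subseteq> (\<Union>k<n. {t. (E ^^ k) s t})"
    using inf fin finite_subset by (metis (no_types, lifting) finite_UN finite_lessThan)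
  then obtain t where t: "E\<^sup>*\<^sup>* s t" "\<And>k. k < n \<Longrightarrow> \<not> (E ^^ k) s t" by blast
  define k where "k = (LEAST k. (E ^^ k) s t)"
  have "\<exists>k. (E ^^ k) s t" using t(1) by (simp add: rtranclp_power)
  then have k: "(E ^^ k) s t" and min: "\<And>j. (E ^^ j) s t \<Longrightarrow> k \<le> j"
    unfolding k_def by (auto intro: LeastI_ex Least_le)
  have "n \<le> k" using t(2) k by (meson not_less)
  obtain h where h: "h 0 = s" "h k = t" "\<And>i. i < k \<Longrightarrow> E (h i) (h (Suc i))"
    using k by (auto simp: relpowp_fun_conv)
  have seg: "(E ^^ (j - i)) (h i) (h j)" if "i \<le> j" "j \<le> k" for i j
    unfolding relpowp_fun_conv
    by (rule exI[of _ "\<lambda>l. h (i + l)"]) (use that h(3) in auto)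
  have "inj_on h {..k}"
  proof (rule linorder_inj_onI)
    fix i j assume ij: "i < j" "i \<in> {..k}" "j \<in> {..k}"
    show "h i \<noteq> h j"
    proof
      assume eq: "h i = h j"
      have "(E ^^ i) s (h j)" using seg[of 0 i] ij h(1) eq by simp
      moreover have "(E ^^ (k - j)) (h j) t" using seg[of j k] ij h(2) by simp
      ultimately have "(E ^^ (i + (k - j))) s t" by (auto simp: relpowp_add)
      then show False using min ij by fastforce
    qed
  qed auto
  then have "inj_on h {..n}" using \<open>n \<le> k\<close> by (auto intro: inj_on_subset)
  then show ?thesis using h \<open>n \<le> k\<close> by (intro exI[of _ h]) auto
qed

lemma prob_poisson_pos_le:
  assumes "0 < lam"
  shows "measure_pmf.prob (poisson_pmf lam) {n. 1 \<le> n} \<le> lam"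
proof -
  have "{n::nat. 1 \<le> n} = UNIV - {0}" by auto
  then have "measure_pmf.prob (poisson_pmf lam) {n. 1 \<le> n} = 1 - pmf (poisson_pmf lam) 0"
    using measure_pmf.prob_compl[of "{0}" "poisson_pmf lam"] by (simp add: pmf.rep_eq)
  also have "\<dots> = 1 - exp (- lam)" using assms by simp
  also have "\<dots> \<le> lam" using exp_ge_add_one_self[of "- lam"] by simp
  finally show ?thesis .
qed

text \<open>First moment bound: with D squares in a neighbourhood there are at most
  \<open>D ^ n\<close> paths of n steps, and a path with \<open>Suc n\<close> distinct squares is
  occupied with probability at most \<open>lam ^ Suc n\<close>. Distinctness is what makes the
  occupation events independent.\<close>

lemma AE_no_long_occupied_path:
  fixes lam :: real
  assumes lam: "0 < lam" and R: "0 \<le> R" and small: "lam * real (nat (2 * R + 1) ^ 2) < 1"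
  shows "AE N in PiM UNIV (\<lambda>_ :: int \<times> int. measure_pmf (poisson_pmf lam)).
    \<exists>n. \<not> (\<exists>p\<in>square_paths R n s. distinct p \<and> (\<forall>t\<in>set p. 1 \<le> N t))"
proof -
  let ?D = "real (nat (2 * R + 1) ^ 2)"
  interpret univ_product "\<lambda>_ :: int \<times> int. measure_pmf (poisson_pmf lam)"
    by unfold_locales (rule measure_pmf.emeasure_space_1)
  let ?O = "\<lambda>p. {N \<in> space \<Omega>. \<forall>t\<in>set p. 1 \<le> N t}"
  let ?Q = "\<lambda>n. {p \<in> square_paths R n s. distinct p}"
  let ?B = "\<lambda>n. \<Union>p\<in>?Q n. ?O p"
  have O_sets: "?O p \<in> P.events" for p by measurable
  have PO: "P.prob (?O p) \<le> lam ^ Suc n" if "p \<in> ?Q n" for p n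
  proof -
    have "P.prob (?O p) = (\<Prod>t\<in>set p. P.prob {N \<in> space \<Omega>. 1 \<le> N t})"
      by (rule prob_ball_depends_on[where J = "\<lambda>t. {t}"])
        (auto simp: disjoint_family_on_def depends_on_def)
    also have "\<dots> = (\<Prod>t\<in>set p. measure_pmf.prob (poisson_pmf lam) {n. 1 \<le> n})"
      using prob_coordinate[of "{n. 1 \<le> n}"] by simp
    also have "\<dots> = measure_pmf.prob (poisson_pmf lam) {n. 1 \<le> n} ^ Suc n"
      using that length_square_paths[of p R n s] distinct_card[of p] by simp
    also have "\<dots> \<le> lam ^ Suc n"
      by (intro power_mono prob_poisson_pos_le lam) simp
    finally show ?thesis .
  qed
  have PB: "P.prob (?B n) \<le> lam * (lam * ?D) ^ n" for n
  proof -
    have "P.prob (?B n) \<le> (\<Sum>p\<in>?Q n. P.prob (?O p))"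
      by (rule P.finite_measure_subadditive_finite) (use O_sets in auto)
    also have "\<dots> \<le> (\<Sum>p\<in>?Q n. lam ^ Suc n)" by (intro sum_mono PO)
    also have "\<dots> = real (card (?Q n)) * lam ^ Suc n" by simp
    also have "\<dots> \<le> ?D ^ n * lam ^ Suc n"
    proof (intro mult_right_mono)
      have "card (?Q n) \<le> card (square_paths R n s)" by (intro card_mono) auto
      also have "\<dots> \<le> (nat (2 * R + 1) ^ 2) ^ n" by (rule card_square_paths[OF R])
      finally show "real (card (?Q n)) \<le> ?D ^ n" by (metis of_nat_le_iff of_nat_power)
    qed (use lam in simp)
    also have "\<dots> = lam * (lam * ?D) ^ n" by (simp add: power_mult_distrib)
    finally show ?thesis .
  qed
  have B_sets: "?B n \<in> P.events" for n by (rule sets.finite_UN) (use O_sets in auto)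
  have "P.prob (\<Inter>n. ?B n) \<le> lam * (lam * ?D) ^ n" for n
    using P.finite_measure_mono[of "\<Inter>n. ?B n" "?B n"] B_sets PB[of n]
        by (meson INF_lower UNIV_I order_trans)
  moreover have "(\<lambda>n. lam * (lam * ?D) ^ n) \<longlonglongrightarrow> lam * 0"
    by (intro tendsto_mult tendsto_const LIMSEQ_realpow_zero) (use lam small in auto)
  ultimately have "P.prob (\<Inter>n. ?B n) \<le> 0"
    by (intro LIMSEQ_le_const[where X = "\<lambda>n. lam * (lam * ?D) ^ n"]) auto
  then have "P.prob (\<Inter>n. ?B n) = 0" by (simp add: measure_le_0_iff)
  moreover have "(\<Inter>n. ?B n) \<in> P.events" using B_sets by auto
  ultimately have "AE N in \<Omega>. N \<notin> (\<Inter>n. ?B n)" using P.prob_eq_0 by blast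
  then show ?thesis by (rule AE_mp) (auto intro!: AE_I2)
qed

lemma AE_RCM_regular:
  "AE \<omega> in RCM_space lam. (\<forall>v. fst (snd \<omega>) v \<in> unit_square (fst v)) \<and> (\<forall>e. 0 \<le> snd (snd \<omega>) e)"
proof -
  have X: "AE X in PiM UNIV (\<lambda>v::label. square_unif (fst v)). \<forall>v. X v \<in> unit_square (fst v)"
    unfolding AE_all_countable
    by (intro allI AE_PiM_component prob_square_unif AE_square_unif) auto
  have U: "AE U in PiM UNIV (\<lambda>e::label \<times> label. unif01). \<forall>e. 0 \<le> U e"
    unfolding AE_all_countable
    by (intro allI AE_PiM_component prob_unif01 AE_unif01) auto
  note P = prob_space_PiM[OF prob_square_unif] prob_space_PiM[OF prob_unif01]
    prob_space_PiM[OF measure_pmf.prob_space_axioms]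
  show ?thesis
    unfolding RCM_space_def
  proof (rule AE_snd[where P = "\<lambda>x. (\<forall>v. fst x v \<in> unit_square (fst v)) \<and> (\<forall>e. 0 \<le> snd x e)"])
    show "AE x in PiM UNIV (\<lambda>v::label. square_unif (fst v)) \<Otimes>\<^sub>M PiM UNIV (\<lambda>e::label \<times> label. unif01).
        (\<forall>v. fst x v \<in> unit_square (fst v)) \<and> (\<forall>e. 0 \<le> snd x e)"
      by (rule AE_conjI[OF AE_fst[OF X] AE_snd[OF U]]) (rule P)+
  qed (intro prob_space_pair P)+
qed

text \<open>An edge joins points of near occupied squares, and each square holds finitely many
  points. An infinite cluster therefore visits infinitely many squares and would contain occupied
  self-avoiding square paths of every length.\<close>

lemma RCM_subcritical:
  assumes range: "\<And>r. 0 \<le> r \<Longrightarrow> 0 < g r \<Longrightarrow> r \<le> A" and R: "A + 1 \<le> real_of_int R" "0 \<le> R"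
    and lam: "0 < lam" "lam * real (nat (2 * R + 1) ^ 2) < 1"
  shows "AE \<omega> in RCM_space lam. \<not> RCM_percolates g \<omega>"
proof -
  have "AE N in PiM UNIV (\<lambda>_ :: int \<times> int. measure_pmf (poisson_pmf lam)).
      \<forall>s. \<exists>n. \<not> (\<exists>p\<in>square_paths R n s. distinct p \<and> (\<forall>t\<in>set p. 1 \<le> N t))"
    unfolding AE_all_countable using AE_no_long_occupied_path[OF lam(1) R(2) lam(2)] by blast
  then have 1: "AE \<omega> in RCM_space lam.
      \<forall>s. \<exists>n. \<not> (\<exists>p\<in>square_paths R n s. distinct p \<and> (\<forall>t\<in>set p. 1 \<le> fst \<omega> t))"
    unfolding RCM_space_def
    by (rule AE_fst) (intro prob_space_pair prob_space_PiM prob_square_unif prob_unif01)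
  show ?thesis
    using 1 AE_RCM_regular
  proof eventually_elim
    case (elim \<omega>)
    let ?N = "fst \<omega>"
    have near_edge: "near R (fst v) (fst w) \<and> snd v < ?N (fst v) \<and> snd w < ?N (fst w)" if
        "RCM_edge g \<omega> v w" for v w
    proof -
      have "0 < g (dist (fst (snd \<omega>) v) (fst (snd \<omega>) w))"
        using that elim(2) unfolding RCM_edge_def by (meson le_less_trans)
      then have "dist (fst (snd \<omega>) v) (fst (snd \<omega>) w) \<le> A" by (intro range) auto
      then show ?thesis
        using dist_square_near[of "fst (snd \<omega>) v" "fst v" "fst (snd \<omega>) w" "fst w" A R] elim(2) R(1) that
        by (auto simp: RCM_edge_def RCM_active_def)
    qed
    show ?case
    proof
      assume "RCM_percolates g \<omega>"
      then obtain v where v: "snd v < ?N (fst v)" "infinite {w. (RCM_edge g \<omega>)\<^sup>*\<^sup>* v w}"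
        by (auto simp: RCM_percolates_def RCM_active_def)
      let ?C = "{w. (RCM_edge g \<omega>)\<^sup>*\<^sup>* v w}"
      define E where "E = (\<lambda>s t. near R s t \<and> 1 \<le> ?N s \<and> 1 \<le> ?N t)"
      have reach: "E\<^sup>*\<^sup>* (fst v) (fst w) \<and> snd w < ?N (fst w)" if "(RCM_edge g \<omega>)\<^sup>*\<^sup>* v w" for w
        using that
      proof induction
        case (step w u)
        then show ?case using near_edge[OF step(2)]
          by (auto simp: E_def intro!: rtranclp.rtrancl_into_rtrancl[of _ _ "fst w"])
      qed (use v in simp)
      have "infinite (fst ` ?C)"
      proof
        assume "finite (fst ` ?C)"
        moreover have "?C \<subseteq> (SIGMA s:fst ` ?C. {..<?N s})" using reach by force
        ultimately show False using v(2) by (meson finite_SigmaI finite_lessThan finite_subset)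
      qed
      moreover have "fst ` ?C \<subseteq> {t. E\<^sup>*\<^sup>* (fst v) t}" using reach by auto
      ultimately have inf: "infinite {t. E\<^sup>*\<^sup>* (fst v) t}" using finite_subset by blast
      obtain n where n: "\<not> (\<exists>p\<in>square_paths R n (fst v). distinct p \<and> (\<forall>t\<in>set p. 1 \<le> ?N t))"
        using elim(1) by blast
      obtain h where h: "h 0 = fst v" "\<And>i. i < n \<Longrightarrow> E (h i) (h (Suc i))" "inj_on h {..n}"
        using infinite_reachable_path[of E R "fst v" n, OF _ inf] by (auto simp: E_def)
      have occ: "1 \<le> ?N (h i)" if "i \<le> n" for i
      proof (cases i)
        case 0 then show ?thesis using v(1) h(1) by simp
      next
        case (Suc j) then show ?thesis using h(2)[of j] that by (simp add: E_def)
      qed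
      have "map h (rev [0..<Suc n]) \<in> square_paths R n (fst v)"
        by (rule square_paths_of_fun) (use h(1,2) in \<open>auto simp: E_def\<close>)
      moreover have "distinct (map h (rev [0..<Suc n]))"
        using h(3) by (auto simp: distinct_map atLeast0LessThan lessThan_Suc_atMost simp del: upt_Suc)
      moreover have "\<forall>t\<in>set (map h (rev [0..<Suc n])). 1 \<le> ?N t" using occ by (auto simp del: upt_Suc)
      ultimately show False using n by blast
    qed
  qed
qed

section \<open>Renormalised site percolation\<close>

definition sub_offsets :: "(int \<times> int) set" where
  "sub_offsets = {0, 1, 2} \<times> {0, 1, 2}"

definition subbox :: "int \<times> int \<Rightarrow> int \<times> int \<Rightarrow> int \<times> int" where
  "subbox x d = (3 * fst x + fst d, 3 * snd x + snd d)"

text \<open>A box is good if at most one of its 3x3 subboxes is bad. Two adjacent good boxes then have a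
  pair of adjacent good subboxes on their common side, and the good subboxes of a good box form a
  connected grid, so no planar duality is needed.\<close>

fun box_good :: "(int \<times> int \<Rightarrow> bool) \<Rightarrow> nat \<Rightarrow> int \<times> int \<Rightarrow> bool" where
  "box_good Q 0 x = Q x"
| "box_good Q (Suc n) x = (\<forall>d\<in>sub_offsets. \<forall>d'\<in>sub_offsets. d \<noteq> d' \<longrightarrow>
      box_good Q n (subbox x d) \<or> box_good Q n (subbox x d'))"

text \<open>The sites that are reached by descending through good subboxes only; good sites inside a
  bad subbox are ignored, which is why this set lies in a single component.\<close>

fun giant :: "(int \<times> int \<Rightarrow> bool) \<Rightarrow> nat \<Rightarrow> int \<times> int \<Rightarrow> (int \<times> int) set" where
  "giant Q 0 x = {x}"
| "giant Q (Suc n) x = (\<Union>d\<in>{d \<in> sub_offsets. box_good Q n (subbox x d)}. giant Q n (subbox x d))"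

fun box_sites :: "nat \<Rightarrow> int \<times> int \<Rightarrow> (int \<times> int) set" where
  "box_sites 0 x = {x}"
| "box_sites (Suc n) x = (\<Union>d\<in>sub_offsets. box_sites n (subbox x d))"

text \<open>Oriented to the right and upwards. It is used to derive equality of components, so one
  orientation suffices.\<close>

definition lattice_adj :: "int \<times> int \<Rightarrow> int \<times> int \<Rightarrow> bool" where
  "lattice_adj x y \<longleftrightarrow> y = (fst x + 1, snd x) \<or> y = (fst x, snd x + 1)"

text \<open>Rows and columns that avoid the exceptional offset b are constant for r. Every other
  offset lies in such a row or in such a column, and these all meet each other.\<close>

lemma grid_minus_one_connected:
  fixes r :: "int \<times> int \<Rightarrow> 'c"
  assumes one: "\<And>d d'. d \<in> sub_offsets \<Longrightarrow> d' \<in> sub_offsets \<Longrightarrow> d \<noteq> d' \<Longrightarrow> g d \<or> g d'"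
    and step: "\<And>d d'. d \<in> sub_offsets \<Longrightarrow> d' \<in> sub_offsets \<Longrightarrow> lattice_adj d d' \<Longrightarrow> g d \<Longrightarrow> g d' \<Longrightarrow> r d = r d'"
    and d: "d \<in> sub_offsets" "d' \<in> sub_offsets" "g d" "g d'"
  shows "r d = r d'"
proof -
  \<comment> \<open>If no offset is bad, any offset serves as b; so b may itself be good.\<close>
  obtain b where b: "b \<in> sub_offsets" "\<And>e. e \<in> sub_offsets \<Longrightarrow> e \<noteq> b \<Longrightarrow> g e"
    using one d(1) by metis
  have h: "r (i, j) = r (i + 1, j)" if "i \<in> {0, 1}" "j \<in> {0, 1, 2}" "b \<noteq> (i, j)" "b \<noteq> (i + 1, j)" for i j
  proof (rule step)
    show "(i, j) \<in> sub_offsets" "(i + 1, j) \<in> sub_offsets" "lattice_adj (i, j) (i + 1, j)"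
      using that(1,2) by (auto simp: sub_offsets_def lattice_adj_def)
    then show "g (i, j)" "g (i + 1, j)" using b(2) that(3,4) by metis+
  qed
  have v: "r (i, j) = r (i, j + 1)" if "i \<in> {0, 1, 2}" "j \<in> {0, 1}" "b \<noteq> (i, j)" "b \<noteq> (i, j + 1)" for i j
  proof (rule step)
    show "(i, j) \<in> sub_offsets" "(i, j + 1) \<in> sub_offsets" "lattice_adj (i, j) (i, j + 1)"
      using that(1,2) by (auto simp: sub_offsets_def lattice_adj_def)
    then show "g (i, j)" "g (i, j + 1)" using b(2) that(3,4) by metis+
  qed
  have row: "r (i, j) = r (i', j)" if "i \<in> {0, 1, 2}" "i' \<in> {0, 1, 2}" "j \<in> {0, 1, 2}" "j \<noteq> snd b" for i
      i' j
  proof -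
    have "r (0, j) = r (1, j)" "r (1, j) = r (2, j)" using h[of 0 j] h[of 1 j] that(3,4) by fastforce+
    then show ?thesis using that(1,2) by auto
  qed
  have col: "r (i, j) = r (i, j')" if "j \<in> {0, 1, 2}" "j' \<in> {0, 1, 2}" "i \<in> {0, 1, 2}" "i \<noteq> fst b" for i j
      j'
  proof -
    have "r (i, 0) = r (i, 1)" "r (i, 1) = r (i, 2)" using v[of i 0] v[of i 1] that(3,4) by fastforce+
    then show ?thesis using that(1,2) by auto
  qed
  \<comment> \<open>The reference offset is the crossing of a column and a row that both avoid
    b.\<close>
  obtain i0 j0 :: int where ij: "i0 \<in> {0, 1, 2}" "i0 \<noteq> fst b" "j0 \<in> {0, 1, 2}" "j0 \<noteq> snd b"
    by (metis insertCI zero_neq_one)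
  have ref: "r e = r (i0, j0)" if e: "e \<in> sub_offsets" "e \<noteq> b" for e
  proof -
    obtain i j where e': "e = (i, j)" "i \<in> {0, 1, 2}" "j \<in> {0, 1, 2}" using e(1)
        by (auto simp: sub_offsets_def)
    show ?thesis
    proof (cases "i = fst b")
      case True
      then have "j \<noteq> snd b" using e(2) e'(1) by (auto simp: prod_eq_iff)
      then have "r (i, j) = r (i0, j)" by (rule row[OF e'(2) ij(1) e'(3)])
      also have "\<dots> = r (i0, j0)" by (rule col[OF e'(3) ij(3,1,2)])
      finally show ?thesis by (simp add: e'(1))
    next
      case False
      have "r (i, j) = r (i, j0)" by (rule col[OF e'(3) ij(3) e'(2) False])
      also have "\<dots> = r (i0, j0)" by (rule row[OF e'(2) ij(1,3,4)])
      finally show ?thesis by (simp add: e'(1))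
    qed
  qed
  have all: "r e = r e'" if "e \<in> sub_offsets" "e' \<in> sub_offsets" "e \<noteq> b" "e' \<noteq> b" for e e'
    using ref that by metis
  show ?thesis
  proof (cases "g b")
    \<comment> \<open>A good b is attached through its horizontal neighbour inside the grid, to the
      left of b when b is in the last column.\<close>
    case True
    have "\<exists>e\<in>sub_offsets. e \<noteq> b \<and> r e = r b"
    proof -
      have "\<exists>e\<in>sub_offsets. lattice_adj b e \<or> lattice_adj e b"
        by (rule bexI[of _ "if fst b = 2 then (1, snd b) else (fst b + 1, snd b)"])
          (use b(1) in \<open>auto simp: sub_offsets_def lattice_adj_def prod_eq_iff\<close>)
      then obtain e where e: "e \<in> sub_offsets" "lattice_adj b e \<or> lattice_adj e b" by blast
      then have "e \<noteq> b" by (auto simp: lattice_adj_def prod_eq_iff)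
      moreover have "r e = r b" using step[of b e] step[of e b] e b True \<open>e \<noteq> b\<close> by metis
      ultimately show ?thesis using e by blast
    qed
    then show ?thesis using all d b by metis
  next
    case False
    then show ?thesis using all d by metis
  qed
qed

text \<open>Three pairs of subboxes face each other across the common side. Each of the two good
  boxes spoils at most one of them, so at least one pair is intact.\<close>

lemma adjacent_box_pair:
  assumes "box_good Q (Suc n) x" "box_good Q (Suc n) y" "lattice_adj x y"
  obtains d d' where "d \<in> sub_offsets" "d' \<in> sub_offsets" "box_good Q n (subbox x d)" "box_good Q n
      (subbox y d')"
    "lattice_adj (subbox x d) (subbox y d')"
proof -
  let ?g = "\<lambda>x d. box_good Q n (subbox x d)"
  have one: "?g z d \<or> ?g z d'" if "z \<in> {x, y}" "d \<in> sub_offsets" "d' \<in> sub_offsets" "d \<noteq> d'" for z d d'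
    using assms that by auto
  consider "y = (fst x + 1, snd x)" | "y = (fst x, snd x + 1)" using assms(3)
      by (auto simp: lattice_adj_def)
  then show thesis
  proof cases
    case 1
    have "\<exists>j\<in>{0, 1, 2}. ?g x (2, j) \<and> ?g y (0, j)"
      using one[of x "(2,0)" "(2,1)"] one[of x "(2,0)" "(2,2)"] one[of x "(2,1)" "(2,2)"]
        one[of y "(0,0)" "(0,1)"] one[of y "(0,0)" "(0,2)"] one[of y "(0,1)" "(0,2)"]
      unfolding sub_offsets_def by auto
    then obtain j where "j \<in> {0, 1, 2}" "?g x (2, j)" "?g y (0, j)" by blast
    then show thesis by (intro that[of
        "(2, j)" "(0, j)"]) (use 1 in \<open>auto simp: sub_offsets_def lattice_adj_def subbox_def\<close>)
  next
    case 2
    have "\<exists>j\<in>{0, 1, 2}. ?g x (j, 2) \<and> ?g y (j, 0)"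
      using one[of x "(0,2)" "(1,2)"] one[of x "(0,2)" "(2,2)"] one[of x "(1,2)" "(2,2)"]
        one[of y "(0,0)" "(1,0)"] one[of y "(0,0)" "(2,0)"] one[of y "(1,0)" "(2,0)"]
      unfolding sub_offsets_def by auto
    then obtain j where "j \<in> {0, 1, 2}" "?g x (j, 2)" "?g y (j, 0)" by blast
    then show thesis by (intro that[of
        "(j, 2)" "(j, 0)"]) (use 2 in \<open>auto simp: sub_offsets_def lattice_adj_def subbox_def\<close>)
  qed
qed

lemma giant_nonempty: "box_good Q n x \<Longrightarrow> giant Q n x \<noteq> {}"
proof (induction n arbitrary: x)
  case (Suc n)
  have "box_good Q n (subbox x (0, 0)) \<or> box_good Q n (subbox x (0, 1))"
    using Suc.prems by (auto simp: sub_offsets_def)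
  then obtain d where "d \<in> sub_offsets" "box_good Q n (subbox x d)" by (auto simp: sub_offsets_def)
  moreover obtain u where "u \<in> giant Q n (subbox x d)" using Suc.IH calculation by blast
  ultimately have "u \<in> giant Q (Suc n) x" unfolding giant.simps by blast
  then show ?case by blast
qed simp

lemma giant_occupied: "box_good Q n x \<Longrightarrow> u \<in> giant Q n x \<Longrightarrow> Q u"
proof (induction n arbitrary: x)
  case (Suc n)
  then show ?case unfolding giant.simps by blast
qed simp

text \<open>The function c plays the role of the component of a site. The cases of equal and of
  adjacent boxes are proved together, because connectedness inside a box at level
  \<open>Suc n\<close> uses adjacent boxes at level n.\<close>

lemma giant_one_component:
  assumes adj: "\<And>x y. Q x \<Longrightarrow> Q y \<Longrightarrow> lattice_adj x y \<Longrightarrow> c x = c y"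
  shows "box_good Q n x \<Longrightarrow> box_good Q n y \<Longrightarrow> x = y \<or> lattice_adj x y \<Longrightarrow>
    u \<in> giant Q n x \<Longrightarrow> v \<in> giant Q n y \<Longrightarrow> c u = c v"
proof (induction n arbitrary: x y u v)
  case 0
  then show ?case using adj[of x y] by (auto simp del: split_paired_All)
next
  case (Suc n)
  \<comment> \<open>By the induction hypothesis for equal boxes, c is constant on the giant of a
    good box, so any chosen element represents it.\<close>
  define r where "r z = c (SOME u. u \<in> giant Q n z)" for z
  have r: "c u = r z" if "box_good Q n z" "u \<in> giant Q n z" for u z
    unfolding r_def using Suc.IH[of z z] that someI[of "\<lambda>u. u \<in> giant Q n z"] by blast
  have radj: "r z = r z'" if "box_good Q n z" "box_good Q n z'" "lattice_adj z z'" for z z'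
    using giant_nonempty[OF that(1)] giant_nonempty[OF that(2)] Suc.IH[OF that(1,2)] that r by fastforce
  have rbox: "r (subbox z d) = r (subbox z d')"
    if "box_good Q (Suc n) z" "d \<in> sub_offsets" "d' \<in> sub_offsets"
      "box_good Q n (subbox z d)" "box_good Q n (subbox z d')" for z d d'
    by (rule grid_minus_one_connected[where g = "\<lambda>d. box_good Q n (subbox z d)" and r =
        "\<lambda>d. r (subbox z d)"])
      (use that radj in \<open>auto simp: lattice_adj_def subbox_def\<close>)
  obtain d where d: "d \<in> sub_offsets" "box_good Q n (subbox x d)" "u \<in> giant Q n (subbox x d)"
    using Suc.prems(4) by auto
  obtain e where e: "e \<in> sub_offsets" "box_good Q n (subbox y e)" "v \<in> giant Q n (subbox y e)"
    using Suc.prems(5) by auto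
  have "r (subbox x d) = r (subbox y e)"
  proof (cases "x = y")
    case True
    then show ?thesis using rbox[OF Suc.prems(1)] d e by blast
  next
    case False
    then obtain d' e' where "d' \<in> sub_offsets" "e' \<in> sub_offsets" "box_good Q n (subbox x d')" "box_good Q
        n (subbox y e')"
      "lattice_adj (subbox x d') (subbox y e')"
      using adjacent_box_pair[OF Suc.prems(1,2)] Suc.prems(3) by blast
    then show ?thesis
      using rbox[OF Suc.prems(1), of d d'] rbox[OF Suc.prems(2), of e e'] radj[of
          "subbox x d'" "subbox y e'"] d e by simp
  qed
  then show ?case using r d e by metis
qed

lemma giant_fst_lower: "u \<in> giant Q n x \<Longrightarrow> 3 ^ n * fst x \<le> fst u"
proof (induction n arbitrary: x)
  case (Suc n)
  then obtain d where "d \<in> sub_offsets" "u \<in> giant Q n (subbox x d)" by auto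
  then have "3 ^ n * (3 * fst x + fst d) \<le> fst u" "0 \<le> fst d" using Suc.IH
      by (fastforce simp: subbox_def sub_offsets_def)+
  moreover have "3 ^ n * (3 * fst x) \<le> 3 ^ n * (3 * fst x + fst d)" using \<open>0 \<le> fst d\<close> by simp
  ultimately have "3 ^ n * (3 * fst x) \<le> fst u" by linarith
  then show ?case by (simp add: mult.assoc mult.left_commute)
qed simp

text \<open>The box (0, 0) of level n is the lower left subbox of the box (0, 0) of level
  \<open>Suc n\<close>, so the giants increase, and their union lies in one component.\<close>

lemma infinite_component_of_good_boxes:
  assumes adj: "\<And>x y. Q x \<Longrightarrow> Q y \<Longrightarrow> lattice_adj x y \<Longrightarrow> c x = c y"
    and good: "\<And>n. box_good Q n (0, 0)"
  shows "\<exists>S. infinite S \<and> (\<forall>s\<in>S. Q s) \<and> (\<forall>s\<in>S. \<forall>t\<in>S. c s = c t)"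
proof -
  define S where "S = (\<Union>n. giant Q n (0, 0))"
  have mono: "giant Q n (0, 0) \<subseteq> giant Q (Suc n) (0, 0)" for n
  proof -
    have "(0, 0) \<in> sub_offsets" "subbox (0, 0) (0, 0) = (0, 0)" by (auto simp: sub_offsets_def subbox_def)
    then show ?thesis using good[of n] by force
  qed
  have mono': "n \<le> m \<Longrightarrow> giant Q n (0, 0) \<subseteq> giant Q m (0, 0)" for n m
    using lift_Suc_mono_le[of "\<lambda>n. giant Q n (0, 0)"] mono by blast
  have same: "c s = c t" if st: "s \<in> S" "t \<in> S" for s t
  proof -
    obtain n m where "s \<in> giant Q n (0, 0)" "t \<in> giant Q m (0, 0)" using st unfolding S_def by blast
    then have "s \<in> giant Q (max n m) (0, 0)" "t \<in> giant Q (max n m) (0, 0)" using mono'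
        by (meson max.cobounded1 max.cobounded2 subsetD)+
    then show ?thesis using giant_one_component[of Q c, OF adj good good] by blast
  qed
  have "\<exists>s\<in>S. int n \<le> fst s" for n
  proof -
    \<comment> \<open>Two different subboxes of the last column cannot both be bad, and the giant of
      the good one has first coordinates of at least \<open>2 * 3 ^ n\<close>. This makes the union
      unbounded.\<close>
    have "box_good Q n (subbox (0, 0) (2, 0)) \<or> box_good Q n (subbox (0, 0) (2, 1))"
      using good[of "Suc n"] by (auto simp: sub_offsets_def)
    then obtain j where j: "(2, j) \<in> sub_offsets" "box_good Q n (subbox (0, 0) (2, j))" by (auto simp:
        sub_offsets_def)
    then obtain u where u: "u \<in> giant Q n (subbox (0, 0) (2, j))" using giant_nonempty by blast
    have "u \<in> giant Q (Suc n) (0, 0)" using j u by auto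
    then have "u \<in> S" unfolding S_def by blast
    moreover have "3 ^ n * 2 \<le> fst u" using giant_fst_lower[OF u] by (simp add: subbox_def)
    moreover have "int n \<le> 3 ^ n" using of_nat_less_two_power[of n, where 'a=int] power_mono[of
        "2::int" 3 n] by linarith
    moreover have "(0::int) \<le> 3 ^ n" by simp
    ultimately show ?thesis by (intro bexI[of _ u]) linarith+
  qed
  moreover have "\<exists>n. \<forall>s\<in>S. fst s < int n" if "finite S"
  proof -
    have "bdd_above (fst ` S)" using that by simp
    then obtain b where "\<And>s. s \<in> S \<Longrightarrow> fst s \<le> b" by (auto simp: bdd_above_def)
    then show ?thesis by (intro exI[of _ "nat (b + 1)"]) force
  qed
  ultimately have "infinite S" by (meson not_le)
  moreover have "\<forall>s\<in>S. Q s" unfolding S_def using giant_occupied[OF good] by blast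
  ultimately show ?thesis using same by blast
qed

text \<open>A site determines its box at each level, so different boxes of one level have disjoint
  sites and hence independent states.\<close>

lemma box_sites_div: "s \<in> box_sites n x \<Longrightarrow> x = (fst s div 3 ^ n, snd s div 3 ^ n)"
proof (induction n arbitrary: x)
  case (Suc n)
  then obtain d where d: "d \<in> sub_offsets" "s \<in> box_sites n (subbox x d)" by auto
  have "subbox x d = (fst s div 3 ^ n, snd s div 3 ^ n)" by (rule Suc.IH[OF d(2)])
  moreover have "x = (fst (subbox x d) div 3, snd (subbox x d) div 3)"
    using d(1) by (auto simp: subbox_def sub_offsets_def)
  ultimately show ?case by (simp add: zdiv_zmult2_eq[symmetric] mult.commute)
qed simp

context univ_product
begin

text \<open>A bad box contains two different bad subboxes, so the bad probabilities satisfy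
  \<open>p (Suc n) \<le> 81 * (p n)\<^sup>2\<close>, where 81 bounds the number of pairs of offsets.
  The threshold 1/324 is 1/(4 * 81): one step then costs a factor 1/4 times the current power of
  1/2, the bound halves at every level, and its sum 1/162 is below 1.\<close>

lemma percolation_of_good_sites:
  fixes Q :: "_ \<Rightarrow> int \<times> int \<Rightarrow> bool"
  assumes disj: "disjoint_family J"
    and [measurable]: "\<And>s. Measurable.pred \<Omega> (\<lambda>\<omega>. Q \<omega> s)"
    and dep: "\<And>s. depends_on (J s) (\<lambda>\<omega>. Q \<omega> s)"
    and bad: "\<And>s. P.prob {\<omega> \<in> space \<Omega>. \<not> Q \<omega> s} \<le> 1 / 324"
  shows "0 < P.prob {\<omega> \<in> space \<Omega>. \<forall>n. box_good (Q \<omega>) n (0, 0)}"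
proof -
  have meas [measurable]: "Measurable.pred \<Omega> (\<lambda>\<omega>. box_good (Q \<omega>) n x)" for n x
  proof (induction n arbitrary: x)
    case (Suc n)
    have [measurable]: "Measurable.pred \<Omega> (\<lambda>\<omega>. box_good (Q \<omega>) n x)" for x by (rule Suc.IH)
    have "countable sub_offsets" by (simp add: sub_offsets_def)
    then show ?case unfolding box_good.simps by measurable
  qed simp
  have depb: "depends_on (\<Union>s\<in>box_sites n x. J s) (\<lambda>\<omega>. \<not> box_good (Q \<omega>) n x)" for n x
  proof (induction n arbitrary: x)
    case 0
    then show ?case using dep[of x] by (auto simp: depends_on_def)
  next
    case (Suc n)
    show ?case
    proof (rule depends_onI)
      fix \<omega> \<omega>' :: "'i \<Rightarrow> 'b" assume eq: "\<And>i. i \<in> (\<Union>s\<in>box_sites (Suc n) x. J s) \<Longrightarrow> \<omega> i = \<omega>' i"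
      have "box_good (Q \<omega>) n (subbox x d) = box_good (Q \<omega>') n (subbox x d)" if "d \<in> sub_offsets" for d
        using depends_onD[OF Suc.IH[of "subbox x d"], of \<omega> \<omega>'] eq that by auto
      then show "(\<not> box_good (Q \<omega>) (Suc n) x) = (\<not> box_good (Q \<omega>') (Suc n) x)"
        by auto
    qed
  qed
  have pb: "P.prob {\<omega> \<in> space \<Omega>. \<not> box_good (Q \<omega>) n x} \<le> (1 / 324) * (1 / 2) ^ n" for n x
  proof (induction n arbitrary: x)
    case 0
    then show ?case using bad by simp
  next
    case (Suc n)
    let ?B = "\<lambda>d. {\<omega> \<in> space \<Omega>. \<not> box_good (Q \<omega>) n (subbox x d)}"
    let ?Pr = "{(d, d') \<in> sub_offsets \<times> sub_offsets. d \<noteq> d'}"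
    have fin: "finite ?Pr" by (rule finite_subset[of _
        "sub_offsets \<times> sub_offsets"]) (auto simp: sub_offsets_def)
    have "card ?Pr \<le> card (sub_offsets \<times> sub_offsets)" by (intro card_mono) (auto simp: sub_offsets_def)
    then have card: "card ?Pr \<le> 81" by (simp add: card_cartesian_product sub_offsets_def)
    have pair: "P.prob (?B (fst e) \<inter> ?B (snd e)) \<le> ((1 / 324) * (1 / 2) ^ n)\<^sup>2" if "e \<in> ?Pr" for e
    proof -
      have ne: "subbox x (fst e) \<noteq> subbox x (snd e)" using that by (auto simp: subbox_def prod_eq_iff)
      have "box_sites n (subbox x (fst e)) \<inter> box_sites n (subbox x (snd e)) = {}"
        using ne box_sites_div by (metis disjoint_iff)
      then have dj: "(\<Union>s\<in>box_sites n (subbox x (fst e)). J s) \<inter> (\<Union>s\<in>box_sites n (subbox x (snd e)). J s) =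
          {}"
        using disj unfolding disjoint_family_on_def disjoint_iff by (metis UNIV_I UN_E)
      have "?B (fst e) \<inter> ?B (snd e) = {\<omega> \<in> space \<Omega>. \<not> box_good (Q \<omega>) n (subbox x (fst e)) \<and>
          \<not> box_good (Q \<omega>) n (subbox x (snd e))}"
        by auto
      then have "P.prob (?B (fst e) \<inter> ?B (snd e)) = P.prob (?B (fst e)) * P.prob (?B (snd e))"
        using prob_conj_depends_on[OF dj _ depb _ depb] by simp
      also have "\<dots> \<le> ((1 / 324) * (1 / 2) ^ n) * ((1 / 324) * (1 / 2) ^ n)"
        by (intro mult_mono Suc.IH) auto
      finally show ?thesis by (simp add: power2_eq_square)
    qed
    have "{\<omega> \<in> space \<Omega>. \<not> box_good (Q \<omega>) (Suc n) x} \<subseteq> (\<Union>e\<in>?Pr. ?B (fst e) \<inter> ?B (snd e))"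
    proof
      fix \<omega> assume \<omega>: "\<omega> \<in> {\<omega> \<in> space \<Omega>. \<not> box_good (Q \<omega>) (Suc n) x}"
      then obtain d d' where "d \<in> sub_offsets" "d' \<in> sub_offsets" "d \<noteq> d'"
        "\<not> box_good (Q \<omega>) n (subbox x d)" "\<not> box_good (Q \<omega>) n (subbox x d')"
        unfolding box_good.simps by blast
      then show "\<omega> \<in> (\<Union>e\<in>?Pr. ?B (fst e) \<inter> ?B (snd e))"
        using \<omega> by (intro UN_I[of "(d, d')"]) auto
    qed
    then have "P.prob {\<omega> \<in> space \<Omega>. \<not> box_good (Q \<omega>) (Suc n) x} \<le>
        P.prob (\<Union>e\<in>?Pr. ?B (fst e) \<inter> ?B (snd e))"
      by (rule P.finite_measure_mono) (intro sets.finite_UN fin sets.Int; measurable)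
    also have "\<dots> \<le> (\<Sum>e\<in>?Pr. P.prob (?B (fst e) \<inter> ?B (snd e)))"
      by (rule P.finite_measure_subadditive_finite[OF fin]) auto
    also have "\<dots> \<le> (\<Sum>e\<in>?Pr. ((1 / 324) * (1 / 2) ^ n)\<^sup>2)" by (intro sum_mono pair)
    also have "\<dots> = real (card ?Pr) * ((1 / 324) * (1 / 2) ^ n)\<^sup>2" by simp
    also have "\<dots> \<le> 81 * ((1 / 324) * (1 / 2) ^ n)\<^sup>2" using card by (intro mult_right_mono) auto
    also have "\<dots> = (1 / 324) * (1 / 4) * ((1 / 2) ^ n * (1 / 2) ^ n)" by (simp add: power2_eq_square)
    also have "\<dots> \<le> (1 / 324) * (1 / 4) * ((1 / 2) ^ n * 1)" by (intro mult_left_mono power_le_one) auto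
    also have "\<dots> \<le> (1 / 324) * (1 / 2) ^ Suc n" by simp
    finally show ?case .
  qed
  let ?C = "\<lambda>n. {\<omega> \<in> space \<Omega>. \<not> box_good (Q \<omega>) n (0, 0)}"
  have summ: "summable (\<lambda>n. P.prob (?C n))"
    by (rule summable_comparison_test'[where g = "\<lambda>n. (1 / 324) * (1 / 2 :: real) ^ n" and N = 0])
      (use pb in \<open>auto intro!: summable_mult summable_geometric\<close>)
  have "P.prob (\<Union>n. ?C n) \<le> (\<Sum>n. P.prob (?C n))"
    by (rule P.finite_measure_subadditive_countably[OF _ summ]) auto
  also have "\<dots> \<le> (\<Sum>n. (1 / 324) * (1 / 2 :: real) ^ n)"
    by (intro suminf_le pb summ summable_mult summable_geometric) auto
  also have "\<dots> = 1 / 162"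
    by (subst suminf_mult) (auto simp: suminf_geometric summable_geometric)
  finally have "P.prob (\<Union>n. ?C n) \<le> 1 / 162" .
  moreover have "{\<omega> \<in> space \<Omega>. \<forall>n. box_good (Q \<omega>) n (0, 0)} = space \<Omega> - (\<Union>n. ?C n)" by auto
  moreover have "P.prob (space \<Omega> - (\<Union>n. ?C n)) = 1 - P.prob (\<Union>n. ?C n)"
    by (rule P.prob_compl) (intro sets.countable_UN, auto)
  ultimately show ?thesis by simp
qed

end

section \<open>Cells and the master product space\<close>

text \<open>The mesh is 1/m. The cells are closed so that they cover the closed unit squares;
  overlapping sides are harmless, since only covering, diameter and the measure of a single cell
  matter.\<close>

definition cell :: "int \<Rightarrow> int \<times> int \<Rightarrow> (real \<times> real) set" where
  "cell m z = {real_of_int (fst z) / real_of_int m .. (real_of_int (fst z) + 1) / real_of_int m} \<times>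
    {real_of_int (snd z) / real_of_int m .. (real_of_int (snd z) + 1) / real_of_int m}"

definition cell_square :: "int \<Rightarrow> int \<times> int \<Rightarrow> int \<times> int" where
  "cell_square m z = (fst z div m, snd z div m)"

lemma cell_borel [measurable]: "cell m z \<in> sets borel"
  unfolding cell_def by (simp add: borel_Times)

lemma cell_square_vimage:
  assumes "0 < m"
  shows "{z. cell_square m z = s} = {m * fst s..m * fst s + m - 1} \<times> {m * snd s..m * snd s + m - 1}"
proof -
  have div: "i div m = k \<longleftrightarrow> m * k \<le> i \<and> i \<le> m * k + m - 1" for i k
  proof
    assume "i div m = k"
    then have "i = m * k + i mod m" by auto
    moreover have "0 \<le> i mod m" "i mod m < m" using assms by auto
    ultimately show "m * k \<le> i \<and> i \<le> m * k + m - 1" by linarith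
  next
    assume "m * k \<le> i \<and> i \<le> m * k + m - 1"
    then show "i div m = k" by (intro int_div_pos_eq[where r = "i - m * k"]) auto
  qed
  have "cell_square m z = s \<longleftrightarrow> fst z div m = fst s \<and> snd z div m = snd s" for z
    by (auto simp: cell_square_def prod_eq_iff)
  then show ?thesis unfolding div by (auto simp: mem_Times_iff)
qed

lemma unit_square_cell:
  assumes m: "0 < m" and x: "x \<in> unit_square s"
  obtains z where "cell_square m z = s" "x \<in> cell m z"
proof -
  have coord: "\<exists>i. m * k \<le> i \<and> i \<le> m * k + m - 1 \<and> real_of_int i / m \<le> y \<and> y \<le> (real_of_int i + 1) / m"
    if "real_of_int k \<le> y" "y \<le> real_of_int k + 1" for k :: int and y :: real
  proof (cases "y = real_of_int k + 1")
    \<comment> \<open>At the upper end of the side the floor of \<open>m * y\<close> would point to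
      a cell of the next square, so the last cell of this one is taken.\<close>
    case True
    then show ?thesis using m by (intro exI[of _ "m * k + m - 1"]) (auto simp: field_simps)
  next
    case False
    let ?i = "\<lfloor>m * y\<rfloor>"
    have fl: "real_of_int ?i \<le> m * y" "m * y < real_of_int ?i + 1" by linarith+
    have "real_of_int (m * k) \<le> m * y" using that m by simp
    then have 1: "m * k \<le> ?i" by linarith
    have "m * y < m * (real_of_int k + 1)" using that False m by simp
    then have "real_of_int ?i < m * (real_of_int k + 1)" using fl(1) by linarith
    also have "\<dots> = real_of_int (m * k + m)" by (simp add: distrib_left)
    finally have "real_of_int ?i < real_of_int (m * k + m)" .
    then have 2: "?i \<le> m * k + m - 1" by linarith
    show ?thesis using 1 2 fl m by (intro exI[of _ ?i]) (auto simp: field_simps)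
  qed
  obtain i where i: "m * fst s \<le> i" "i \<le> m * fst s + m - 1" "real_of_int i / m \<le> fst x" "fst x \<le>
      (real_of_int i + 1) / m"
    using coord[of "fst s" "fst x"] x by (auto simp: unit_square_def)
  obtain j where j: "m * snd s \<le> j" "j \<le> m * snd s + m - 1" "real_of_int j / m \<le> snd x" "snd x \<le>
      (real_of_int j + 1) / m"
    using coord[of "snd s" "snd x"] x by (auto simp: unit_square_def)
  have "(i, j) \<in> {z. cell_square m z = s}" unfolding cell_square_vimage[OF m] using i j by auto
  then have "cell_square m (i, j) = s" by simp
  moreover have "x \<in> cell m (i, j)" using i j by (auto simp: cell_def mem_Times_iff)
  ultimately show thesis by (rule that)
qed

lemma cell_subset_square:
  assumes m: "0 < m" and z: "cell_square m z = s"
  shows "cell m z \<subseteq> unit_square s"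
proof -
  have "z \<in> {m * fst s..m * fst s + m - 1} \<times> {m * snd s..m * snd s + m - 1}"
    using z cell_square_vimage[OF m, of s] by blast
  then have 1: "m * fst s \<le> fst z" "fst z + 1 \<le> m * fst s + m" "m * snd s \<le> snd z" "snd z + 1 \<le> m *
      snd s + m" by auto
  have 2: "real_of_int (m * fst s) \<le> real_of_int (fst z)" "real_of_int (fst z + 1) \<le> real_of_int (m *
      fst s + m)"
    "real_of_int (m * snd s) \<le> real_of_int (snd z)" "real_of_int (snd z + 1) \<le> real_of_int (m * snd s +
        m)"
    using 1 by (simp_all only: of_int_le_iff)
  have "real_of_int (fst s) \<le> real_of_int (fst z) / m" "(real_of_int (fst z) + 1) / m \<le>
      real_of_int (fst s) + 1"
    "real_of_int (snd s) \<le> real_of_int (snd z) / m" "(real_of_int (snd z) + 1) / m \<le> real_of_int (snd s) +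
        1"
    using 2 m by (simp_all add: field_simps)
  then show ?thesis by (auto simp: cell_def unit_square_def)
qed

lemma measure_square_unif_cell:
  assumes m: "0 < m" and z: "cell_square m z = s"
  shows "measure (square_unif s) (cell m z) = 1 / (real_of_int m)\<^sup>2"
proof -
  have "emeasure (lborel \<Otimes>\<^sub>M lborel) (cell m z) =
      emeasure lborel {real_of_int (fst z) / real_of_int m .. (real_of_int (fst z) + 1) / real_of_int m} *
      emeasure lborel {real_of_int (snd z) / real_of_int m .. (real_of_int (snd z) + 1) / real_of_int m}"
    unfolding cell_def by (rule lborel.emeasure_pair_measure_Times) auto
  also have "\<dots> = ennreal (1 / (real_of_int m)\<^sup>2)"
    using m by (simp add: divide_right_mono ennreal_mult[symmetric] diff_divide_distrib[symmetric]
        power2_eq_square)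
  finally have "emeasure lborel (cell m z) = ennreal (1 / (real_of_int m)\<^sup>2)" by (simp add: lborel_prod)
  moreover have "unit_square s \<inter> cell m z = cell m z" using cell_subset_square[OF assms] by auto
  ultimately have "emeasure (square_unif s) (cell m z) = ennreal (1 / (real_of_int m)\<^sup>2)"
    using divide_ennreal[of "1 / (real_of_int m)\<^sup>2" 1]
    by (subst emeasure_uniform_measure) (auto simp: emeasure_unit_square)
  then show ?thesis by (simp add: measure_def)
qed

text \<open>Each coordinate differs by at most 2/m, diagonal neighbours included, and the distance
  is at most the sum of the two differences. This is the source of the condition
  \<open>4 / m \<le> r0\<close>.\<close>

lemma dist_adjacent_cells:
  assumes m: "0 < m" and x: "x \<in> cell m z" and y: "y \<in> cell m z'" and n: "near 1 z z'"
  shows "dist x y \<le> 4 / real_of_int m"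
proof -
  have c: "\<bar>a - b\<bar> \<le> 2 / real_of_int m"
    if "real_of_int i / real_of_int m \<le> a" "a \<le> (real_of_int i + 1) / real_of_int m"
      "real_of_int j / real_of_int m \<le> b" "b \<le> (real_of_int j + 1) / real_of_int m" "\<bar>i - j\<bar> \<le>
          1" for a b :: real and i j :: int
  proof -
    have "(real_of_int i + 1) / m \<le> (real_of_int j + 2) / m" "(real_of_int j + 1) / m \<le> (real_of_int i +
        2) / m"
      using that(5) m by (auto intro!: divide_right_mono)
    then show ?thesis using that by (simp add: add_divide_distrib)
  qed
  have "dist x y \<le> dist (fst x) (fst y) + dist (snd x) (snd y)"
    unfolding dist_prod_def by (rule sqrt_sum_squares_le_sum) auto
  also have "\<dots> \<le> 2 / real_of_int m + 2 / real_of_int m"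
    unfolding dist_real_def using x y n by (intro add_mono c) (auto simp: cell_def near_def)
  finally show ?thesis by simp
qed

text \<open>Connectedness of a lattice rectangle for a component-valued r: along a row to the left
  side, then along that side to the corner.\<close>

lemma rectangle_constant:
  fixes r :: "int \<times> int \<Rightarrow> 'c"
  assumes step: "\<And>z z'. z \<in> {a..b} \<times> {c..d} \<Longrightarrow> z' \<in> {a..b} \<times> {c..d} \<Longrightarrow> lattice_adj z z' \<Longrightarrow> r z = r z'"
    and z: "z \<in> {a..b} \<times> {c..d}" "z' \<in> {a..b} \<times> {c..d}"
  shows "r z = r z'"
proof -
  have row: "i \<le> b \<longrightarrow> r (i, j) = r (a, j)" if "a \<le> i" "j \<in> {c..d}" for i j
    using that(1)
  proof (induction i rule: int_ge_induct)
    case (step i)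
    then show ?case using assms(1)[of "(i, j)" "(i + 1, j)"] that(2) by (auto simp: lattice_adj_def)
  qed simp
  have col: "j \<le> d \<longrightarrow> r (a, j) = r (a, c)" if "c \<le> j" "a \<le> b" for j
    using that(1)
  proof (induction j rule: int_ge_induct)
    case (step j)
    then show ?case using assms(1)[of "(a, j)" "(a, j + 1)"] that(2) by (auto simp: lattice_adj_def)
  qed simp
  have "r u = r (a, c)" if "u \<in> {a..b} \<times> {c..d}" for u
    using that row[of "fst u" "snd u"] col[of "snd u"] by auto
  then show ?thesis using z by metis
qed

text \<open>\<open>Base s k\<close> labels the k-th point of square s; \<open>Em s z i\<close> labels the i-th extra point in cell z
  that serves the emulator of square s.\<close>

datatype lab = Base "int \<times> int" nat | Em "int \<times> int" "int \<times> int" nat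

instance lab :: countable by countable_datatype

text \<open>All randomness lives in one product space over this index type with values in
  \<open>real \<times> real\<close>; a natural number n is stored as \<open>(n, 0)\<close>. \<open>Zet\<close> is the auxiliary variable in the
  coupling of the counts, and \<open>Junk\<close> supplies the marks of label pairs that carry no coupled edge and all
  marks of the supercritical argument.\<close>

datatype idx = Cnt "int \<times> int" | Zet "int \<times> int" | Slot "int \<times> int" "int \<times> int" | Pos lab
  | Mark "lab \<times> lab" | Half label label | Junk "label \<times> label"

text \<open>An emulator point lies in the square of its cell z, which is in general not the square s
  that it serves.\<close>

fun lab_square :: "int \<Rightarrow> lab \<Rightarrow> int \<times> int" where
  "lab_square m (Base s k) = s"
| "lab_square m (Em s z i) = cell_square m z"

section \<open>Encoded laws and the product space\<close>

definition enc_pmf :: "nat pmf \<Rightarrow> (real \<times> real) measure" where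
  "enc_pmf p = distr (measure_pmf p) borel (\<lambda>n. (real n, 0))"

definition dec :: "real \<times> real \<Rightarrow> nat" where
  "dec x = nat \<lfloor>fst x\<rfloor>"

definition enc_unif :: "(real \<times> real) measure" where
  "enc_unif = distr unif01 borel (\<lambda>u. (u, 0))"

lemma fst_borel [measurable]: "fst \<in> borel_measurable (borel :: (real \<times> real) measure)"
  by (intro borel_measurable_continuous_onI continuous_intros)

lemma dec_measurable [measurable]: "dec \<in> measurable borel (count_space UNIV)"
  unfolding dec_def by (rule measurable_compose[OF fst_borel]) measurable

lemma pair_zero_measurable [measurable]: "(\<lambda>u::real. (u, 0::real)) \<in> borel_measurable unif01"
proof -
  have "(\<lambda>u::real. (u, 0::real)) \<in> borel_measurable borel"
    by (intro borel_measurable_continuous_onI continuous_intros)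
  then show ?thesis by (simp cong: measurable_cong_sets)
qed

lemma distr_enc_pmf: "distr (enc_pmf p) (count_space UNIV) dec = measure_pmf p"
proof -
  have "distr (enc_pmf p) (count_space UNIV) dec = distr (measure_pmf p) (count_space UNIV) (\<lambda>n. n)"
    unfolding enc_pmf_def by (subst distr_distr) (auto simp: comp_def dec_def)
  also have "\<dots> = measure_pmf p" by (rule distr_id2) simp
  finally show ?thesis .
qed

lemma distr_enc_unif: "distr enc_unif borel fst = unif01"
proof -
  have "distr enc_unif borel fst = distr unif01 borel (\<lambda>n. n)"
    unfolding enc_unif_def by (subst distr_distr[OF fst_borel pair_zero_measurable]) (simp add: comp_def)
  also have "\<dots> = unif01" by (rule distr_id2) simp
  finally show ?thesis .
qed

lemma prob_enc_pmf: "prob_space (enc_pmf p)"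
  unfolding enc_pmf_def by (rule measure_pmf.prob_space_distr) simp

lemma prob_enc_unif: "prob_space enc_unif"
  unfolding enc_unif_def by (rule prob_space.prob_space_distr[OF prob_unif01 pair_zero_measurable])

text \<open>The law \<open>zeta\<close> of the auxiliary variable stays open: the coupling
  instantiates it by \<open>dense_pmf\<close>, the supercritical argument by a point mass.\<close>

locale master =
  fixes lam r del :: real and zeta :: "int \<times> int \<Rightarrow> nat pmf" and m :: int
begin

fun coord :: "idx \<Rightarrow> (real \<times> real) measure" where
  "coord (Cnt s) = enc_pmf (poisson_pmf lam)"
| "coord (Zet s) = enc_pmf (zeta s)"
| "coord (Slot s z) = enc_pmf (poisson_pmf del)"
| "coord (Pos l) = square_unif (lab_square m l)"
| "coord (Mark e) = enc_unif"
| "coord (Half v w) = enc_pmf (map_pmf of_bool (bernoulli_pmf r))"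
| "coord (Junk e) = enc_unif"

lemma sets_coord [simp, measurable_cong]: "sets (coord i) = sets borel"
  by (cases i) (auto simp: enc_pmf_def enc_unif_def)

lemma space_coord [simp]: "space (coord i) = UNIV"
  using sets_eq_imp_space_eq[OF sets_coord, of i] by simp

sublocale univ_product coord
proof (rule univ_product.intro)
  show "prob_space (coord i)" for i
    by (cases i) (auto intro: prob_enc_pmf prob_enc_unif prob_square_unif)
qed

lemma space_\<Omega> [simp]: "space \<Omega> = UNIV"
  by (auto simp: space_PiM)

lemma component_borel [measurable]: "(\<lambda>\<omega>. \<omega> i) \<in> borel_measurable \<Omega>"
proof -
  have "(\<lambda>\<omega>. \<omega> i) \<in> \<Omega> \<rightarrow>\<^sub>M coord i" by (rule measurable_component_singleton) simp
  moreover have "measurable \<Omega> (coord i) = borel_measurable \<Omega>"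
    by (rule measurable_cong_sets[OF refl sets_coord])
  ultimately show ?thesis by blast
qed

lemma distr_component:
  assumes "h \<in> measurable borel N"
  shows "distr \<Omega> N (\<lambda>\<omega>. h (\<omega> i)) = distr (coord i) N h"
proof -
  have h: "h \<in> measurable (coord i) N" using assms by (simp cong: measurable_cong_sets)
  have "distr (distr \<Omega> (coord i) (\<lambda>\<omega>. \<omega> i)) N h = distr \<Omega> N (\<lambda>\<omega>. h (\<omega> i))"
    by (subst distr_distr[OF h]) (auto simp: comp_def)
  then show ?thesis by (simp add: PiM_component)
qed

lemma distr_dec:
  "distr \<Omega> (count_space UNIV) (\<lambda>\<omega>. dec (\<omega> i)) = distr (coord i) (count_space UNIV) dec"
  by (rule distr_component) measurable

lemma distr_Pos: "distr \<Omega> borel (\<lambda>\<omega>. \<omega> (Pos l)) = square_unif (lab_square m l)"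
proof -
  have "distr \<Omega> borel (\<lambda>\<omega>. (\<lambda>x. x) (\<omega> (Pos l))) = distr (coord (Pos l)) borel (\<lambda>x. x)"
    by (rule distr_component) simp
  also have "\<dots> = square_unif (lab_square m l)" unfolding coord.simps by (rule distr_id2) simp
  finally show ?thesis by simp
qed

lemma distr_unif_coord: "coord i = enc_unif \<Longrightarrow> distr \<Omega> borel (\<lambda>\<omega>. fst (\<omega> i)) = unif01"
  by (simp add: distr_component distr_enc_unif)

lemma prob_dec:
  assumes "coord i = enc_pmf p"
  shows "P.prob {\<omega>. dec (\<omega> i) \<in> A} = measure_pmf.prob p A"
proof -
  have "measure (distr \<Omega> (count_space UNIV) (\<lambda>\<omega>. dec (\<omega> i))) A = measure_pmf.prob p A"
    by (simp add: distr_dec assms distr_enc_pmf)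
  moreover have "(\<lambda>\<omega>. dec (\<omega> i)) -` A \<inter> space \<Omega> = {\<omega>. dec (\<omega> i) \<in> A}" by auto
  ultimately show ?thesis by (subst (asm) measure_distr) auto
qed

lemma prob_unif_less:
  assumes "coord i = enc_unif" "0 \<le> c" "c \<le> 1"
  shows "P.prob {\<omega>. fst (\<omega> i) < c} = c"
proof -
  have "measure (distr \<Omega> borel (\<lambda>\<omega>. fst (\<omega> i))) {..<c} = measure unif01 {..<c}"
    by (simp add: distr_unif_coord[OF assms(1)])
  moreover have "(\<lambda>\<omega>. fst (\<omega> i)) -` {..<c} \<inter> space \<Omega> = {\<omega>. fst (\<omega> i) < c}" by auto
  moreover have "measure unif01 {..<c} = c"
  proof -
    have "{0..1} \<inter> {..<c} = {0..<c}" using assms by auto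
    then show ?thesis using assms(2) by (simp add: measure_uniform_measure)
  qed
  ultimately show ?thesis by (subst (asm) measure_distr) auto
qed

lemma prob_Pos_cell:
  assumes "0 < m" "cell_square m z = lab_square m l"
  shows "P.prob {\<omega>. \<omega> (Pos l) \<in> cell m z} = 1 / (real_of_int m)\<^sup>2"
  using prob_coordinate[of "cell m z" "Pos l"] measure_square_unif_cell[OF assms] by simp

lemma AE_Pos: "AE \<omega> in \<Omega>. \<forall>l. \<omega> (Pos l) \<in> unit_square (lab_square m l)"
  unfolding AE_all_countable
proof
  fix l
  have "AE x in coord (Pos l). x \<in> unit_square (lab_square m l)"
    unfolding coord.simps by (rule AE_square_unif)
  then show "AE \<omega> in \<Omega>. \<omega> (Pos l) \<in> unit_square (lab_square m l)" by (rule AE_coordinate)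
qed

lemma AE_unif_nonneg:
  assumes "coord i = enc_unif"
  shows "AE \<omega> in \<Omega>. 0 \<le> fst (\<omega> i)"
proof -
  have "AE u in distr \<Omega> borel (\<lambda>\<omega>. fst (\<omega> i)). 0 \<le> u"
    unfolding distr_component[OF fst_borel] assms distr_enc_unif by (rule AE_unif01)
  then show ?thesis by (rule AE_distrD[rotated]) measurable
qed

text \<open>One criterion for every configuration built on the master space: correct marginal laws
  together with disjoint coordinate sets give exactly the law of the model. It serves the plain
  configuration and the coupled one.\<close>

lemma distr_RCM:
  fixes N :: "int \<times> int \<Rightarrow> _ \<Rightarrow> nat" and X :: "label \<Rightarrow> _ \<Rightarrow> real \<times> real" and U :: "label \<times> label \<Rightarrow> _ \<Rightarrow> real"
  assumes N: "\<And>s. N s \<in> measurable \<Omega> (count_space UNIV)"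
      "\<And>s. distr \<Omega> (count_space UNIV) (N s) = measure_pmf (poisson_pmf \<mu>)" "\<And>s. depends_on (JN s) (N s)"
    and X: "\<And>v. X v \<in> borel_measurable \<Omega>" "\<And>v. distr \<Omega> borel (X v) = square_unif (fst v)"
      "\<And>v. depends_on (JX v) (X v)"
    and U: "\<And>e. U e \<in> borel_measurable \<Omega>" "\<And>e. distr \<Omega> borel (U e) = unif01" "\<And>e. depends_on (JU e) (U e)"
    and disj: "disjoint_family JN" "disjoint_family JX" "disjoint_family JU"
      "\<And>s v. JN s \<inter> JX v = {}" "\<And>s e. JN s \<inter> JU e = {}" "\<And>v e. JX v \<inter> JU e = {}"
  shows "distr \<Omega> (RCM_space \<mu>) (\<lambda>\<omega>. (\<lambda>s. N s \<omega>, \<lambda>v. X v \<omega>, \<lambda>e. U e \<omega>)) = RCM_space \<mu>"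
    and "(\<lambda>\<omega>. (\<lambda>s. N s \<omega>, \<lambda>v. X v \<omega>, \<lambda>e. U e \<omega>)) \<in> \<Omega> \<rightarrow>\<^sub>M RCM_space \<mu>"
proof -
  let ?SN = "PiM UNIV (\<lambda>_ :: int \<times> int. count_space (UNIV :: nat set))"
  let ?SX = "PiM UNIV (\<lambda>_ :: label. borel :: (real \<times> real) measure)"
  let ?SU = "PiM UNIV (\<lambda>_ :: label \<times> label. borel :: real measure)"
  have mN: "(\<lambda>\<omega> s. N s \<omega>) \<in> \<Omega> \<rightarrow>\<^sub>M ?SN" using N(1) by (auto intro: measurable_PiM_single')
  have mX: "(\<lambda>\<omega> v. X v \<omega>) \<in> \<Omega> \<rightarrow>\<^sub>M ?SX" using X(1) by (auto intro: measurable_PiM_single')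
  have mU: "(\<lambda>\<omega> e. U e \<omega>) \<in> \<Omega> \<rightarrow>\<^sub>M ?SU" using U(1) by (auto intro: measurable_PiM_single')
  have lN: "distr \<Omega> ?SN (\<lambda>\<omega> s. N s \<omega>) = PiM UNIV (\<lambda>_. measure_pmf (poisson_pmf \<mu>))"
    by (subst distr_family[OF disj(1) N(1,3)]) (simp add: N(2))
  have lX: "distr \<Omega> ?SX (\<lambda>\<omega> v. X v \<omega>) = PiM UNIV (\<lambda>v. square_unif (fst v))"
    by (subst distr_family[OF disj(2) X(1,3)]) (simp add: X(2))
  have lU: "distr \<Omega> ?SU (\<lambda>\<omega> e. U e \<omega>) = PiM UNIV (\<lambda>_. unif01)"
    by (subst distr_family[OF disj(3) U(1,3)]) (simp add: U(2))
  have dN: "depends_on (\<Union>s. JN s) (\<lambda>\<omega> s. N s \<omega>)" by (rule depends_on_family[OF N(3)])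
  have dX: "depends_on (\<Union>v. JX v) (\<lambda>\<omega> v. X v \<omega>)" by (rule depends_on_family[OF X(3)])
  have dU: "depends_on (\<Union>e. JU e) (\<lambda>\<omega> e. U e \<omega>)" by (rule depends_on_family[OF U(3)])
  have lXU: "distr \<Omega> (?SX \<Otimes>\<^sub>M ?SU) (\<lambda>\<omega>. (\<lambda>v. X v \<omega>, \<lambda>e. U e \<omega>)) =
      PiM UNIV (\<lambda>v. square_unif (fst v)) \<Otimes>\<^sub>M PiM UNIV (\<lambda>_. unif01)"
    unfolding lX[symmetric] lU[symmetric]
    by (rule distr_pair[OF _ mX dX mU dU]) (use disj(6) in blast)
  have mXU: "(\<lambda>\<omega>. (\<lambda>v. X v \<omega>, \<lambda>e. U e \<omega>)) \<in> \<Omega> \<rightarrow>\<^sub>M ?SX \<Otimes>\<^sub>M ?SU"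
    using mX mU by simp
  have l: "distr \<Omega> (?SN \<Otimes>\<^sub>M (?SX \<Otimes>\<^sub>M ?SU)) (\<lambda>\<omega>. (\<lambda>s. N s \<omega>, \<lambda>v. X v \<omega>, \<lambda>e. U e \<omega>)) = RCM_space \<mu>"
    unfolding RCM_space_def lXU[symmetric] lN[symmetric]
    by (rule distr_pair[OF _ mN dN mXU depends_on_pair[OF dX dU]]) (use disj(4,5) in blast)
  \<comment> \<open>The equality of measures just proved also identifies the sigma-algebras, which
    allows the target space to be exchanged.\<close>
  have s: "sets (?SN \<Otimes>\<^sub>M (?SX \<Otimes>\<^sub>M ?SU)) = sets (RCM_space \<mu>)"
    unfolding l[symmetric] by simp
  show "distr \<Omega> (RCM_space \<mu>) (\<lambda>\<omega>. (\<lambda>s. N s \<omega>, \<lambda>v. X v \<omega>, \<lambda>e. U e \<omega>)) = RCM_space \<mu>"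
    by (subst (2) l[symmetric]) (rule distr_cong; simp add: s)
  show "(\<lambda>\<omega>. (\<lambda>s. N s \<omega>, \<lambda>v. X v \<omega>, \<lambda>e. U e \<omega>)) \<in> \<Omega> \<rightarrow>\<^sub>M RCM_space \<mu>"
    by (subst measurable_cong_sets[OF refl s[symmetric]]) (use mN mXU in simp)
qed

end

section \<open>The supercritical regime\<close>

context master
begin

definition plain_N :: "(idx \<Rightarrow> real \<times> real) \<Rightarrow> int \<times> int \<Rightarrow> nat" where
  "plain_N \<omega> s = dec (\<omega> (Cnt s))"

definition plain_X :: "(idx \<Rightarrow> real \<times> real) \<Rightarrow> label \<Rightarrow> real \<times> real" where
  "plain_X \<omega> v = \<omega> (Pos (Base (fst v) (snd v)))"

definition plain_U :: "(idx \<Rightarrow> real \<times> real) \<Rightarrow> label \<times> label \<Rightarrow> real" where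
  "plain_U \<omega> e = fst (\<omega> (Junk e))"

lemma plain_measurable [measurable]:
  "(\<lambda>\<omega>. plain_N \<omega> s) \<in> measurable \<Omega> (count_space UNIV)"
  "(\<lambda>\<omega>. plain_X \<omega> v) \<in> borel_measurable \<Omega>"
  "(\<lambda>\<omega>. plain_U \<omega> e) \<in> borel_measurable \<Omega>"
  unfolding plain_N_def plain_X_def plain_U_def by measurable

lemma distr_plain:
  shows "distr \<Omega> (RCM_space lam) (\<lambda>\<omega>. (plain_N \<omega>, plain_X \<omega>, plain_U \<omega>)) = RCM_space lam" (is ?A)
    and "(\<lambda>\<omega>. (plain_N \<omega>, plain_X \<omega>, plain_U \<omega>)) \<in> \<Omega> \<rightarrow>\<^sub>M RCM_space lam" (is ?B)
proof -
  have N: "distr \<Omega> (count_space UNIV) (\<lambda>\<omega>. plain_N \<omega> s) = measure_pmf (poisson_pmf lam)" for s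
    unfolding plain_N_def by (simp add: distr_dec distr_enc_pmf)
  have X: "distr \<Omega> borel (\<lambda>\<omega>. plain_X \<omega> v) = square_unif (fst v)" for v
    using distr_Pos[of "Base (fst v) (snd v)"] by (simp add: plain_X_def)
  have U: "distr \<Omega> borel (\<lambda>\<omega>. plain_U \<omega> e) = unif01" for e
    unfolding plain_U_def by (rule distr_unif_coord) simp
  note L = distr_RCM[of "\<lambda>s \<omega>. plain_N \<omega> s" lam
      "\<lambda>s. {Cnt s}" "\<lambda>v \<omega>. plain_X \<omega> v" "\<lambda>v. {Pos (Base (fst v) (snd v))}"
      "\<lambda>e \<omega>. plain_U \<omega> e" "\<lambda>e. {Junk e}"]
  show ?A
    by (rule L(1); (rule plain_measurable N X U)?)
      (auto simp: disjoint_family_on_def plain_N_def plain_X_def plain_U_def intro!: depends_onI)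
  show ?B
    by (rule L(2); (rule plain_measurable N X U)?)
      (auto simp: disjoint_family_on_def plain_N_def plain_X_def plain_U_def intro!: depends_onI)
qed

definition fwd :: "int \<times> int \<Rightarrow> (int \<times> int) set" where
  "fwd s = {s, (fst s + 1, snd s), (fst s, snd s + 1)}"

definition cells_of :: "int \<times> int \<Rightarrow> (int \<times> int) set" where
  "cells_of s = {z. cell_square m z = s}"

text \<open>Labels with index below n0 are joined through a common neighbour with index at least n0.
  The square of that neighbour identifies the site, so different sites use disjoint sets of marks.\<close>

definition relay :: "real \<Rightarrow> int \<times> int \<Rightarrow> nat \<Rightarrow> int \<times> int \<Rightarrow> nat \<Rightarrow> int \<times> int \<Rightarrow> (idx \<Rightarrow> real \<times> real) \<Rightarrow> nat \<Rightarrow>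
    bool" where
  "relay c s k t j z \<omega> i \<longleftrightarrow> plain_X \<omega> (s, i) \<in> cell m z \<and>
    (plain_U \<omega> (gkey (s, i) (s, k)) < c \<and> plain_U \<omega> (gkey (s, i) (t, j)) < c)"

text \<open>A relay is required in every cell z, and not just in the cell of the label
  \<open>(s, k)\<close>. This keeps the relay condition free of the positions of the low labels, so
  its probability is a product over i and it involves only coordinates that belong to s.\<close>

definition site_good :: "nat \<Rightarrow> nat \<Rightarrow> real \<Rightarrow> (idx \<Rightarrow> real \<times> real) \<Rightarrow> int \<times> int \<Rightarrow> bool" where
  "site_good n0 n c \<omega> s \<longleftrightarrow> n \<le> plain_N \<omega> s \<and>
    (\<forall>z\<in>cells_of s. \<exists>k\<in>{..<n0}. plain_X \<omega> (s, k) \<in> cell m z) \<and>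
    (\<forall>k\<in>{..<n0}. \<forall>t\<in>fwd s. \<forall>j\<in>{..<n0}. \<forall>z\<in>cells_of s. (s, k) \<noteq> (t, j) \<longrightarrow>
        (\<exists>i\<in>{n0..<n}. relay c s k t j z \<omega> i))"

text \<open>A pair with one index at least n0 and one below n0 has a unique high label, and its mark
  is assigned to the square of that label. Hence no mark is shared between sites.\<close>

definition site_coords :: "nat \<Rightarrow> int \<times> int \<Rightarrow> idx set" where
  "site_coords n0 s = {Cnt s} \<union> {Pos (Base s k) |k. True} \<union>
    {Junk (v, w) |v w. (fst v = s \<and> n0 \<le> snd v \<and> snd w < n0) \<or> (fst w = s \<and> n0 \<le> snd w \<and> snd v < n0)}"

lemma disjoint_site_coords: "disjoint_family (site_coords n0)"
  unfolding disjoint_family_on_def site_coords_def by auto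

lemma gkey_Junk_site_coords: "n0 \<le> i \<Longrightarrow> j < n0 \<Longrightarrow> Junk (gkey (s, i) (t, j)) \<in> site_coords n0 s"
  unfolding site_coords_def gkey_def by (cases s) auto

lemma depends_on_site_good: "depends_on (site_coords n0 s) (\<lambda>\<omega>. site_good n0 n c \<omega> s)"
proof (rule depends_onI)
  fix \<omega> \<omega>' :: "idx \<Rightarrow> real \<times> real"
  assume eq: "\<And>i. i \<in> site_coords n0 s \<Longrightarrow> \<omega> i = \<omega>' i"
  have "plain_N \<omega> s = plain_N \<omega>' s" using eq[of "Cnt s"] by (simp add: plain_N_def site_coords_def)
  moreover have X: "plain_X \<omega> (s, k) = plain_X \<omega>' (s, k)" for k
    using eq[of "Pos (Base s k)"] by (simp add: plain_X_def site_coords_def)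
  moreover have "relay c s k t j z \<omega> i = relay c s k t j z \<omega>' i" if
      "n0 \<le> i" "k < n0" "j < n0" for k t j z i
    unfolding relay_def X plain_U_def using eq gkey_Junk_site_coords that by simp
  ultimately show "site_good n0 n c \<omega> s = site_good n0 n c \<omega>' s"
    unfolding site_good_def by (intro conj_cong ball_cong bex_cong imp_cong refl) auto
qed

lemma finite_cells_of: "0 < m \<Longrightarrow> finite (cells_of s)"
  and card_cells_of: "0 < m \<Longrightarrow> card (cells_of s) = nat m ^ 2"
  unfolding cells_of_def by (simp_all add: cell_square_vimage card_cartesian_product power2_eq_square)

lemma pred_relay [measurable]: "Measurable.pred \<Omega> (\<lambda>\<omega>. relay c s k t j z \<omega> i)"
  unfolding relay_def by measurable

lemma pred_site_good [measurable]: "0 < m \<Longrightarrow> Measurable.pred \<Omega> (\<lambda>\<omega>. site_good n0 n c \<omega> s)"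
proof -
  assume "0 < m"
  then have [simp]: "countable (cells_of s)" "countable (fwd s)"
    using finite_cells_of by (auto intro: countable_finite simp: fwd_def)
  show ?thesis unfolding site_good_def by measurable
qed

lemma prob_relay:
  assumes m: "0 < m" and c: "0 \<le> c" "c \<le> 1" and z: "cell_square m z = s" and ne:
      "(s, k) \<noteq> (t, j)" "(s, i) \<noteq> (s, k)" "(s, i) \<noteq> (t, j)"
  shows "P.prob {\<omega>. relay c s k t j z \<omega> i} = c\<^sup>2 / (real_of_int m)\<^sup>2"
proof -
  let ?a = "gkey (s, i) (s, k)" and ?b = "gkey (s, i) (t, j)"
  have ab: "?a \<noteq> ?b" using ne by (auto simp: gkey_eq_iff)
  have "P.prob {\<omega> \<in> space \<Omega>. plain_U \<omega> ?a < c \<and> plain_U \<omega> ?b < c} =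
      P.prob {\<omega> \<in> space \<Omega>. plain_U \<omega> ?a < c} * P.prob {\<omega> \<in> space \<Omega>. plain_U \<omega> ?b < c}"
    by (rule prob_conj_depends_on[of "{Junk ?a}" "{Junk ?b}"]) (use ab in \<open>auto intro!: depends_onI simp:
        plain_U_def\<close>)
  also have "\<dots> = c\<^sup>2" using c by (simp add: plain_U_def prob_unif_less power2_eq_square)
  finally have 1: "P.prob {\<omega> \<in> space \<Omega>. plain_U \<omega> ?a < c \<and> plain_U \<omega> ?b < c} = c\<^sup>2" .
  have "P.prob {\<omega> \<in> space \<Omega>. plain_X \<omega> (s, i) \<in> cell m z \<and> (plain_U \<omega> ?a < c \<and> plain_U \<omega> ?b < c)} =
      P.prob {\<omega> \<in> space \<Omega>. plain_X \<omega> (s, i) \<in> cell m z} * P.prob {\<omega> \<in> space \<Omega>. plain_U \<omega> ?a < c \<and>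
          plain_U \<omega> ?b < c}"
    by (rule prob_conj_depends_on[of "{Pos (Base s i)}" "{Junk ?a, Junk ?b}"])
      (auto intro!: depends_onI simp: plain_U_def plain_X_def)
  also have "P.prob {\<omega> \<in> space \<Omega>. plain_X \<omega> (s, i) \<in> cell m z} = 1 / (real_of_int m)\<^sup>2"
    using prob_Pos_cell[of z "Base s i"] m z by (simp add: plain_X_def)
  finally show ?thesis unfolding relay_def 1 by simp
qed

lemma prob_compl_pred:
  "Measurable.pred \<Omega> Y \<Longrightarrow> P.prob {\<omega>. \<not> Y \<omega>} = 1 - P.prob {\<omega>. Y \<omega>}"
  using prob_not[of Y] by simp

text \<open>Union bound over the three ways to fail: too few points, a cell without low label, a
  missing relay; the 3 in the last term is the size of \<open>fwd s\<close>. Positions and marks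
  exist for inactive labels too, so the last two terms are computed without conditioning on the
  count.\<close>

lemma prob_site_bad:
  assumes m: "0 < m" and c: "0 \<le> c" "c \<le> 1" and n: "n0 \<le> n"
  shows "P.prob {\<omega>. \<not> site_good n0 n c \<omega> s} \<le> measure_pmf.prob (poisson_pmf lam) {..<n} +
    real (nat m ^ 2) * (1 - 1 / (real_of_int m)\<^sup>2) ^ n0 +
    real (3 * n0 * n0 * nat m ^ 2) * (1 - c\<^sup>2 / (real_of_int m)\<^sup>2) ^ (n - n0)"
proof -
  let ?B1 = "{\<omega>. plain_N \<omega> s < n}"
  let ?B2 = "\<lambda>z. {\<omega>. \<forall>k\<in>{..<n0}. plain_X \<omega> (s, k) \<notin> cell m z}"
  let ?I = "{(k, t, j, z). k < n0 \<and> t \<in> fwd s \<and> j < n0 \<and> z \<in> cells_of s \<and> (s, k) \<noteq> (t, j)}"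
  let ?B3 = "\<lambda>(k, t, j, z). {\<omega>. \<forall>i\<in>{n0..<n}. \<not> relay c s k t j z \<omega> i}"
  have meas: "?B1 \<in> P.events" "?B2 z \<in> P.events" "?B3 x \<in> P.events" for z x
  proof -
    have "{\<omega> \<in> space \<Omega>. plain_N \<omega> s < n} \<in> P.events" by measurable
    then show "?B1 \<in> P.events" by simp
    have "{\<omega> \<in> space \<Omega>. \<forall>k\<in>{..<n0}. plain_X \<omega> (s, k) \<notin> cell m z} \<in> P.events" by measurable
    then show "?B2 z \<in> P.events" by simp
    obtain k t j z where x: "x = (k, t, j, z)" by (cases x) auto
    have "{\<omega> \<in> space \<Omega>. \<forall>i\<in>{n0..<n}. \<not> relay c s k t j z \<omega> i} \<in> P.events" by measurable
    then show "?B3 x \<in> P.events" by (simp add: x)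
  qed
  have U2: "(\<Union>z\<in>cells_of s. ?B2 z) \<in> P.events"
    by (rule sets.finite_UN[OF finite_cells_of[OF m]]) (rule meas(2))
  have fin3: "finite ?I" and card3: "card ?I \<le> 3 * n0 * n0 * nat m ^ 2"
  proof -
    have sub: "?I \<subseteq> {..<n0} \<times> fwd s \<times> {..<n0} \<times> cells_of s" by auto
    have f: "finite ({..<n0} \<times> fwd s \<times> {..<n0} \<times> cells_of s)" using finite_cells_of[OF m]
        by (simp add: fwd_def)
    show "finite ?I" by (rule finite_subset[OF sub f])
    have "card ?I \<le> card ({..<n0} \<times> fwd s \<times> {..<n0} \<times> cells_of s)" by (rule card_mono[OF f sub])
    also have "\<dots> = n0 * (card (fwd s) * (n0 * nat m ^ 2))" by (simp add: card_cartesian_product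
        card_cells_of[OF m])
    also have "\<dots> \<le> n0 * (3 * (n0 * nat m ^ 2))"
      unfolding fwd_def by (intro mult_le_mono le_refl) (simp add: card_insert_if)
    finally show "card ?I \<le> 3 * n0 * n0 * nat m ^ 2" by (simp add: mult.assoc mult.left_commute)
  qed
  have U3: "(\<Union>x\<in>?I. ?B3 x) \<in> P.events"
    by (rule sets.finite_UN[OF fin3]) (rule meas(3))
  have p1: "P.prob ?B1 = measure_pmf.prob (poisson_pmf lam) {..<n}"
    using prob_dec[of "Cnt s" "poisson_pmf lam" "{..<n}"] by (simp add: plain_N_def)
  have p2: "P.prob (?B2 z) = (1 - 1 / (real_of_int m)\<^sup>2) ^ n0" if "z \<in> cells_of s" for z
  proof -
    have "P.prob {\<omega> \<in> space \<Omega>. \<forall>k\<in>{..<n0}. plain_X \<omega> (s, k) \<notin> cell m z} =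
        (\<Prod>k\<in>{..<n0}. P.prob {\<omega> \<in> space \<Omega>. plain_X \<omega> (s, k) \<notin> cell m z})"
      by (rule prob_ball_depends_on[where J = "\<lambda>k. {Pos (Base s k)}"])
        (auto simp: disjoint_family_on_def plain_X_def intro!: depends_onI)
    also have "\<dots> = (\<Prod>k\<in>{..<n0}. 1 - 1 / (real_of_int m)\<^sup>2)"
    proof (rule prod.cong[OF refl])
      fix k
      have "P.prob {\<omega>. \<not> plain_X \<omega> (s, k) \<in> cell m z} = 1 - P.prob {\<omega>. plain_X \<omega> (s, k) \<in> cell m z}"
        by (rule prob_compl_pred) measurable
      also have "P.prob {\<omega>. plain_X \<omega> (s, k) \<in> cell m z} = 1 / (real_of_int m)\<^sup>2"
        using prob_Pos_cell[of z "Base s k"] m that by (simp add: plain_X_def cells_of_def)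
      finally show "P.prob {\<omega> \<in> space \<Omega>. plain_X \<omega> (s, k) \<notin> cell m z} = 1 - 1 / (real_of_int m)\<^sup>2" by simp
    qed
    finally show ?thesis by simp
  qed
  have p3: "P.prob (?B3 x) = (1 - c\<^sup>2 / (real_of_int m)\<^sup>2) ^ (n - n0)" if "x \<in> ?I" for x
  proof -
    obtain k t j z where x: "x = (k, t, j, z)" by (cases x) auto
    have I: "k < n0" "j < n0" "cell_square m z = s" "(s, k) \<noteq> (t, j)" using that
        by (auto simp: x cells_of_def)
    \<comment> \<open>Different relays i use different marks because i is at least n0 while k and j
      are below n0.\<close>
    have "P.prob {\<omega> \<in> space \<Omega>. \<forall>i\<in>{n0..<n}. \<not> relay c s k t j z \<omega> i} =
        (\<Prod>i\<in>{n0..<n}. P.prob {\<omega> \<in> space \<Omega>. \<not> relay c s k t j z \<omega> i})"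
    proof (rule prob_ball_depends_on[where J = "\<lambda>i. {Pos (Base s i), Junk (gkey (s, i) (s, k)), Junk (gkey
        (s, i) (t, j))}"])
      show "disjoint_family_on (\<lambda>i. {Pos (Base s i), Junk (gkey (s, i) (s, k)), Junk (gkey (s, i) (t,
          j))}) {n0..<n}"
        using I(1,2) by (auto simp: disjoint_family_on_def gkey_eq_iff)
    qed (auto simp: relay_def plain_X_def plain_U_def intro!: depends_onI)
    also have "\<dots> = (\<Prod>i\<in>{n0..<n}. 1 - c\<^sup>2 / (real_of_int m)\<^sup>2)"
    proof (rule prod.cong[OF refl])
      fix i assume i: "i \<in> {n0..<n}"
      have "P.prob {\<omega>. \<not> relay c s k t j z \<omega> i} = 1 - P.prob {\<omega>. relay c s k t j z \<omega> i}"
        by (rule prob_compl_pred) measurable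
      also have "P.prob {\<omega>. relay c s k t j z \<omega> i} = c\<^sup>2 / (real_of_int m)\<^sup>2"
        by (rule prob_relay) (use m c I i in auto)
      finally show "P.prob {\<omega> \<in> space \<Omega>. \<not> relay c s k t j z \<omega> i} = 1 - c\<^sup>2 / (real_of_int m)\<^sup>2" by simp
    qed
    finally show ?thesis by (simp add: x)
  qed
  have "{\<omega>. \<not> site_good n0 n c \<omega> s} \<subseteq> ?B1 \<union> (\<Union>z\<in>cells_of s. ?B2 z) \<union> (\<Union>x\<in>?I. ?B3 x)"
  proof
    fix \<omega> assume "\<omega> \<in> {\<omega>. \<not> site_good n0 n c \<omega> s}"
    then consider "plain_N \<omega> s < n" | z where "z \<in> cells_of s" "\<forall>k\<in>{..<n0}. plain_X \<omega> (s, k) \<notin> cell m z"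
      | k t j z where "k < n0" "t \<in> fwd s" "j < n0" "z \<in> cells_of s" "(s, k) \<noteq> (t, j)" "\<forall>i\<in>{n0..<n}. \<not>
          relay c s k t j z \<omega> i"
      unfolding site_good_def mem_Collect_eq by (meson lessThan_iff not_le)
    then show "\<omega> \<in> ?B1 \<union> (\<Union>z\<in>cells_of s. ?B2 z) \<union> (\<Union>x\<in>?I. ?B3 x)"
    proof cases
      case (3 k t j z)
      then have "\<omega> \<in> ?B3 (k, t, j, z)" "(k, t, j, z) \<in> ?I" by auto
      then show ?thesis by blast
    qed auto
  qed
  then have "P.prob {\<omega>. \<not> site_good n0 n c \<omega> s} \<le> P.prob (?B1 \<union> (\<Union>z\<in>cells_of s. ?B2 z) \<union> (\<Union>x\<in>?I. ?B3 x))"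
    by (rule P.finite_measure_mono) (intro sets.Un meas(1) U2 U3)
  also have "\<dots> \<le> P.prob (?B1 \<union> (\<Union>z\<in>cells_of s. ?B2 z)) + P.prob (\<Union>x\<in>?I. ?B3 x)"
    by (rule measure_Un_le) (intro sets.Un meas(1) U2 U3)+
  also have "P.prob (?B1 \<union> (\<Union>z\<in>cells_of s. ?B2 z)) \<le> P.prob ?B1 + P.prob (\<Union>z\<in>cells_of s. ?B2 z)"
    by (rule measure_Un_le) (intro sets.Un meas(1) U2 U3)+
  also have "P.prob (\<Union>z\<in>cells_of s. ?B2 z) \<le> (\<Sum>z\<in>cells_of s. P.prob (?B2 z))"
    by (rule P.finite_measure_subadditive_finite[OF finite_cells_of[OF m]]) (use meas in blast)
  also have "\<dots> = real (nat m ^ 2) * (1 - 1 / (real_of_int m)\<^sup>2) ^ n0"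
    by (simp add: p2 card_cells_of[OF m])
  also have "P.prob (\<Union>x\<in>?I. ?B3 x) \<le> (\<Sum>x\<in>?I. P.prob (?B3 x))"
    by (rule P.finite_measure_subadditive_finite[OF fin3]) (use meas in blast)
  also have "\<dots> = (\<Sum>x\<in>?I. (1 - c\<^sup>2 / (real_of_int m)\<^sup>2) ^ (n - n0))" by (rule sum.cong[OF refl p3])
  also have "\<dots> = real (card ?I) * (1 - c\<^sup>2 / (real_of_int m)\<^sup>2) ^ (n - n0)" by simp
  also have "\<dots> \<le> real (3 * n0 * n0 * nat m ^ 2) * (1 - c\<^sup>2 / (real_of_int m)\<^sup>2) ^ (n - n0)"
  proof (intro mult_right_mono zero_le_power)
    show "real (card ?I) \<le> real (3 * n0 * n0 * nat m ^ 2)" using card3 by (rule of_nat_mono)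
    have "c\<^sup>2 \<le> 1" using c by (simp add: power_le_one)
    moreover have "1 \<le> (real_of_int m)\<^sup>2" using m by (simp add: one_le_power)
    ultimately have "c\<^sup>2 \<le> (real_of_int m)\<^sup>2" by linarith
    then show "0 \<le> 1 - c\<^sup>2 / (real_of_int m)\<^sup>2" using m by (simp add: field_simps)
  qed
  finally show ?thesis by (simp add: p1)
qed

text \<open>Two low labels in equal or neighbouring cells have the same component through a relay in
  the cell of the first. Walking over the cells of a square and across a common side makes the
  component of the label with index 0 constant on adjacent good sites, to which the renormalisation
  applies.\<close>

lemma good_sites_percolate:
  assumes m: "0 < m" "4 / real_of_int m \<le> r0" and g: "antitone_nonneg g" and c: "c = g r0"
    and n: "0 < n0" "n0 \<le> n"
    and pos: "\<And>l. \<omega> (Pos l) \<in> unit_square (lab_square m l)"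
    and good: "\<And>k. box_good (site_good n0 n c \<omega>) k (0, 0)"
  shows "gperc g {v. snd v < plain_N \<omega> (fst v)} (plain_X \<omega>) (plain_U \<omega>)"
proof -
  let ?V = "{v. snd v < plain_N \<omega> (fst v)}"
  let ?E = "gedge g ?V (plain_X \<omega>) (plain_U \<omega>)"
  let ?G = "site_good n0 n c \<omega>"
  define C where "C v = {w. ?E\<^sup>*\<^sup>* v w}" for v
  have C_edge: "C v = C w" if "?E v w" for v w
    unfolding C_def using that gedge_sym[OF that] by (auto intro: converse_rtranclp_into_rtranclp)
  have edge: "?E v w" if "v \<in> ?V" "w \<in> ?V" "v \<noteq> w" "plain_X \<omega> v \<in> cell m z" "plain_X \<omega> w \<in> cell m
      z'" "near 1 z z'"
    "plain_U \<omega> (gkey v w) < c" for v w z z'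
  proof -
    have "dist (plain_X \<omega> v) (plain_X \<omega> w) \<le> r0" using dist_adjacent_cells[OF m(1) that(4,5,6)] m(2)
        by linarith
    then have "c \<le> g (dist (plain_X \<omega> v) (plain_X \<omega> w))" using g unfolding antitone_nonneg_def c by simp
    then show ?thesis unfolding gedge_def using that by auto
  qed
  have low: "(s, k) \<in> ?V" if "?G s" "k < n" for s k using that by (auto simp: site_good_def)
  have relayed: "C (s, k) = C (t, j)"
    if rel: "?G s" "?G t" "t \<in> fwd s" "k < n0" "j < n0" "cell_square m z = s"
      "plain_X \<omega> (s, k) \<in> cell m z" "plain_X \<omega> (t, j) \<in> cell m z'" "near 1 z z'" for s k t j z z'
  proof (cases "(s, k) = (t, j)")
    case False
    have z: "z \<in> cells_of s" using rel(6) by (simp add: cells_of_def)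
    have "\<forall>k\<in>{..<n0}. \<forall>t\<in>fwd s. \<forall>j\<in>{..<n0}. \<forall>z\<in>cells_of s. (s, k) \<noteq> (t, j) \<longrightarrow>
        (\<exists>i\<in>{n0..<n}. relay c s k t j z \<omega> i)"
      using rel(1) unfolding site_good_def by blast
    then have "\<exists>i\<in>{n0..<n}. relay c s k t j z \<omega> i"
      using rel(3,4,5) z False unfolding lessThan_iff[symmetric] by blast
    then obtain i where i: "n0 \<le> i" "i < n" "relay c s k t j z \<omega> i" by auto
    have "?E (s, i) (s, k)"
      by (rule edge[of _ _ z z]) (use i rel n low in \<open>auto simp: relay_def near_def\<close>)
    moreover have "?E (s, i) (t, j)"
      by (rule edge[of _ _ z z']) (use i rel n low in \<open>auto simp: relay_def\<close>)
    ultimately show ?thesis using C_edge by metis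
  qed simp
  have cell_label: "\<exists>k<n0. plain_X \<omega> (s, k) \<in> cell m z" if "?G s" "cell_square m z = s" for s z
    using that unfolding site_good_def cells_of_def by blast
  \<comment> \<open>One low label per cell turns adjacency of cells into equality of
    components.\<close>
  define L where "L s z = (SOME k. k < n0 \<and> plain_X \<omega> (s, k) \<in> cell m z)" for s z
  have L: "L s z < n0" "plain_X \<omega> (s, L s z) \<in> cell m z" if "?G s" "cell_square m z = s" for s z
    using someI_ex[OF cell_label[OF that]] unfolding L_def by auto
  have sq: "cell_square m z = s \<longleftrightarrow> z \<in> {m * fst s..m * fst s + m - 1} \<times> {m * snd s..m * snd s +
      m - 1}" for s z
    using cell_square_vimage[OF m(1), of s] by blast
  have Lconst: "C (s, L s z) = C (s, L s z')" if G: "?G s" and z: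
      "cell_square m z = s" "cell_square m z' = s" for s z z'
  proof (rule rectangle_constant[where r = "\<lambda>z. C (s, L s z)"])
    show "z \<in> {m * fst s..m * fst s + m - 1} \<times> {m * snd s..m * snd s + m - 1}"
      "z' \<in> {m * fst s..m * fst s + m - 1} \<times> {m * snd s..m * snd s + m - 1}"
      using z sq by blast+
    fix y y' assume "y \<in> {m * fst s..m * fst s + m - 1} \<times> {m * snd s..m * snd s + m - 1}"
      "y' \<in> {m * fst s..m * fst s + m - 1} \<times> {m * snd s..m * snd s + m - 1}" and adj: "lattice_adj y y'"
    then have y: "cell_square m y = s" "cell_square m y' = s" using sq by blast+
    show "C (s, L s y) = C (s, L s y')"
      by (rule relayed[of s s "L s y" "L s y'" y y']) (use L[OF G] y adj G in \<open>auto simp: fwd_def near_def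
          lattice_adj_def\<close>)
  qed
  have site: "C (s, 0) = C (s, L s z)" if G: "?G s" and z: "cell_square m z = s" for s z
  proof -
    have "plain_X \<omega> (s, 0) \<in> unit_square s" using pos[of "Base s 0"] by (simp add: plain_X_def)
    then obtain y where y: "cell_square m y = s" "plain_X \<omega> (s, 0) \<in> cell m y"
      by (rule unit_square_cell[OF m(1)])
    have "C (s, 0) = C (s, L s y)"
      by (rule relayed[of s s 0 "L s y" y y]) (use L[OF G] y n G in \<open>auto simp: fwd_def near_def\<close>)
    then show ?thesis using Lconst[OF G y(1) z] by simp
  qed
  have adj: "C (s, 0) = C (t, 0)" if G: "?G s" "?G t" and st: "lattice_adj s t" for s t
  proof -
    \<comment> \<open>The two cells that face each other across the common side of s and t, at its
      lower or left end.\<close>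
    define z where "z = (if fst t = fst s then (m * fst s, m * snd s + m - 1) else (m * fst s + m - 1, m *
        snd s))"
    define z' where "z' = (if fst t = fst s then (m * fst s, m * snd s + m) else (m * fst s + m, m *
        snd s))"
    have zz: "cell_square m z = s" "cell_square m z' = t"
      unfolding sq using st m(1) by (auto simp: z_def z'_def lattice_adj_def algebra_simps split:
          if_splits)
    have "C (s, L s z) = C (t, L t z')"
      by (rule relayed[of s t "L s z" "L t z'" z z'])
        (use L[OF G(1) zz(1)] L[OF G(2) zz(2)] st G zz in \<open>auto simp: fwd_def near_def z_def z'_def
            lattice_adj_def\<close>)
    then show ?thesis using site[OF G(1) zz(1)] site[OF G(2) zz(2)] by simp
  qed
  obtain S where S: "infinite S" "\<And>s. s \<in> S \<Longrightarrow> ?G s" "\<And>s t. s \<in> S \<Longrightarrow> t \<in> S \<Longrightarrow> C (s, 0) = C (t, 0)"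
    using infinite_component_of_good_boxes[of ?G "\<lambda>s. C (s, 0)"] adj good by metis
  obtain s where s: "s \<in> S" using S(1) by (metis finite.emptyI equals0I)
  have "(\<lambda>t. (t, 0)) ` S \<subseteq> C (s, 0)"
  proof (rule image_subsetI)
    fix t assume "t \<in> S"
    then have "C (s, 0) = C (t, 0)" using S(3) s by blast
    moreover have "(t, 0) \<in> C (t, 0)" by (simp add: C_def)
    ultimately show "(t, 0) \<in> C (s, 0)" by simp
  qed
  moreover have "infinite ((\<lambda>t. (t, 0::nat)) ` S)" using S(1) by (simp add: finite_image_iff inj_on_def)
  ultimately have "infinite (C (s, 0))" using finite_subset by blast
  then show ?thesis unfolding gperc_def C_def using low[OF S(2)[OF s], of 0] n by blast
qed

end

lemma poisson_lower_tail:
  assumes "0 < e"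
  shows "\<exists>\<Lambda>>0. \<forall>lam\<ge>\<Lambda>. measure_pmf.prob (poisson_pmf lam) {..<n} \<le> e"
proof -
  have "((\<lambda>lam::real. \<Sum>k<n. lam ^ k / exp lam / fact k) \<longlongrightarrow> (\<Sum>k<n. 0 / fact k)) at_top"
    by (intro tendsto_sum tendsto_divide tendsto_power_div_exp_0 tendsto_const) simp
  then have "eventually (\<lambda>lam::real. (\<Sum>k<n. lam ^ k / exp lam / fact k) < e) at_top"
    using assms by (auto dest: order_tendstoD(2))
  then obtain L where L: "\<And>lam. lam \<ge> L \<Longrightarrow> (\<Sum>k<n. lam ^ k / exp lam / fact k) < e"
    by (auto simp: eventually_at_top_linorder)
  show ?thesis
  proof (intro exI[of _ "max L 1"] conjI allI impI)
    fix lam :: real assume lam: "max L 1 \<le> lam"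
    then have "measure_pmf.prob (poisson_pmf lam) {..<n} = (\<Sum>k<n. pmf (poisson_pmf lam) k)"
      by (intro measure_measure_pmf_finite) simp
    also have "\<dots> = (\<Sum>k<n. lam ^ k / exp lam / fact k)"
      using lam by (intro sum.cong) (auto simp: exp_minus field_simps)
    finally show "measure_pmf.prob (poisson_pmf lam) {..<n} \<le> e" using L[of lam] lam by simp
  qed simp
qed

text \<open>The order of choices is: the mesh m from r0, then n0 so that all cells are visited, then
  n so that relays exist, and the intensity last. Each of the three terms of
  \<open>prob_site_bad\<close> receives 1/972, a third of 1/324.\<close>

lemma RCM_supercritical:
  assumes g: "antitone_nonneg g" and r0: "0 < r0" "0 < g r0" "g r0 \<le> 1"
  shows "\<exists>\<Lambda>>0. \<forall>lam\<ge>\<Lambda>. \<not> (AE \<omega> in RCM_space lam. \<not> RCM_percolates g \<omega>)"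
proof -
  define c where "c = g r0"
  define m where "m = max 2 \<lceil>4 / r0\<rceil>"
  have m: "0 < m" "2 \<le> m" by (auto simp: m_def)
  have "4 / r0 \<le> real_of_int m" unfolding m_def by linarith
  then have m4: "4 / real_of_int m \<le> r0" using r0 m by (simp add: field_simps)
  have m2: "1 < (real_of_int m)\<^sup>2" using m by (simp add: one_less_power)
  let ?a = "1 - 1 / (real_of_int m)\<^sup>2" and ?b = "1 - c\<^sup>2 / (real_of_int m)\<^sup>2"
  have m0: "0 < (real_of_int m)\<^sup>2" using m2 by linarith
  have a: "0 \<le> ?a" "?a < 1" using m2 m0 by (simp_all add: divide_le_eq_1_pos)
  have c1: "0 < c" "c \<le> 1" using r0 by (auto simp: c_def)
  then have "c\<^sup>2 \<le> 1" "0 < c\<^sup>2" by (auto simp: power_le_one)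
  then have b: "0 \<le> ?b" "?b < 1" using m2 m0 by (simp_all add: divide_le_eq_1_pos)
  have "(\<lambda>k. real (nat m ^ 2) * ?a ^ k) \<longlonglongrightarrow> real (nat m ^ 2) * 0"
    by (intro tendsto_mult tendsto_const LIMSEQ_realpow_zero a)
  then have "eventually (\<lambda>k. real (nat m ^ 2) * ?a ^ k < 1 / 972) sequentially"
    by (rule order_tendstoD(2)) simp
  then obtain n1 where n1: "\<And>k. k \<ge> n1 \<Longrightarrow> real (nat m ^ 2) * ?a ^ k < 1 / 972"
    by (auto simp: eventually_sequentially)
  define n0 where "n0 = Suc n1"
  have n0: "0 < n0" "real (nat m ^ 2) * ?a ^ n0 \<le> 1 / 972" using n1[of n0] by (auto simp: n0_def)
  have "(\<lambda>k. real (3 * n0 * n0 * nat m ^ 2) * ?b ^ k) \<longlonglongrightarrow> real (3 * n0 * n0 * nat m ^ 2) * 0"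
    by (intro tendsto_mult tendsto_const LIMSEQ_realpow_zero b)
  then have "eventually (\<lambda>k. real (3 * n0 * n0 * nat m ^ 2) * ?b ^ k < 1 / 972) sequentially"
    by (rule order_tendstoD(2)) simp
  then obtain n2 where n2: "real (3 * n0 * n0 * nat m ^ 2) * ?b ^ n2 < 1 / 972"
    by (auto simp: eventually_sequentially)
  define n where "n = n0 + n2"
  obtain \<Lambda> where \<Lambda>: "0 < \<Lambda>" "\<And>lam. lam \<ge> \<Lambda> \<Longrightarrow> measure_pmf.prob (poisson_pmf lam) {..<n} \<le> 1 / 972"
    using poisson_lower_tail[of "1 / 972" n] by auto
  have "\<not> (AE \<omega> in RCM_space lam. \<not> RCM_percolates g \<omega>)" if lam: "\<Lambda> \<le> lam" for lam
  proof
    assume AE: "AE \<omega> in RCM_space lam. \<not> RCM_percolates g \<omega>"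
    interpret master lam 1 1 "\<lambda>_. return_pmf 0" m .
    let ?Q = "\<lambda>\<omega>. site_good n0 n c \<omega>"
    have bad: "P.prob {\<omega> \<in> space \<Omega>. \<not> ?Q \<omega> s} \<le> 1 / 324" for s
      using prob_site_bad[of c n0 n s] m c1 n0 n2 \<Lambda>(2)[OF lam] by (simp add: n_def)
    have pos: "0 < P.prob {\<omega> \<in> space \<Omega>. \<forall>k. box_good (?Q \<omega>) k (0, 0)}"
      by (rule percolation_of_good_sites[OF disjoint_site_coords _ depends_on_site_good bad])
        (rule pred_site_good[OF m(1)])
    have "AE \<omega> in distr \<Omega> (RCM_space lam) (\<lambda>\<omega>. (plain_N \<omega>, plain_X \<omega>, plain_U \<omega>)). \<not> RCM_percolates g \<omega>"
      using AE by (simp only: distr_plain(1))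
    then have "AE \<omega> in \<Omega>. \<not> RCM_percolates g (plain_N \<omega>, plain_X \<omega>, plain_U \<omega>)"
      by (rule AE_distrD[OF distr_plain(2)])
    then have "AE \<omega> in \<Omega>. \<not> (\<forall>k. box_good (?Q \<omega>) k (0, 0))"
      using AE_Pos
    proof eventually_elim
      case (elim \<omega>)
      then show ?case
        using good_sites_percolate[OF m(1) m4 g c_def n0(1), of n \<omega>]
        unfolding RCM_percolates_gperc n_def by auto
    qed
    then have "P.prob {\<omega> \<in> space \<Omega>. \<forall>k. box_good (?Q \<omega>) k (0, 0)} = 0"
      by (intro P.prob_eq_0_AE) simp
    then show False using pos by simp
  qed
  then show ?thesis using \<Lambda>(1) by blast
qed

section \<open>Relabelling, thinning and coupling of laws\<close>

text \<open>An injection that carries edges to edges sends an infinite component into a single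
  component of the target, so W may exceed the image.\<close>

lemma gperc_relabel:
  assumes inj: "inj_on \<iota> V" and W: "\<iota> ` V \<subseteq> W"
    and X: "\<And>v. v \<in> V \<Longrightarrow> X' v = X (\<iota> v)"
    and U: "\<And>v w. v \<in> V \<Longrightarrow> w \<in> V \<Longrightarrow> v \<noteq> w \<Longrightarrow> U' (gkey v w) = U (gkey (\<iota> v) (\<iota> w))"
    and perc: "gperc g V X' U'"
  shows "gperc g W X U"
proof -
  let ?E = "gedge g V X' U'" and ?F = "gedge g W X U"
  obtain v where v: "v \<in> V" "infinite {w. ?E\<^sup>*\<^sup>* v w}" using perc by (auto simp: gperc_def)
  have reach: "w \<in> V \<and> ?F\<^sup>*\<^sup>* (\<iota> v) (\<iota> w)" if "?E\<^sup>*\<^sup>* v w" for w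
    using that
  proof induction
    case (step w u)
    then have "?F (\<iota> w) (\<iota> u)"
      using W inj X U by (auto simp: gedge_def inj_on_eq_iff)
    moreover have "u \<in> V" using step(2) by (simp add: gedge_def)
    ultimately show ?case using step by auto
  qed (use v in simp)
  have "infinite (\<iota> ` {w. ?E\<^sup>*\<^sup>* v w})"
    using v(2) reach inj by (subst finite_image_iff) (auto intro: inj_on_subset)
  moreover have "\<iota> ` {w. ?E\<^sup>*\<^sup>* v w} \<subseteq> {w. ?F\<^sup>*\<^sup>* (\<iota> v) w}" using reach by auto
  ultimately have "infinite {w. ?F\<^sup>*\<^sup>* (\<iota> v) w}" using finite_subset by blast
  then show ?thesis using v(1) W by (auto simp: gperc_def)
qed

text \<open>For a fixed vertex set only the number of vertices in each square matters. Numbering the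
  vertices within each square embeds V into standard labels, and both product laws have the same
  projection to the positions of V and the marks of its pairs, where the null event can be
  compared.\<close>

lemma relabel_null:
  fixes V :: "'l::countable set" and sq :: "'l \<Rightarrow> int \<times> int"
  assumes g: "antitone_nonneg g" and fin: "\<And>s. finite {v \<in> V. sq v = s}"
    and null: "AE x in PiM UNIV (\<lambda>v::label. square_unif (fst v)) \<Otimes>\<^sub>M PiM UNIV (\<lambda>_::label \<times> label. unif01).
      \<not> gperc g {v. snd v < card {w \<in> V. sq w = fst v}} (fst x) (snd x)"
  shows "AE x in PiM UNIV (\<lambda>v::'l. square_unif (sq v)) \<Otimes>\<^sub>M PiM UNIV (\<lambda>_::'l \<times> 'l. unif01). \<not> gperc g V
      (fst x) (snd x)"
proof -
  have "\<exists>h. bij_betw h {v \<in> V. sq v = s} {0..<card {v \<in> V. sq v = s}}" for s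
    by (rule ex_bij_betw_finite_nat[OF fin])
  then obtain h where h: "\<And>s. bij_betw (h s) {v \<in> V. sq v = s} {0..<card {v \<in> V. sq v = s}}" by metis
  define \<iota> where "\<iota> v = (sq v, h (sq v) v)" for v
  let ?W = "{v. snd v < card {w \<in> V. sq w = fst v}}"
  have inj: "inj_on \<iota> V"
  proof (rule inj_onI)
    fix v w assume vw: "v \<in> V" "w \<in> V" "\<iota> v = \<iota> w"
    then have "sq w = sq v" "h (sq v) v = h (sq v) w" by (auto simp: \<iota>_def)
    then show "v = w" using bij_betw_imp_inj_on[OF h[of "sq v"]] vw(1,2) by (auto dest: inj_onD)
  qed
  have W: "\<iota> ` V \<subseteq> ?W"
  proof (rule image_subsetI)
    fix v assume "v \<in> V"
    then have "h (sq v) v \<in> {0..<card {w \<in> V. sq w = sq v}}"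
      using bij_betw_imp_surj_on[OF h[of "sq v"]] by blast
    then show "\<iota> v \<in> ?W" by (simp add: \<iota>_def)
  qed
  \<comment> \<open>One key per unordered pair in V. The relabelling need not respect the orders
    behind \<open>gkey\<close>, so \<open>\<kappa>\<close> sorts each image pair anew.\<close>
  define K where "K = {e. fst e \<in> V \<and> snd e \<in> V \<and> fst e \<noteq> snd e \<and> gkey (fst e) (snd e) = e}"
  define \<kappa> where "\<kappa> e = gkey (\<iota> (fst e)) (\<iota> (snd e))" for e
  have K: "gkey v w \<in> K" if "v \<in> V" "w \<in> V" "v \<noteq> w" for v w
    unfolding K_def using that gkey_cases[of v w] gkey_idem[of v w] by auto
  have \<kappa>: "\<kappa> (gkey v w) = gkey (\<iota> v) (\<iota> w)" for v w
    unfolding \<kappa>_def using gkey_cases[of v w] gkey_commute[of "\<iota> v" "\<iota> w"] by auto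
  have inj\<kappa>: "inj_on \<kappa> K"
  proof (rule inj_onI)
    fix e e' assume e: "e \<in> K" "e' \<in> K" "\<kappa> e = \<kappa> e'"
    then have "fst e = fst e' \<and> snd e = snd e' \<or> fst e = snd e' \<and> snd e = fst e'"
      using inj unfolding \<kappa>_def gkey_eq_iff K_def by (auto dest: inj_onD)
    then show "e = e'"
    proof
      assume "fst e = snd e' \<and> snd e = fst e'"
      then have "gkey (fst e) (snd e) = gkey (fst e') (snd e')" by (simp add: gkey_commute)
      then show ?thesis using e by (simp add: K_def)
    qed (simp add: prod_eq_iff)
  qed
  let ?AL = "PiM UNIV (\<lambda>v::label. square_unif (fst v))" and ?BL = "PiM UNIV (\<lambda>_::label \<times> label. unif01)"
  let ?A = "PiM UNIV (\<lambda>v::'l. square_unif (sq v))" and ?B = "PiM UNIV (\<lambda>_::'l \<times> 'l. unif01)"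
  let ?AV = "PiM V (\<lambda>v. square_unif (sq v))" and ?BV = "PiM K (\<lambda>_. unif01)"
  let ?T = "\<lambda>(x, y). (\<lambda>v\<in>V. x (\<iota> v), \<lambda>e\<in>K. y (\<kappa> e))"
  let ?R = "\<lambda>(x, y). (\<lambda>v\<in>V. x v, \<lambda>e\<in>K. y e)"
  have sf: "sigma_finite_measure ?BV"
    by (intro prob_space_imp_sigma_finite prob_space_PiM prob_unif01)
  have a1: "distr ?AL ?AV (\<lambda>x. \<lambda>v\<in>V. x (\<iota> v)) = ?AV"
    using distr_PiM_reindex[of UNIV "\<lambda>v::label. square_unif (fst v)" \<iota> V] inj prob_square_unif
    by (simp add: \<iota>_def)
  have b1: "distr ?BL ?BV (\<lambda>y. \<lambda>e\<in>K. y (\<kappa> e)) = ?BV"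
    using distr_PiM_reindex[of UNIV "\<lambda>_::label \<times> label. unif01" \<kappa> K] inj\<kappa> prob_unif01 by simp
  have a2: "distr ?A ?AV (\<lambda>x. \<lambda>v\<in>V. x v) = ?AV"
    using distr_PiM_reindex[of UNIV "\<lambda>v. square_unif (sq v)" "\<lambda>v. v" V] prob_square_unif by simp
  have b2: "distr ?B ?BV (\<lambda>y. \<lambda>e\<in>K. y e) = ?BV"
    using distr_PiM_reindex[of UNIV "\<lambda>_::'l \<times> 'l. unif01" "\<lambda>e. e" K] prob_unif01 by simp
  have m1: "(\<lambda>x. \<lambda>v\<in>V. x (\<iota> v)) \<in> ?AL \<rightarrow>\<^sub>M ?AV"
    by (rule measurable_restrict) (simp add: \<iota>_def measurable_component_singleton[of "\<iota> _" UNIV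
        "\<lambda>v::label. square_unif (fst v)", unfolded \<iota>_def, simplified])
  have m2: "(\<lambda>y. \<lambda>e\<in>K. y (\<kappa> e)) \<in> ?BL \<rightarrow>\<^sub>M ?BV" by (rule measurable_restrict) simp
  have m3: "(\<lambda>x. \<lambda>v\<in>V. x v) \<in> ?A \<rightarrow>\<^sub>M ?AV" by (rule measurable_restrict) simp
  have m4: "(\<lambda>y. \<lambda>e\<in>K. y e) \<in> ?B \<rightarrow>\<^sub>M ?BV" by (rule measurable_restrict) simp
  have T: "?T \<in> ?AL \<Otimes>\<^sub>M ?BL \<rightarrow>\<^sub>M ?AV \<Otimes>\<^sub>M ?BV"
    unfolding case_prod_beta using m1 m2
    by (intro measurable_Pair) (auto intro: measurable_compose[OF measurable_fst] measurable_compose[OF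
        measurable_snd])
  have R: "?R \<in> ?A \<Otimes>\<^sub>M ?B \<rightarrow>\<^sub>M ?AV \<Otimes>\<^sub>M ?BV"
    unfolding case_prod_beta using m3 m4
    by (intro measurable_Pair) (auto intro: measurable_compose[OF measurable_fst] measurable_compose[OF
        measurable_snd])
  have "distr ?AL ?AV (\<lambda>x. \<lambda>v\<in>V. x (\<iota> v)) \<Otimes>\<^sub>M distr ?BL ?BV (\<lambda>y. \<lambda>e\<in>K. y (\<kappa> e)) =
      distr (?AL \<Otimes>\<^sub>M ?BL) (?AV \<Otimes>\<^sub>M ?BV) ?T"
    by (rule pair_measure_distr[OF m1 m2]) (simp only: b1 sf)
  then have dT: "distr (?AL \<Otimes>\<^sub>M ?BL) (?AV \<Otimes>\<^sub>M ?BV) ?T = ?AV \<Otimes>\<^sub>M ?BV" by (simp only: a1 b1)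
  have "distr ?A ?AV (\<lambda>x. \<lambda>v\<in>V. x v) \<Otimes>\<^sub>M distr ?B ?BV (\<lambda>y. \<lambda>e\<in>K. y e) =
      distr (?A \<Otimes>\<^sub>M ?B) (?AV \<Otimes>\<^sub>M ?BV) ?R"
    by (rule pair_measure_distr[OF m3 m4]) (simp only: b2 sf)
  then have dR: "distr (?A \<Otimes>\<^sub>M ?B) (?AV \<Otimes>\<^sub>M ?BV) ?R = ?AV \<Otimes>\<^sub>M ?BV" by (simp only: a2 b2)
  have meas: "Measurable.pred (?AV \<Otimes>\<^sub>M ?BV) (\<lambda>x. gperc g V (fst x) (snd x))"
  proof (rule pred_gperc[OF g, where W = V])
    show "(\<lambda>x. fst x v) \<in> borel_measurable (?AV \<Otimes>\<^sub>M ?BV)" if "v \<in> V" for v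
    proof -
      have "(\<lambda>x. fst x v) \<in> ?AV \<Otimes>\<^sub>M ?BV \<rightarrow>\<^sub>M square_unif (sq v)"
        by (rule measurable_compose[OF measurable_fst measurable_component_singleton[OF that]])
      then show ?thesis by (simp cong: measurable_cong_sets)
    qed
    show "(\<lambda>x. snd x (gkey v w)) \<in> borel_measurable (?AV \<Otimes>\<^sub>M ?BV)" if "v \<in> V" "w \<in> V" "v \<noteq> w" for v w
    proof -
      have "(\<lambda>x. snd x (gkey v w)) \<in> ?AV \<Otimes>\<^sub>M ?BV \<rightarrow>\<^sub>M unif01"
        by (rule measurable_compose[OF measurable_snd measurable_component_singleton[OF K[OF that]]])
      then show ?thesis by (simp cong: measurable_cong_sets)
    qed
  qed auto
  have "AE x in ?AL \<Otimes>\<^sub>M ?BL. \<not> gperc g V (fst (?T x)) (snd (?T x))"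
    using null
  proof eventually_elim
    case (elim x)
    then show ?case
      using gperc_relabel[OF inj W, of "fst (?T x)" "fst x" "snd (?T x)" "snd x" g] K \<kappa>
          by (auto simp: case_prod_beta)
  qed
  then have "AE x in distr (?AL \<Otimes>\<^sub>M ?BL) (?AV \<Otimes>\<^sub>M ?BV) ?T. \<not> gperc g V (fst x) (snd x)"
    by (subst AE_distr_iff[OF T]) (use meas in \<open>measurable\<close>)
  then have "AE x in distr (?A \<Otimes>\<^sub>M ?B) (?AV \<Otimes>\<^sub>M ?BV) ?R. \<not> gperc g V (fst x) (snd x)"
    by (simp only: dT dR)
  then have "AE x in ?A \<Otimes>\<^sub>M ?B. \<not> gperc g V (fst (?R x)) (snd (?R x))"
    by (rule AE_distrD[OF R])
  then show ?thesis
  proof eventually_elim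
    case (elim x)
    then show ?case
      using gperc_relabel[of "\<lambda>v. v" V V "fst x" "fst (?R x)" "snd x" "snd (?R x)" g] K 
      by (auto simp: case_prod_beta)
  qed
qed

section \<open>Laws of counts: superposition, thinning and coupling\<close>

lemma nat_law_eqI:
  assumes "prob_space M" and Y: "Y \<in> measurable M (count_space UNIV)"
    and eq: "\<And>n::nat. measure M {\<omega> \<in> space M. Y \<omega> = n} = pmf p n"
  shows "distr M (count_space UNIV) Y = measure_pmf p"
proof -
  interpret prob_space M by fact
  have "emeasure (distr M (count_space UNIV) Y) {n} = emeasure (measure_pmf p) {n}" for n
  proof -
    have "Y -` {n} \<inter> space M = {\<omega> \<in> space M. Y \<omega> = n}" by auto
    then have "emeasure (distr M (count_space UNIV) Y) {n} = emeasure M {\<omega> \<in> space M. Y \<omega> = n}"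
      using Y by (simp add: emeasure_distr)
    then show ?thesis by (simp add: emeasure_eq_measure eq emeasure_pmf_single)
  qed
  then show ?thesis by (intro measure_eqI_countable[of _ UNIV]) auto
qed

text \<open>Total mass 1 determines the mass at 0. This is convenient for
  \<open>coupled_count\<close>, whose value 0 arises in several ways.\<close>

lemma nat_law_eqI_pos:
  assumes "prob_space M" and Y: "Y \<in> measurable M (count_space UNIV)"
    and eq: "\<And>n::nat. 0 < n \<Longrightarrow> measure M {\<omega> \<in> space M. Y \<omega> = n} = pmf p n"
  shows "distr M (count_space UNIV) Y = measure_pmf p"
proof (rule nat_law_eqI[OF assms(1) Y])
  interpret prob_space M by fact
  fix n
  show "measure M {\<omega> \<in> space M. Y \<omega> = n} = pmf p n"
  proof (cases "n = 0")
    case True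
    have [measurable]: "{\<omega> \<in> space M. Y \<omega> = k} \<in> events" for k using Y by measurable
    have "(\<lambda>k. prob {\<omega> \<in> space M. Y \<omega> = Suc k}) sums prob (\<Union>k. {\<omega> \<in> space M. Y \<omega> = Suc k})"
      by (rule finite_measure_UNION) (auto simp: disjoint_family_on_def)
    moreover have "(\<Union>k. {\<omega> \<in> space M. Y \<omega> = Suc k}) = space M - {\<omega> \<in> space M. Y \<omega> = 0}"
      using not0_implies_Suc by auto
    moreover have "prob (space M - {\<omega> \<in> space M. Y \<omega> = 0}) = 1 - prob {\<omega> \<in> space M. Y \<omega> = 0}"
      by (rule prob_compl) measurable
    ultimately have 1: "(\<lambda>k. pmf p (Suc k)) sums (1 - prob {\<omega> \<in> space M. Y \<omega> = 0})" by (simp add: eq)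
    have "(\<lambda>k. measure (measure_pmf p) {Suc k}) sums measure (measure_pmf p) (\<Union>k. {Suc k})"
      by (rule measure_pmf.finite_measure_UNION) (auto simp: disjoint_family_on_def)
    moreover have "(\<Union>k. {Suc k}) = UNIV - {0}" using not0_implies_Suc by auto
    moreover have "measure (measure_pmf p) (UNIV - {0}) = 1 - pmf p 0"
      using measure_pmf.prob_compl[of "{0}" p] by (simp add: pmf.rep_eq)
    ultimately have "(\<lambda>k. pmf p (Suc k)) sums (1 - pmf p 0)" by (simp add: pmf.rep_eq)
    from sums_unique2[OF 1 this] show ?thesis using True by simp
  qed (simp add: eq)
qed

context univ_product
begin

lemma prob_law:
  assumes "Y \<in> measurable \<Omega> (count_space UNIV)" "distr \<Omega> (count_space UNIV) Y = measure_pmf p"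
  shows "P.prob {\<omega> \<in> space \<Omega>. Y \<omega> = n} = pmf p n"
proof -
  have "pmf p n = measure (distr \<Omega> (count_space UNIV) Y) {n}" by (simp add: assms(2) pmf.rep_eq)
  also have "\<dots> = P.prob (Y -` {n} \<inter> space \<Omega>)" using assms(1) by (subst measure_distr) auto
  also have "Y -` {n} \<inter> space \<Omega> = {\<omega> \<in> space \<Omega>. Y \<omega> = n}" by auto
  finally show ?thesis by simp
qed

lemma distr_poisson_add:
  assumes a: "0 < a" "0 < b" and disj: "J \<inter> J' = {}"
    and Y [measurable]: "Y \<in> measurable \<Omega> (count_space UNIV)" and depY: "depends_on J Y"
    and Z [measurable]: "Z \<in> measurable \<Omega> (count_space UNIV)" and depZ: "depends_on J' Z"
    and lawY: "distr \<Omega> (count_space UNIV) Y = measure_pmf (poisson_pmf a)"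
    and lawZ: "distr \<Omega> (count_space UNIV) Z = measure_pmf (poisson_pmf b)"
  shows "distr \<Omega> (count_space UNIV) (\<lambda>\<omega>. Y \<omega> + Z \<omega> :: nat) = measure_pmf (poisson_pmf (a + b))"
proof (rule nat_law_eqI)
  show "prob_space \<Omega>" by unfold_locales
  show "(\<lambda>\<omega>. Y \<omega> + Z \<omega>) \<in> \<Omega> \<rightarrow>\<^sub>M count_space UNIV" by measurable
  fix n
  let ?A = "\<lambda>k. {\<omega> \<in> space \<Omega>. Y \<omega> = k \<and> Z \<omega> = n - k}"
  have "{\<omega> \<in> space \<Omega>. Y \<omega> + Z \<omega> = n} = (\<Union>k\<in>{..n}. ?A k)" by auto
  then have "P.prob {\<omega> \<in> space \<Omega>. Y \<omega> + Z \<omega> = n} = P.prob (\<Union>k\<in>{..n}. ?A k)" by simp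
  also have "\<dots> = (\<Sum>k\<le>n. P.prob (?A k))"
    by (rule P.finite_measure_finite_Union) (auto simp: disjoint_family_on_def)
  also have "\<dots> = (\<Sum>k\<le>n. pmf (poisson_pmf a) k * pmf (poisson_pmf b) (n - k))"
  proof (rule sum.cong[OF refl])
    fix k
    have "P.prob (?A k) = P.prob {\<omega> \<in> space \<Omega>. Y \<omega> = k} * P.prob {\<omega> \<in> space \<Omega>. Z \<omega> = n - k}"
      by (rule prob_conj_depends_on[OF disj]) (auto intro: depends_on_eq depY depZ)
    then show "P.prob (?A k) = pmf (poisson_pmf a) k * pmf (poisson_pmf b) (n - k)"
      by (simp only: prob_law[OF Y lawY] prob_law[OF Z lawZ])
  qed
  also have "\<dots> = (\<Sum>k\<le>n. of_nat (n choose k) * a ^ k * b ^ (n - k)) / fact n * exp (- (a + b))"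
    unfolding sum_divide_distrib sum_distrib_right
    using a by (intro sum.cong refl) (simp add: binomial_fact exp_add[of
        "- a" "- b", simplified] field_simps)
  also have "\<dots> = pmf (poisson_pmf (a + b)) n"
    using a by (simp add: binomial_ring)
  finally show "P.prob {\<omega> \<in> space \<Omega>. Y \<omega> + Z \<omega> = n} = pmf (poisson_pmf (a + b)) n" .
qed

lemma prob_binomial:
  assumes disj: "disjoint_family J"
    and F [measurable]: "\<And>k::nat. Measurable.pred \<Omega> (F k)" and dep: "\<And>k. depends_on (J k) (F k)"
    and p: "\<And>k. P.prob {\<omega> \<in> space \<Omega>. F k \<omega>} = p"
  shows "P.prob {\<omega> \<in> space \<Omega>. card {k \<in> {..<H}. F k \<omega>} = n} = of_nat (H choose n) * p ^ n *
      (1 - p) ^ (H - n)"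
proof -
  let ?S = "{S. S \<subseteq> {..<H} \<and> card S = n}"
  let ?A = "\<lambda>S. {\<omega> \<in> space \<Omega>. \<forall>k\<in>{..<H}. F k \<omega> \<longleftrightarrow> k \<in> S}"
  have q: "P.prob {\<omega> \<in> space \<Omega>. \<not> F k \<omega>} = 1 - p" for k
    using prob_not[OF F] p by simp
  have "{\<omega> \<in> space \<Omega>. card {k \<in> {..<H}. F k \<omega>} = n} = (\<Union>S\<in>?S. ?A S)"
  proof (intro set_eqI iffI)
    fix \<omega> assume "\<omega> \<in> {\<omega> \<in> space \<Omega>. card {k \<in> {..<H}. F k \<omega>} = n}"
    then show "\<omega> \<in> (\<Union>S\<in>?S. ?A S)" by (intro UN_I[of "{k \<in> {..<H}. F k \<omega>}"]) auto
  next
    fix \<omega> assume "\<omega> \<in> (\<Union>S\<in>?S. ?A S)"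
    then obtain S where S: "S \<subseteq> {..<H}" "card S = n" "\<omega> \<in> ?A S" by blast
    then have "{k \<in> {..<H}. F k \<omega>} = S" by auto
    then show "\<omega> \<in> {\<omega> \<in> space \<Omega>. card {k \<in> {..<H}. F k \<omega>} = n}" using S by simp
  qed
  then have "P.prob {\<omega> \<in> space \<Omega>. card {k \<in> {..<H}. F k \<omega>} = n} = P.prob (\<Union>S\<in>?S. ?A S)" by simp
  also have "\<dots> = (\<Sum>S\<in>?S. P.prob (?A S))"
  proof (rule P.finite_measure_finite_Union)
    show "finite ?S" by simp
    show "disjoint_family_on ?A ?S" unfolding disjoint_family_on_def by blast
  qed auto
  also have "\<dots> = (\<Sum>S\<in>?S. p ^ n * (1 - p) ^ (H - n))"
  proof (rule sum.cong[OF refl])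
    fix S assume S: "S \<in> ?S"
    have "P.prob (?A S) = (\<Prod>k\<in>{..<H}. P.prob {\<omega> \<in> space \<Omega>. F k \<omega> \<longleftrightarrow> k \<in> S})"
    proof (rule prob_ball_depends_on[where J = J])
      show "disjoint_family_on J {..<H}" using disj by (auto simp: disjoint_family_on_def)
      show "depends_on (J k) (\<lambda>\<omega>. F k \<omega> \<longleftrightarrow> k \<in> S)" for k using dep[of k] by (auto simp: depends_on_def)
    qed auto
    also have "\<dots> = (\<Prod>k\<in>{..<H}. if k \<in> S then p else 1 - p)"
      by (rule prod.cong) (auto simp: p q)
    also have "\<dots> = p ^ card ({..<H} \<inter> S) * (1 - p) ^ card ({..<H} - S)"
      by (simp add: prod.If_cases Diff_eq)
    also have "\<dots> = p ^ n * (1 - p) ^ (H - n)"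
      using S by (auto simp: Int_absorb1 card_Diff_subset finite_subset[OF _ finite_lessThan])
    finally show "P.prob (?A S) = p ^ n * (1 - p) ^ (H - n)" .
  qed
  finally show ?thesis using n_subsets[of "{..<H}" n] by simp
qed

text \<open>The flags exist for every k and are independent of the count, so each joint probability
  is a Poisson weight times a binomial weight. Summing over the number j of discarded points
  produces the exponential series of \<open>a * (1 - p)\<close>.\<close>

lemma distr_poisson_thinning:
  assumes a: "0 < a" and p: "0 < p" "p \<le> 1"
    and N [measurable]: "N \<in> measurable \<Omega> (count_space UNIV)" and depN: "depends_on JN N"
    and lawN: "distr \<Omega> (count_space UNIV) N = measure_pmf (poisson_pmf a)"
    and disj: "disjoint_family J" and disjN: "\<And>k. JN \<inter> J k = {}"
    and F [measurable]: "\<And>k::nat. Measurable.pred \<Omega> (F k)" and dep: "\<And>k. depends_on (J k) (F k)"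
    and pF: "\<And>k. P.prob {\<omega> \<in> space \<Omega>. F k \<omega>} = p"
  shows "(\<lambda>\<omega>. card {k \<in> {..<N \<omega>}. F k \<omega>}) \<in> measurable \<Omega> (count_space UNIV)" (is "?C \<in> _")
    and "distr \<Omega> (count_space UNIV) (\<lambda>\<omega>. card {k \<in> {..<N \<omega>}. F k \<omega>}) = measure_pmf (poisson_pmf (p * a))"
proof -
  have [measurable]: "Measurable.pred \<Omega> (\<lambda>\<omega>. card {k \<in> {..<H}. F k \<omega>} = n)" for H n
  proof -
    have "(\<lambda>\<omega>. card {k \<in> {..<H}. F k \<omega>}) = (\<lambda>\<omega>. \<Sum>k<H. if F k \<omega> then 1 else 0)"
      by (simp add: sum.If_cases Int_def)
    then show ?thesis by measurable
  qed
  have "{\<omega> \<in> space \<Omega>. ?C \<omega> = n} = (\<Union>H. {\<omega> \<in> space \<Omega>. N \<omega> = H \<and> card {k \<in> {..<H}. F k \<omega>} = n})" for n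
    by auto
  then have ev: "{\<omega> \<in> space \<Omega>. ?C \<omega> = n} \<in> P.events" for n by simp
  have "?C -` A \<inter> space \<Omega> \<in> P.events" for A
  proof -
    have "?C -` A \<inter> space \<Omega> = (\<Union>n\<in>A. {\<omega> \<in> space \<Omega>. ?C \<omega> = n})" by auto
    then show ?thesis using ev by (simp add: sets.countable_UN')
  qed
  then show C: "?C \<in> measurable \<Omega> (count_space UNIV)" by (simp add: measurable_def)
  show "distr \<Omega> (count_space UNIV) ?C = measure_pmf (poisson_pmf (p * a))"
  proof (rule nat_law_eqI[OF _ C])
    show "prob_space \<Omega>" by unfold_locales
    fix n
    let ?A = "\<lambda>j. {\<omega> \<in> space \<Omega>. N \<omega> = n + j \<and> card {k \<in> {..<n + j}. F k \<omega>} = n}"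
    have le: "n \<le> N \<omega>" if "?C \<omega> = n" for \<omega>
    proof -
      have "?C \<omega> \<le> card {..<N \<omega>}" by (rule card_mono) auto
      then show ?thesis using that by simp
    qed
    have eqA: "{\<omega> \<in> space \<Omega>. ?C \<omega> = n} = (\<Union>j. ?A j)"
    proof (intro set_eqI iffI)
      fix \<omega> assume w: "\<omega> \<in> {\<omega> \<in> space \<Omega>. ?C \<omega> = n}"
      then have "N \<omega> = n + (N \<omega> - n)" using le by simp
      then show "\<omega> \<in> (\<Union>j. ?A j)" using w by (intro UN_I[of "N \<omega> - n"]) auto
    qed auto
    have s1: "(\<lambda>j. P.prob (?A j)) sums P.prob {\<omega> \<in> space \<Omega>. ?C \<omega> = n}"
      unfolding eqA by (rule P.finite_measure_UNION) (auto simp: disjoint_family_on_def)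
    have PA: "P.prob (?A j) = (p * a) ^ n / fact n * exp (- a) * ((a * (1 - p)) ^ j / fact j)" for j
    proof -
      have "P.prob (?A j) = P.prob {\<omega> \<in> space \<Omega>. N \<omega> = n + j} * P.prob {\<omega> \<in> space \<Omega>. card {k \<in> {..<n +
          j}. F k \<omega>} = n}"
      proof (rule prob_conj_depends_on[where J = JN and J' = "\<Union>k. J k"])
        show "JN \<inter> (\<Union>k. J k) = {}" using disjN by blast
        show "depends_on (\<Union>k. J k) (\<lambda>\<omega>. card {k \<in> {..<n + j}. F k \<omega>} = n)"
        proof (rule depends_onI)
          fix \<omega> \<omega>' :: "'i \<Rightarrow> 'b" assume e: "\<And>i. i \<in> (\<Union>k. J k) \<Longrightarrow> \<omega> i = \<omega>' i"
          have "F k \<omega> = F k \<omega>'" for k by (rule depends_onD[OF dep]) (use e in blast)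
          then show "(card {k \<in> {..<n + j}. F k \<omega>} = n) = (card {k \<in> {..<n + j}. F k \<omega>'} = n)" by simp
        qed
      qed (auto intro: depends_on_eq depN)
      also have "\<dots> = a ^ (n + j) / fact (n + j) * exp (- a) * (of_nat ((n + j) choose n) * p ^ n *
          (1 - p) ^ j)"
        unfolding prob_law[OF N lawN] prob_binomial[OF disj F dep pF] using a by simp
      also have "of_nat ((n + j) choose n) = fact (n + j) / (fact n * fact j :: real)"
        by (simp add: binomial_fact)
      also have "a ^ (n + j) / fact (n + j) * exp (- a) * (fact (n + j) / (fact n * fact j) * p ^ n *
          (1 - p) ^ j) =
          (p * a) ^ n / fact n * exp (- a) * ((a * (1 - p)) ^ j / fact j)"
        unfolding power_mult_distrib power_add by (simp add: divide_simps mult_ac)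
      finally show ?thesis .
    qed
    have "(\<lambda>j. (p * a) ^ n / fact n * exp (- a) * ((a * (1 - p)) ^ j / fact j)) sums
        ((p * a) ^ n / fact n * exp (- a) * exp (a * (1 - p)))"
      using exp_converges[of "a * (1 - p)"]
          by (intro sums_mult) (simp add: scaleR_conv_of_real divide_inverse mult.commute)
    then have "P.prob {\<omega> \<in> space \<Omega>. ?C \<omega> = n} = (p * a) ^ n / fact n * exp (- a) * exp (a * (1 - p))"
      using s1 unfolding PA by (rule sums_unique2[rotated])
    also have "\<dots> = (p * a) ^ n / fact n * exp (- (p * a))"
      by (simp add: mult.assoc exp_add[symmetric] algebra_simps)
    finally show "P.prob {\<omega> \<in> space \<Omega>. ?C \<omega> = n} = pmf (poisson_pmf (p * a)) n" using a p by simp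
  qed
qed

end

text \<open>The auxiliary law \<open>dense_pmf\<close> is chosen such that \<open>coupled_count\<close> has the same Poisson law as
  its first argument, while it exceeds K only if the event of probability g occurs.\<close>

definition dense_pmf :: "real \<Rightarrow> nat \<Rightarrow> real \<Rightarrow> nat pmf" where
  "dense_pmf a K g = bind_pmf (bernoulli_pmf (measure_pmf.prob (poisson_pmf a) {K<..} / (exp (- a) * g)))
    (\<lambda>b. if b then cond_pmf (poisson_pmf a) {K<..} else return_pmf 0)"

definition coupled_count :: "nat \<Rightarrow> nat \<Rightarrow> bool \<Rightarrow> nat \<Rightarrow> nat" where
  "coupled_count K n b z = (if 1 \<le> n \<and> n \<le> K then n else if n = 0 \<and> b then z else 0)"

text \<open>An empty square in which the event occurs has probability \<open>exp (- a) * g\<close>.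
  Dividing by it gives each value above K its Poisson mass; the tail condition says exactly that the
  resulting total is at most 1.\<close>

lemma pmf_dense_pmf:
  assumes a: "0 < a" and g: "0 < g" "measure_pmf.prob (poisson_pmf a) {K<..} \<le> exp (- a) * g" and n:
      "0 < n"
  shows "pmf (dense_pmf a K g) n = (if K < n then pmf (poisson_pmf a) n / (exp (- a) * g) else 0)"
proof -
  let ?T = "measure_pmf.prob (poisson_pmf a) {K<..}"
  have ne: "set_pmf (poisson_pmf a) \<inter> {K<..} \<noteq> {}" using a by (auto simp: intro: exI[of _ "Suc K"])
  have T: "0 < ?T" using ne by (auto simp: measure_pmf_posI)
  have r: "0 \<le> ?T / (exp (- a) * g)" "?T / (exp (- a) * g) \<le> 1" using g by (auto simp: divide_le_eq_1)
  have "pmf (dense_pmf a K g) n = ?T / (exp (- a) * g) * pmf (cond_pmf (poisson_pmf a) {K<..}) n"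
    unfolding dense_pmf_def pmf_bind using r n by (subst integral_bernoulli_pmf) auto
  then show ?thesis using ne T by (simp add: pmf_cond)
qed

lemma set_dense_pmf:
  assumes "0 < a" "n \<in> set_pmf (dense_pmf a K g)"
  shows "n = 0 \<or> K < n"
proof -
  have ne: "set_pmf (poisson_pmf a) \<inter> {K<..} \<noteq> {}" using assms(1) by (auto intro: exI[of _ "Suc K"])
  show ?thesis using assms(2) unfolding dense_pmf_def by (auto simp: set_cond_pmf[OF ne] split: if_splits)
qed

context univ_product
begin

text \<open>Up to null sets, a value between 1 and K comes only from N itself and a value above K
  only from Z in an empty square with G. Original counts above K are turned into 0, and the mass at
  0 then has no choice.\<close>

lemma distr_coupled_count:
  assumes a: "0 < a" and g: "0 < g" "measure_pmf.prob (poisson_pmf a) {K<..} \<le> exp (- a) * g"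
    and N [measurable]: "N \<in> measurable \<Omega> (count_space UNIV)" and depN: "depends_on JN N"
    and lawN: "distr \<Omega> (count_space UNIV) N = measure_pmf (poisson_pmf a)"
    and G [measurable]: "Measurable.pred \<Omega> G" and depG: "depends_on JG G" and probG:
        "P.prob {\<omega> \<in> space \<Omega>. G \<omega>} = g"
    and Z [measurable]: "Z \<in> measurable \<Omega> (count_space UNIV)" and depZ: "depends_on JZ Z"
    and lawZ: "distr \<Omega> (count_space UNIV) Z = measure_pmf (dense_pmf a K g)"
    and disj: "JN \<inter> JG = {}" "JN \<inter> JZ = {}" "JG \<inter> JZ = {}"
  shows "distr \<Omega> (count_space UNIV) (\<lambda>\<omega>. coupled_count K (N \<omega>) (G \<omega>) (Z \<omega>)) = measure_pmf (poisson_pmf a)"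
proof (rule nat_law_eqI_pos)
  show "prob_space \<Omega>" by unfold_locales
  show "(\<lambda>\<omega>. coupled_count K (N \<omega>) (G \<omega>) (Z \<omega>)) \<in> \<Omega> \<rightarrow>\<^sub>M count_space UNIV"
    unfolding coupled_count_def by measurable
  fix n :: nat assume n: "0 < n"
  have Z: "P.prob {\<omega> \<in> space \<Omega>. N \<omega> = 0 \<and> (G \<omega> \<and> Z \<omega> = n)} = exp (- a) * g * pmf (dense_pmf a K g) n"
  proof -
    have "P.prob {\<omega> \<in> space \<Omega>. N \<omega> = 0 \<and> (G \<omega> \<and> Z \<omega> = n)} =
        P.prob {\<omega> \<in> space \<Omega>. N \<omega> = 0} * P.prob {\<omega> \<in> space \<Omega>. G \<omega> \<and> Z \<omega> = n}"
    proof (rule prob_conj_depends_on[of JN "JG \<union> JZ"])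
      show "depends_on (JG \<union> JZ) (\<lambda>\<omega>. G \<omega> \<and> Z \<omega> = n)"
        using depG depends_on_eq[OF depZ, of n] unfolding depends_on_def by blast
    qed (use disj in \<open>auto intro: depends_on_eq depN\<close>)
    also have "P.prob {\<omega> \<in> space \<Omega>. G \<omega> \<and> Z \<omega> = n} = P.prob {\<omega> \<in> space \<Omega>. G \<omega>} *
        P.prob {\<omega> \<in> space \<Omega>. Z \<omega> = n}"
      by (rule prob_conj_depends_on[OF disj(3)]) (auto intro: depends_on_eq depZ depG)
    finally show ?thesis using a by (simp add: prob_law[OF N lawN] prob_law[OF Z lawZ] probG)
  qed
  show "P.prob {\<omega> \<in> space \<Omega>. coupled_count K (N \<omega>) (G \<omega>) (Z \<omega>) = n} = pmf (poisson_pmf a) n"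
  proof (cases "n \<le> K")
    case True
    have Z0: "P.prob {\<omega> \<in> space \<Omega>. N \<omega> = 0 \<and> (G \<omega> \<and> Z \<omega> = n)} = 0"
      using True pmf_dense_pmf[OF a g n] by (simp add: Z)
    have "{\<omega> \<in> space \<Omega>. coupled_count K (N \<omega>) (G \<omega>) (Z \<omega>) = n} =
        {\<omega> \<in> space \<Omega>. N \<omega> = n} \<union> {\<omega> \<in> space \<Omega>. N \<omega> = 0 \<and> (G \<omega> \<and> Z \<omega> = n)}"
      using True n by (auto simp: coupled_count_def)
    also have "P.prob \<dots> = P.prob {\<omega> \<in> space \<Omega>. N \<omega> = n} + P.prob {\<omega> \<in> space \<Omega>. N \<omega> = 0 \<and> (G \<omega> \<and> Z \<omega> = n)}"
      using n by (intro P.finite_measure_Union) auto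
    finally show ?thesis unfolding Z0 prob_law[OF N lawN] by simp
  next
    case False
    have "{\<omega> \<in> space \<Omega>. coupled_count K (N \<omega>) (G \<omega>) (Z \<omega>) = n} = {\<omega> \<in> space \<Omega>. N \<omega> = 0 \<and> (G \<omega> \<and> Z \<omega> = n)}"
      using False n by (auto simp: coupled_count_def)
    then show ?thesis using False g pmf_dense_pmf[OF a g n] by (simp add: Z)
  qed
qed

end

lemma measure_unif01_atMost: "measure unif01 {..t} = max 0 (min 1 t)"
proof -
  have "{0..1} \<inter> {..t} = {0..min 1 t}" by auto
  then show ?thesis by (simp add: measure_uniform_measure max_def min_def)
qed

context univ_product
begin

text \<open>The unit interval is cut at q: with probability q the point falls uniformly into the
  left part and otherwise uniformly into the right part.\<close>

lemma distr_uniform_mixture: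
  assumes q: "0 < q" "q < 1" and disj: "J \<inter> J' = {}"
    and U [measurable]: "U \<in> borel_measurable \<Omega>" and depU: "depends_on J U" and lawU:
        "distr \<Omega> borel U = unif01"
    and B [measurable]: "Measurable.pred \<Omega> B" and depB: "depends_on J' B" and probB:
        "P.prob {\<omega> \<in> space \<Omega>. B \<omega>} = q"
  shows "distr \<Omega> borel (\<lambda>\<omega>. if B \<omega> then q * U \<omega> else q + (1 - q) * U \<omega>) = unif01"
proof (rule cdf_unique)
  let ?F = "\<lambda>\<omega>. if B \<omega> then q * U \<omega> else q + (1 - q) * U \<omega>"
  have F [measurable]: "?F \<in> borel_measurable \<Omega>" by measurable
  show "real_distribution (distr \<Omega> borel ?F)"
    using P.prob_space_distr[OF F] by (auto simp: real_distribution_def real_distribution_axioms_def)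
  show "real_distribution unif01"
    using prob_unif01 by (auto simp: real_distribution_def real_distribution_axioms_def)
  have PU: "P.prob {\<omega> \<in> space \<Omega>. U \<omega> \<le> t} = max 0 (min 1 t)" for t
  proof -
    have "measure (distr \<Omega> borel U) {..t} = P.prob (U -` {..t} \<inter> space \<Omega>)" by (rule measure_distr) auto
    moreover have "U -` {..t} \<inter> space \<Omega> = {\<omega> \<in> space \<Omega>. U \<omega> \<le> t}" by auto
    ultimately show ?thesis by (simp add: lawU measure_unif01_atMost)
  qed
  have notB: "P.prob {\<omega> \<in> space \<Omega>. \<not> B \<omega>} = 1 - q"
    using prob_not[OF B] probB by simp
  have "cdf (distr \<Omega> borel ?F) t = cdf unif01 t" for t
  proof -
    have "cdf (distr \<Omega> borel ?F) t = P.prob (?F -` {..t} \<inter> space \<Omega>)"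
      unfolding cdf_def by (rule measure_distr) auto
    also have "?F -` {..t} \<inter> space \<Omega> =
        {\<omega> \<in> space \<Omega>. U \<omega> \<le> t / q \<and> B \<omega>} \<union> {\<omega> \<in> space \<Omega>. U \<omega> \<le> (t - q) / (1 - q) \<and> \<not> B \<omega>}"
      using q by (auto simp: field_simps split: if_splits)
    also have "P.prob \<dots> = P.prob {\<omega> \<in> space \<Omega>. U \<omega> \<le> t / q \<and> B \<omega>} + P.prob {\<omega> \<in> space \<Omega>. U \<omega> \<le>
        (t - q) / (1 - q) \<and> \<not> B \<omega>}"
      by (rule P.finite_measure_Union) auto
    also have "P.prob {\<omega> \<in> space \<Omega>. U \<omega> \<le> t / q \<and> B \<omega>} = P.prob {\<omega> \<in> space \<Omega>. U \<omega> \<le> t / q} *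
        P.prob {\<omega> \<in> space \<Omega>. B \<omega>}"
      by (rule prob_conj_depends_on[OF disj])
        (auto intro: depends_on_compose[OF depU, of "\<lambda>u. u \<le> t / q"] depB)
    also have "P.prob {\<omega> \<in> space \<Omega>. U \<omega> \<le> (t - q) / (1 - q) \<and> \<not> B \<omega>} =
        P.prob {\<omega> \<in> space \<Omega>. U \<omega> \<le> (t - q) / (1 - q)} * P.prob {\<omega> \<in> space \<Omega>. \<not> B \<omega>}"
      by (rule prob_conj_depends_on[OF disj])
        (auto intro: depends_on_compose[OF depU, of
            "\<lambda>u. u \<le> (t - q) / (1 - q)"] depends_on_compose[OF depB, of Not])
    also have "P.prob {\<omega> \<in> space \<Omega>. U \<omega> \<le> t / q} * P.prob {\<omega> \<in> space \<Omega>. B \<omega>} +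
        P.prob {\<omega> \<in> space \<Omega>. U \<omega> \<le> (t - q) / (1 - q)} * P.prob {\<omega> \<in> space \<Omega>. \<not> B \<omega>} =
        max 0 (min 1 (t / q)) * q + max 0 (min 1 ((t - q) / (1 - q))) * (1 - q)"
      by (simp only: PU probB notB)
    also have "\<dots> = max 0 (min 1 t)"
    proof -
      \<comment> \<open>The distribution function is piecewise linear with breaks at 0, q and
        1.\<close>
      consider "t \<le> 0" | "0 < t" "t \<le> q" | "q < t" "t \<le> 1" | "1 < t" by linarith
      then show ?thesis using q by cases (auto simp: max_def min_def field_simps)
    qed
    finally show ?thesis by (simp add: cdf_def measure_unif01_atMost)
  qed
  then show "cdf (distr \<Omega> borel ?F) = cdf unif01" by auto
qed

end

section \<open>Emulating dense squares\<close>

definition em_cells :: "int \<Rightarrow> int \<Rightarrow> int \<times> int \<Rightarrow> (int \<times> int) set" where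
  "em_cells m R s = {z. near R s (cell_square m z)}"

text \<open>Everything to which an emulator of s may have to be attached. The radius
  \<open>2 * R\<close> is needed since one killed vertex can have neighbours in two dense squares
  that far apart; for t = s it also provides the marks inside the emulator.\<close>

definition rel_labs :: "int \<Rightarrow> int \<Rightarrow> nat \<Rightarrow> int \<times> int \<Rightarrow> lab set" where
  "rel_labs m R K s = (\<lambda>(t, k). Base t k) ` ({t. near R s t} \<times> {..<K}) \<union>
    (\<Union>t\<in>{t. near (2 * R) s t}. (\<lambda>z. Em t z 0) ` em_cells m R t)"

text \<open>A mark between two emulators is charged to only one of them, which keeps the emulator events
  of different squares independent.\<close>

fun owner :: "lab \<times> lab \<Rightarrow> (int \<times> int) option" where
  "owner (Em s z i, l) = Some s"
| "owner (Base t k, Em s z i) = Some s"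
| "owner (Base t k, Base t' k') = None"

definition em_marks :: "int \<Rightarrow> int \<Rightarrow> nat \<Rightarrow> int \<times> int \<Rightarrow> (lab \<times> lab) set" where
  "em_marks m R K s = {e \<in> (\<lambda>(z, l). gkey (Em s z 0) l) ` (em_cells m R s \<times> rel_labs m R K s). owner e =
      Some s}"

text \<open>The factors stand for occupied slots, for first points that fall into the prescribed
  cells, and for low marks among the owned ones; \<open>prob_emu\<close> confirms the
  product.\<close>

definition em_prob :: "int \<Rightarrow> int \<Rightarrow> nat \<Rightarrow> real \<Rightarrow> real \<Rightarrow> int \<times> int \<Rightarrow> real" where
  "em_prob m R K c del s = (1 - exp (- del)) ^ card (em_cells m R s) *
    ((1 / (real_of_int m)\<^sup>2) ^ card (em_cells m R s) * c ^ card (em_marks m R K s))"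

lemma em_cells_rectangle:
  assumes m: "0 < m"
  shows "em_cells m R s = {m * (fst s - R)..m * (fst s + R) + m - 1} \<times> {m * (snd s - R)..m * (snd s + R) +
      m - 1}"
proof -
  have "\<bar>a - i div m\<bar> \<le> R \<longleftrightarrow> m * (a - R) \<le> i \<and> i \<le> m * (a + R) + m - 1" for a i
  proof -
    have i: "m * (i div m) \<le> i" "i < m * (i div m + 1)"
      using m by (auto simp: algebra_simps minus_mod_eq_mult_div[symmetric])
    have "a - R \<le> i div m \<longleftrightarrow> m * (a - R) \<le> i"
    proof
      assume "a - R \<le> i div m"
      then have "m * (a - R) \<le> m * (i div m)" using m by simp
      then show "m * (a - R) \<le> i" using i by linarith
    next
      assume "m * (a - R) \<le> i"
      then have "m * (a - R) < m * (i div m + 1)" using i by linarith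
      then show "a - R \<le> i div m" using m by simp
    qed
    moreover have "i div m \<le> a + R \<longleftrightarrow> i < m * (a + R + 1)"
    proof
      assume "i div m \<le> a + R"
      then have "m * (i div m + 1) \<le> m * (a + R + 1)" using m by simp
      then show "i < m * (a + R + 1)" using i by linarith
    next
      assume "i < m * (a + R + 1)"
      then have "m * (i div m) < m * (a + R + 1)" using i by linarith
      then show "i div m \<le> a + R" using m by simp
    qed
    moreover have "m * (a + R + 1) = m * (a + R) + m" by (simp add: algebra_simps)
    ultimately show ?thesis by linarith
  qed
  then show ?thesis by (auto simp: em_cells_def near_def cell_square_def)
qed

lemma em_cells_UN: "em_cells m R s = (\<Union>t\<in>{t. near R s t}. {z. cell_square m z = t})"
  by (auto simp: em_cells_def)

lemma finite_em_cells [simp]: "0 < m \<Longrightarrow> finite (em_cells m R s)"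
  unfolding em_cells_UN by (auto simp: cell_square_vimage)

lemma card_em_cells:
  assumes "0 < m" "0 \<le> R"
  shows "card (em_cells m R s) = nat (2 * R + 1) ^ 2 * nat m ^ 2"
proof -
  have "card (em_cells m R s) = (\<Sum>t\<in>{t. near R s t}. card {z. cell_square m z = t})"
    unfolding em_cells_UN
  proof (rule card_UN_disjoint)
    show "\<forall>t\<in>{t. near R s t}. finite {z. cell_square m z = t}"
      using assms(1) by (simp add: cell_square_vimage)
  qed auto
  also have "\<dots> = (\<Sum>t\<in>{t. near R s t}. nat m ^ 2)"
    using assms(1) by (simp add: cell_square_vimage card_cartesian_product power2_eq_square)
  finally show ?thesis using card_near[OF assms(2)] by simp
qed

lemma finite_rel_labs: "0 < m \<Longrightarrow> finite (rel_labs m R K s)"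
  unfolding rel_labs_def by auto

lemma card_rel_labs:
  assumes "0 < m" "0 \<le> R"
  shows "card (rel_labs m R K s) \<le> nat (2 * R + 1) ^ 2 * K + nat (4 * R + 1) ^ 2 * (nat (2 * R + 1) ^ 2 *
      nat m ^ 2)"
proof -
  have "card (rel_labs m R K s) \<le> card ((\<lambda>(t, k). Base t k) ` ({t. near R s t} \<times> {..<K})) +
      card (\<Union>t\<in>{t. near (2 * R) s t}. (\<lambda>z. Em t z 0) ` em_cells m R t)"
    unfolding rel_labs_def by (rule card_Un_le)
  also have "card ((\<lambda>(t, k). Base t k) ` ({t. near R s t} \<times> {..<K})) \<le> card ({t. near R s t} \<times> {..<K})"
    by (rule card_image_le) simp
  also have "\<dots> = nat (2 * R + 1) ^ 2 * K" using card_near[OF assms(2)]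
      by (simp add: card_cartesian_product)
  also have "card (\<Union>t\<in>{t. near (2 * R) s t}. (\<lambda>z. Em t z 0) ` em_cells m R t) \<le>
      (\<Sum>t\<in>{t. near (2 * R) s t}. card ((\<lambda>z. Em t z 0) ` em_cells m R t))"
    by (rule card_UN_le) simp
  also have "\<dots> \<le> (\<Sum>t\<in>{t. near (2 * R) s t}. nat (2 * R + 1) ^ 2 * nat m ^ 2)"
    by (intro sum_mono) (metis card_em_cells[OF assms] card_image_le finite_em_cells[OF assms(1)])
  also have "\<dots> = nat (4 * R + 1) ^ 2 * (nat (2 * R + 1) ^ 2 * nat m ^ 2)"
    using card_near[of "2 * R" s] assms(2) by simp
  finally show ?thesis by simp
qed

lemma finite_em_marks: "0 < m \<Longrightarrow> finite (em_marks m R K s)"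
  unfolding em_marks_def using finite_rel_labs by auto

text \<open>The bound is linear in K, which makes the emulator probability no worse than
  exponentially small in K.\<close>

lemma card_em_marks:
  assumes "0 < m" "0 \<le> R"
  shows "card (em_marks m R K s) \<le> nat (2 * R + 1) ^ 2 * nat m ^ 2 *
    (nat (2 * R + 1) ^ 2 * K + nat (4 * R + 1) ^ 2 * (nat (2 * R + 1) ^ 2 * nat m ^ 2))"
proof -
  let ?h = "\<lambda>(z, l). gkey (Em s z 0) l" and ?D = "em_cells m R s \<times> rel_labs m R K s"
  have f: "finite ?D" using assms finite_rel_labs by auto
  have "card (em_marks m R K s) \<le> card (?h ` ?D)"
    unfolding em_marks_def by (rule card_mono) (use f in auto)
  also have "\<dots> \<le> card ?D" by (rule card_image_le[OF f])
  also have "\<dots> \<le> nat (2 * R + 1) ^ 2 * nat m ^ 2 *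
    (nat (2 * R + 1) ^ 2 * K + nat (4 * R + 1) ^ 2 * (nat (2 * R + 1) ^ 2 * nat m ^ 2))"
    using card_rel_labs[OF assms] card_em_cells[OF assms] by (simp add: card_cartesian_product)
  finally show ?thesis .
qed

section \<open>The coupled graphs and their deterministic comparison\<close>

locale coupling =
  fixes f :: "real \<Rightarrow> real" and q r0 A lam del :: real and m R :: int and K :: nat
  assumes q: "0 < q" "q < 1"
    and f_bounds: "\<And>r. 0 \<le> r \<Longrightarrow> 0 \<le> f r \<and> f r \<le> 1"
    and f_antitone: "antitone_nonneg f"
    and r0: "0 < r0" "0 < f r0"
    and f_support: "\<And>r. 0 \<le> r \<Longrightarrow> 0 < f r \<Longrightarrow> r \<le> A"
    and R: "A + 1 \<le> real_of_int R" "0 \<le> R"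
    and m: "0 < m" "4 / real_of_int m \<le> r0"
    and lam: "0 < lam" and del: "0 < del" and K: "0 < K"
    and tail: "\<And>s. measure_pmf.prob (poisson_pmf lam) {K<..} \<le> exp (- lam) * em_prob m R K (f r0) del s"
begin

sublocale master lam "sqrt q" del "\<lambda>s. dense_pmf lam K (em_prob m R K (f r0) del s)" m .

abbreviation bs :: "label \<Rightarrow> lab" where "bs v \<equiv> Base (fst v) (snd v)"

text \<open>Only the first point of each slot, the one with index 0, takes part; further points of a
  slot merely enlarge the comparison graph.\<close>

definition emu :: "int \<times> int \<Rightarrow> (idx \<Rightarrow> real \<times> real) \<Rightarrow> bool" where
  "emu s \<omega> \<longleftrightarrow> (\<forall>z\<in>em_cells m R s. 1 \<le> dec (\<omega> (Slot s z))) \<and>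
    ((\<forall>z\<in>em_cells m R s. \<omega> (Pos (Em s z 0)) \<in> cell m z) \<and>
     (\<forall>e\<in>em_marks m R K s. fst (\<omega> (Mark e)) < f r0))"

text \<open>The half-edges to all labels with index below K count, active or not, so that killing is
  independent of counts and positions.\<close>

definition kill :: "label \<Rightarrow> (idx \<Rightarrow> real \<times> real) \<Rightarrow> bool" where
  "kill v \<omega> \<longleftrightarrow> (\<forall>w\<in>{t. near R (fst v) t} \<times> {..<K}. dec (\<omega> (Half v w)) = 0)"

definition NA :: "int \<times> int \<Rightarrow> (idx \<Rightarrow> real \<times> real) \<Rightarrow> nat" where
  "NA s \<omega> = coupled_count K (dec (\<omega> (Cnt s))) (emu s \<omega>) (dec (\<omega> (Zet s)))"

text \<open>The rescaling makes \<open>UA e\<close> uniform again, and \<open>UA e < q * f d\<close> holds iff both half-edges are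
  open and the underlying mark is below \<open>f d\<close>.\<close>

definition UA :: "label \<times> label \<Rightarrow> (idx \<Rightarrow> real \<times> real) \<Rightarrow> real" where
  "UA e \<omega> = (if to_nat (fst e) < to_nat (snd e)
    then if 1 \<le> dec (\<omega> (Half (fst e) (snd e))) \<and> 1 \<le> dec (\<omega> (Half (snd e) (fst e)))
      then q * fst (\<omega> (Mark (gkey (bs (fst e)) (bs (snd e)))))
      else q + (1 - q) * fst (\<omega> (Mark (gkey (bs (fst e)) (bs (snd e)))))
    else fst (\<omega> (Junk e)))"

text \<open>The counts are the raw \<open>Cnt\<close>, not \<open>NA\<close>, so that the surviving
  base points form an independent thinning. In a square with \<open>Cnt\<close> above K they remain
  although \<open>NA\<close> is 0 there, and slot points remain even where no emulator forms;
  additional vertices can only help percolation.\<close>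

definition VB :: "(idx \<Rightarrow> real \<times> real) \<Rightarrow> lab set" where
  "VB \<omega> = {Base s k |s k. k < dec (\<omega> (Cnt s)) \<and> \<not> kill (s, k) \<omega>} \<union>
    {Em s z i |s z i. z \<in> em_cells m R s \<and> i < dec (\<omega> (Slot s z))}"

definition EA :: "(idx \<Rightarrow> real \<times> real) \<Rightarrow> label \<Rightarrow> label \<Rightarrow> bool" where
  "EA \<omega> = gedge (\<lambda>r. q * f r) {v. snd v < NA (fst v) \<omega>} (plain_X \<omega>) (\<lambda>e. UA e \<omega>)"

definition EB :: "(idx \<Rightarrow> real \<times> real) \<Rightarrow> lab \<Rightarrow> lab \<Rightarrow> bool" where
  "EB \<omega> = gedge f (VB \<omega>) (\<lambda>l. \<omega> (Pos l)) (\<lambda>e. fst (\<omega> (Mark e)))"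

lemma EA_cases:
  assumes pos: "\<And>l. \<omega> (Pos l) \<in> unit_square (lab_square m l)" and mark: "\<And>e. 0 \<le> fst (\<omega> (Mark e))"
    and e: "EA \<omega> v w"
  shows "near R (fst v) (fst w)" "1 \<le> dec (\<omega> (Half v w))" "1 \<le> dec (\<omega> (Half w v))"
    "fst (\<omega> (Mark (gkey (bs v) (bs w)))) < f (dist (\<omega> (Pos (bs v))) (\<omega> (Pos (bs w))))"
proof -
  let ?d = "dist (\<omega> (Pos (bs v))) (\<omega> (Pos (bs w)))" and ?u = "fst (\<omega> (Mark (gkey (bs v) (bs w))))"
  have ne: "v \<noteq> w" and lt: "UA (gkey v w) \<omega> < q * f ?d"
    using e by (auto simp: EA_def gedge_def plain_X_def)
  have "to_nat v \<noteq> to_nat w" using ne by simp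
  then have UA: "UA (gkey v w) \<omega> = (if 1 \<le> dec (\<omega> (Half v w)) \<and> 1 \<le> dec (\<omega> (Half w v)) then q *
      ?u else q + (1 - q) * ?u)"
    unfolding UA_def gkey_def[of v w] using gkey_commute[of "bs v" "bs w"] by auto
  have f1: "f ?d \<le> 1" using f_bounds[of ?d] by simp
  \<comment> \<open>With a closed half-edge the mark is at least q, and \<open>q * f d\<close> never
    exceeds q.\<close>
  have half: "1 \<le> dec (\<omega> (Half v w)) \<and> 1 \<le> dec (\<omega> (Half w v))"
  proof (rule ccontr)
    assume nh: "\<not> ?thesis"
    have "q + (1 - q) * ?u < q * f ?d" using lt unfolding UA if_not_P[OF nh] .
    moreover have "q * f ?d \<le> q" using q f1 by simp
    moreover have "0 \<le> (1 - q) * ?u" using q mark by simp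
    ultimately show False by linarith
  qed
  then show "1 \<le> dec (\<omega> (Half v w))" "1 \<le> dec (\<omega> (Half w v))" by auto
  have "q * ?u < q * f ?d" using lt unfolding UA if_P[OF half] .
  then show u: "?u < f ?d" using q by simp
  then have "0 < f ?d" using mark[of "gkey (bs v) (bs w)"] by linarith
  then have "?d \<le> A" by (intro f_support) auto
  then show "near R (fst v) (fst w)"
    using dist_square_near[OF pos[of "bs v"] pos[of "bs w"] _ R(1)] by simp
qed

lemma near_2R: "near R s t \<Longrightarrow> near R t u \<Longrightarrow> near (2 * R) s u"
  unfolding near_def by linarith

text \<open>The blocks of radius R around two squares at distance at most \<open>2 * R\<close> share
  a square, so both emulators have a point in one common cell.\<close>

lemma near_mid: "near (2 * R) s t \<Longrightarrow> \<exists>u. near R s u \<and> near R t u"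
proof -
  assume n: "near (2 * R) s t"
  have "\<exists>c. \<bar>a - c\<bar> \<le> R \<and> \<bar>b - c\<bar> \<le> R" if "\<bar>a - b\<bar> \<le> 2 * R" for a b :: int
    using that R(2) by (intro exI[of _ "if \<bar>a - b\<bar> \<le> R then a else if a \<le> b then a + R else a - R"]) auto
  then obtain c d where "\<bar>fst s - c\<bar> \<le> R \<and> \<bar>fst t - c\<bar> \<le> R" "\<bar>snd s - d\<bar> \<le> R \<and> \<bar>snd t - d\<bar> \<le> R"
    using n unfolding near_def by metis
  then show ?thesis by (intro exI[of _ "(c, d)"]) (auto simp: near_def)
qed

text \<open>The lower left cell of s, used as a canonical cell inside the square.\<close>

definition ctr :: "int \<times> int \<Rightarrow> int \<times> int" where
  "ctr s = (m * fst s, m * snd s)"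

lemma cell_square_ctr [simp]: "cell_square m (ctr s) = s"
  using m(1) by (simp add: ctr_def cell_square_def)

lemma Em_in_VB:
  assumes "emu s \<omega>" "z \<in> em_cells m R s"
  shows "Em s z 0 \<in> VB \<omega>"
proof -
  have "0 < dec (\<omega> (Slot s z))" using assms by (fastforce simp: emu_def)
  then show ?thesis using assms(2) unfolding VB_def by blast
qed

text \<open>Points in neighbouring cells are at distance at most r0, so by monotonicity a mark below
  \<open>f r0\<close> creates the edge whatever the exact positions are.\<close>

lemma EB_em:
  assumes g: "emu s \<omega>" and z: "z \<in> em_cells m R s" and l: "l \<in> rel_labs m R K s" "l \<in> VB \<omega>" "l \<noteq> Em s z 0"
    and own: "owner (gkey (Em s z 0) l) = Some s"
    and y: "\<omega> (Pos l) \<in> cell m y" "near 1 z y"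
  shows "EB \<omega> (Em s z 0) l"
proof -
  have "gkey (Em s z 0) l \<in> em_marks m R K s" unfolding em_marks_def using z l own by auto
  then have mk: "fst (\<omega> (Mark (gkey (Em s z 0) l))) < f r0" using g by (simp add: emu_def)
  have "\<omega> (Pos (Em s z 0)) \<in> cell m z" using g z by (simp add: emu_def)
  then have "dist (\<omega> (Pos (Em s z 0))) (\<omega> (Pos l)) \<le> r0"
    using dist_adjacent_cells[OF m(1) _ y] m(2) by fastforce
  then have "f r0 \<le> f (dist (\<omega> (Pos (Em s z 0))) (\<omega> (Pos l)))"
    using f_antitone by (simp add: antitone_nonneg_def)
  moreover have "Em s z 0 \<in> VB \<omega>" by (rule Em_in_VB[OF g z])
  ultimately show ?thesis unfolding EB_def gedge_def using mk l by auto
qed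

text \<open>Each vertex of the thinned graph is sent to a component of the comparison graph: its
  own, or that of the emulator if its square is dense. Along an edge between unkilled vertices this
  component does not change. A killed vertex outside the dense squares has all its neighbours in
  dense squares, mutually within \<open>2 * R\<close>, whose emulators are joined directly; so it
  can be bypassed.\<close>

lemma percolation_transfer:
  assumes pos: "\<And>l. \<omega> (Pos l) \<in> unit_square (lab_square m l)" and mark: "\<And>e. 0 \<le> fst (\<omega> (Mark e))"
    and zet: "\<And>s. dec (\<omega> (Zet s)) = 0 \<or> K < dec (\<omega> (Zet s))"
    and perc: "gperc (\<lambda>r. q * f r) {v. snd v < NA (fst v) \<omega>} (plain_X \<omega>) (\<lambda>e. UA e \<omega>)"
  shows "gperc f (VB \<omega>) (\<lambda>l. \<omega> (Pos l)) (\<lambda>e. fst (\<omega> (Mark e)))"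
proof -
  let ?VA = "{v. snd v < NA (fst v) \<omega>}"
  define C where "C l = {l'. (EB \<omega>)\<^sup>*\<^sup>* l l'}" for l
  have C_edge: "C l = C l'" if "EB \<omega> l l'" for l l'
  proof -
    have "EB \<omega> l' l" using that gedge_sym unfolding EB_def by blast
    then show ?thesis unfolding C_def using that by (auto intro: converse_rtranclp_into_rtranclp)
  qed
  define dns where "dns s \<longleftrightarrow> K < NA s \<omega>" for s
  have dns_emu: "emu s \<omega>" if "dns s" for s
    using that by (auto simp: dns_def NA_def coupled_count_def split: if_splits)
  \<comment> \<open>A nonzero \<open>Zet\<close> exceeds K, so in a square that is not dense all
    points come from \<open>Cnt\<close>, and there are at most K of them.\<close>
  have base: "snd v < dec (\<omega> (Cnt (fst v)))" "snd v < K" if "v \<in> ?VA" "\<not> dns (fst v)" for v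
    using that zet[of "fst v"] by (auto simp: dns_def NA_def coupled_count_def split: if_splits)
  note em_VB = Em_in_VB[of _ \<omega>]
  have rect: "C (Em s z 0) = C (Em s z' 0)" if s: "emu s \<omega>" and z:
      "z \<in> em_cells m R s" "z' \<in> em_cells m R s" for s z z'
  proof (rule rectangle_constant[where r = "\<lambda>z. C (Em s z 0)"])
    show "z \<in> {m * (fst s - R)..m * (fst s + R) + m - 1} \<times> {m * (snd s - R)..m * (snd s + R) + m - 1}"
      "z' \<in> {m * (fst s - R)..m * (fst s + R) + m - 1} \<times> {m * (snd s - R)..m * (snd s + R) + m - 1}"
      using z unfolding em_cells_rectangle[OF m(1)] by blast+
    fix y y' assume "y \<in> {m * (fst s - R)..m * (fst s + R) + m - 1} \<times> {m * (snd s - R)..m * (snd s + R) +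
        m - 1}"
      "y' \<in> {m * (fst s - R)..m * (fst s + R) + m - 1} \<times> {m * (snd s - R)..m * (snd s + R) + m - 1}"
      and adj: "lattice_adj y y'"
    then have y: "y \<in> em_cells m R s" "y' \<in> em_cells m R s" unfolding em_cells_rectangle[OF m(1)]
        by blast+
    have "EB \<omega> (Em s y 0) (Em s y' 0)"
    proof (rule EB_em[OF s y(1)])
      have "near (2 * R) s s" using R(2) by (simp add: near_def)
      then show "Em s y' 0 \<in> rel_labs m R K s" unfolding rel_labs_def using y(2) by blast
      show "owner (gkey (Em s y 0) (Em s y' 0)) = Some s" by (simp add: gkey_def)
      show "\<omega> (Pos (Em s y' 0)) \<in> cell m y'" using s y(2) by (simp add: emu_def)
      show "near 1 y y'" using adj by (auto simp: near_def lattice_adj_def)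
      show "Em s y' 0 \<noteq> Em s y 0" using adj by (auto simp: lattice_adj_def prod_eq_iff)
    qed (use em_VB[OF s y(2)] in auto)
    then show "C (Em s y 0) = C (Em s y' 0)" by (rule C_edge)
  qed
  define H where "H s = C (Em s (ctr s) 0)" for s
  have ctr_in: "ctr s \<in> em_cells m R t" if "near R t s" for s t using that by (simp add: em_cells_def)
  have near_refl: "near R s s" for s using R(2) by (simp add: near_def)
  have H: "C (Em s z 0) = H s" if "emu s \<omega>" "z \<in> em_cells m R s" for s z
    unfolding H_def by (rule rect[OF that ctr_in[OF near_refl]])
  have HH: "H s = H t" if st: "emu s \<omega>" "emu t \<omega>" "near (2 * R) s t" for s t
  proof (cases "s = t")
    case False
    obtain u where u: "near R s u" "near R t u" using near_mid[OF st(3)] by blast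
    have z: "ctr u \<in> em_cells m R s" "ctr u \<in> em_cells m R t" using ctr_in u by auto
    \<comment> \<open>Only the owner of the mark between the two points guarantees that it is low,
      so the edge is produced from the side of the owner.\<close>
    have "EB \<omega> (Em s (ctr u) 0) (Em t (ctr u) 0)"
    proof (cases "owner (gkey (Em s (ctr u) 0) (Em t (ctr u) 0)) = Some s")
      case True
      show ?thesis
      proof (rule EB_em[OF st(1) z(1) _ _ _ True])
        show "Em t (ctr u) 0 \<in> rel_labs m R K s" unfolding rel_labs_def using z(2) st(3) by blast
        show "\<omega> (Pos (Em t (ctr u) 0)) \<in> cell m (ctr u)" using st(2) z(2) by (simp add: emu_def)
      qed (use em_VB[OF st(2) z(2)] False in \<open>auto simp: near_def\<close>)
    next
      case own: False
      then have own: "owner (gkey (Em t (ctr u) 0) (Em s (ctr u) 0)) = Some t"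
        using gkey_cases[of "Em t (ctr u) 0" "Em s (ctr u) 0"] gkey_commute[of
            "Em t (ctr u) 0" "Em s (ctr u) 0"] by auto
      have "EB \<omega> (Em t (ctr u) 0) (Em s (ctr u) 0)"
      proof (rule EB_em[OF st(2) z(2) _ _ _ own])
        show "Em s (ctr u) 0 \<in> rel_labs m R K t" unfolding rel_labs_def using z(1) st(3) near_sym by blast
        show "\<omega> (Pos (Em s (ctr u) 0)) \<in> cell m (ctr u)" using st(1) z(1) by (simp add: emu_def)
      qed (use em_VB[OF st(1) z(1)] False in \<open>auto simp: near_def\<close>)
      then show ?thesis unfolding EB_def by (rule gedge_sym)
    qed
    then have "C (Em s (ctr u) 0) = C (Em t (ctr u) 0)" by (rule C_edge)
    then show ?thesis using H[OF st(1) z(1)] H[OF st(2) z(2)] by simp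
  qed simp
  have base_VB: "bs v \<in> VB \<omega>" if "v \<in> ?VA" "\<not> dns (fst v)" "\<not> kill v \<omega>" for v
    using that base[OF that(1,2)] by (cases v) (auto simp: VB_def)
  have HB: "C (bs v) = H s" if v: "v \<in> ?VA" "\<not> dns (fst v)" "\<not> kill v \<omega>" and s:
      "emu s \<omega>" "near R s (fst v)" for v s
  proof -
    obtain z where z: "cell_square m z = fst v" "\<omega> (Pos (bs v)) \<in> cell m z"
      using unit_square_cell[OF m(1) pos[of "bs v"]] by auto
    have zs: "z \<in> em_cells m R s" using z(1) s(2) by (simp add: em_cells_def)
    have "EB \<omega> (Em s z 0) (bs v)"
    proof (rule EB_em[OF s(1) zs])
      have "(fst v, snd v) \<in> {t. near R s t} \<times> {..<K}"
        using s(2) base(2)[OF v(1,2)] by (simp add: mem_Times_iff)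
      then show "bs v \<in> rel_labs m R K s" unfolding rel_labs_def by force
      show "owner (gkey (Em s z 0) (bs v)) = Some s" by (simp add: gkey_def)
    qed (use z base_VB[OF v] in \<open>auto simp: near_def\<close>)
    then have "C (Em s z 0) = C (bs v)" by (rule C_edge)
    then show ?thesis using H[OF s(1) zs] by simp
  qed
  \<comment> \<open>A dense square is represented by its emulator, whatever its own points do; this
    also covers killed vertices inside it, which are therefore not \<open>bad\<close>.\<close>
  define D where "D v = (if dns (fst v) then H (fst v) else C (bs v))" for v
  define bad where "bad v \<longleftrightarrow> \<not> dns (fst v) \<and> kill v \<omega>" for v
  have VA: "v \<in> ?VA" "w \<in> ?VA" "v \<noteq> w" if "EA \<omega> v w" for v w using that by (auto simp: EA_def gedge_def)
  have EA_sym: "EA \<omega> w v" if "EA \<omega> v w" for v w using that unfolding EA_def by (rule gedge_sym)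
  note EA' = EA_cases[OF pos mark]
  have D_edge: "D v = D w" if e: "EA \<omega> v w" and nb: "\<not> bad v" "\<not> bad w" for v w
  proof -
    have n: "near R (fst v) (fst w)" "near R (fst w) (fst v)" using EA'(1)[OF e] near_sym by auto
    consider "dns (fst v)" "dns (fst w)" | "dns (fst v)" "\<not> dns (fst w)" | "\<not> dns (fst v)" "dns (fst w)" |
        "\<not> dns (fst v)" "\<not> dns (fst w)"
      by blast
    then show ?thesis
    proof cases
      case 1
      then show ?thesis using HH[of "fst v" "fst w"] dns_emu near_2R[OF n(1) near_refl]
          by (simp add: D_def)
    next
      case 2
      then show ?thesis
        using HB[OF VA(2)[OF e] _ _ dns_emu[of "fst v"] n(1)] nb by (simp add: D_def bad_def)
    next
      case 3
      then show ?thesis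
        using HB[OF VA(1)[OF e] _ _ dns_emu[of "fst w"] n(2)] nb by (simp add: D_def bad_def)
    next
      case 4
      have "EB \<omega> (bs v) (bs w)"
        unfolding EB_def gedge_def
        using base_VB[OF VA(1)[OF e]] base_VB[OF VA(2)[OF e]] nb 4 EA'(4)[OF e] VA(3)[OF e]
        by (auto simp: bad_def prod_eq_iff)
      then show ?thesis using C_edge 4 by (simp add: D_def)
    qed
  qed
  have bad_edge: "dns (fst w)" if e: "EA \<omega> v w" and b: "bad v" for v w
  proof (rule ccontr)
    assume nd: "\<not> dns (fst w)"
    \<comment> \<open>A neighbour outside the dense squares would have an index below K, and towards
      such a label the killed v has no open half-edge.\<close>
    have "w \<in> {t. near R (fst v) t} \<times> {..<K}"
      using EA'(1)[OF e] base(2)[OF VA(2)[OF e] nd] by (simp add: mem_Times_iff)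
    moreover have "kill v \<omega>" using b by (simp add: bad_def)
    ultimately have "dec (\<omega> (Half v w)) = 0" unfolding kill_def by (rule bspec[rotated])
    then show False using EA'(2)[OF e] by simp
  qed
  obtain v where v: "v \<in> ?VA" "infinite {w. (EA \<omega>)\<^sup>*\<^sup>* v w}" using perc by (auto simp: gperc_def EA_def)
  \<comment> \<open>A bad start has neighbours only in dense squares, and these are not bad, so the
    start can be moved along one edge.\<close>
  obtain v0 where v0: "v0 \<in> ?VA" "\<not> bad v0" "infinite {w. (EA \<omega>)\<^sup>*\<^sup>* v0 w}"
  proof (cases "bad v")
    case True
    have "\<exists>x. EA \<omega> v x"
    proof (rule ccontr)
      assume "\<nexists>x. EA \<omega> v x"
      then have "{w. (EA \<omega>)\<^sup>*\<^sup>* v w} \<subseteq> {v}" by (auto elim: converse_rtranclpE)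
      then show False using v(2) finite_subset by blast
    qed
    then obtain x where x: "EA \<omega> v x" by blast
    have "{w. (EA \<omega>)\<^sup>*\<^sup>* v w} \<subseteq> {w. (EA \<omega>)\<^sup>*\<^sup>* x w}"
      using EA_sym[OF x] by (auto intro: converse_rtranclp_into_rtranclp)
    then have "infinite {w. (EA \<omega>)\<^sup>*\<^sup>* x w}" using v(2) finite_subset by blast
    moreover have "\<not> bad x" using bad_edge[OF x True] by (simp add: bad_def)
    ultimately show ?thesis using that VA(2)[OF x] by blast
  qed (use v that in blast)
  let ?Cl = "{w. (EA \<omega>)\<^sup>*\<^sup>* v0 w}"
  \<comment> \<open>A bad vertex has no counterpart in \<open>VB\<close>. The induction remembers
    instead a dense square within range whose emulator carries the component.\<close>
  have reach: "w \<in> ?VA \<and> (\<not> bad w \<longrightarrow> D w = D v0) \<and> (bad w \<longrightarrow> (\<exists>s. dns s \<and> near R s (fst w) \<and> H s = D v0))"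
    if "(EA \<omega>)\<^sup>*\<^sup>* v0 w" for w
    using that
  proof induction
    case base
    then show ?case using v0 by simp
  next
    case (step w u)
    note e = step(2)
    have n: "near R (fst w) (fst u)" by (rule EA'(1)[OF e])
    consider "\<not> bad w" "\<not> bad u" | "\<not> bad w" "bad u" | "bad w" "\<not> bad u" | "bad w" "bad u" by blast
    then have "(\<not> bad u \<longrightarrow> D u = D v0) \<and> (bad u \<longrightarrow> (\<exists>s. dns s \<and> near R s (fst u) \<and> H s = D v0))"
    proof cases
      case 1
      then show ?thesis using D_edge[OF e] step(3) by simp
    next
      case 2
      have w: "dns (fst w)" by (rule bad_edge[OF EA_sym[OF e] 2(2)])
      then have "H (fst w) = D v0" using 2 step(3) by (simp add: D_def)
      then show ?thesis using w 2(2) n by blast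
    next
      case 3
      have u: "dns (fst u)" by (rule bad_edge[OF e 3(1)])
      obtain s where s: "dns s" "near R s (fst w)" "H s = D v0" using step(3) 3 by blast
      have "H s = H (fst u)" by (rule HH[OF dns_emu[OF s(1)] dns_emu[OF u] near_2R[OF s(2) n]])
      then show ?thesis using u s(3) 3(2) by (simp add: D_def)
    next
      case 4
      have "dns (fst u)" by (rule bad_edge[OF e 4(1)])
      then show ?thesis using 4(2) by (simp add: bad_def)
    qed
    then show ?case using VA(2)[OF e] by blast
  qed
  have D_ne: "\<exists>l\<in>VB \<omega>. D w = C l \<and> lab_square m l = fst w" if "w \<in> ?VA" "\<not> bad w" for w
  proof (cases "dns (fst w)")
    case True
    then show ?thesis
      using em_VB[OF dns_emu[OF True] ctr_in[OF near_refl]]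
      by (intro bexI[of _ "Em (fst w) (ctr (fst w)) 0"]) (auto simp: D_def H_def)
  next
    case False
    then show ?thesis
      using base_VB[OF that(1) False] that(2) by (intro bexI[of _ "bs w"]) (auto simp: D_def bad_def)
  qed
  have witness: "\<exists>l\<in>D v0. near R (lab_square m l) (fst w)" if cl: "w \<in> ?Cl" for w
  proof (cases "bad w")
    case False
    have w: "w \<in> ?VA" "D w = D v0" using reach[of w] cl False by auto
    obtain l where l: "D w = C l" "lab_square m l = fst w" using D_ne[OF w(1) False] by blast
    moreover have "l \<in> C l" by (simp add: C_def)
    ultimately show ?thesis using w(2) near_refl[of "fst w"] by (intro bexI[of _ l]) auto
  next
    case True
    then obtain s where s: "dns s" "near R s (fst w)" "H s = D v0" using reach[of w] cl True by blast
    have "Em s (ctr s) 0 \<in> H s" by (simp add: H_def C_def)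
    then show ?thesis using s by (intro bexI[of _ "Em s (ctr s) 0"]) auto
  qed
  \<comment> \<open>Squares hold finitely many points, so the cluster visits infinitely many
    squares. The component \<open>D v0\<close> comes within range R of each of them, which finitely
    many labels could not achieve.\<close>
  have "infinite (fst ` ?Cl)"
  proof
    assume "finite (fst ` ?Cl)"
    moreover have "?Cl \<subseteq> (SIGMA s:fst ` ?Cl. {..<NA s \<omega>})" using reach by force
    ultimately show False using v0(3) by (meson finite_SigmaI finite_lessThan finite_subset)
  qed
  moreover have "fst ` ?Cl \<subseteq> (\<Union>l\<in>D v0. {t. near R (lab_square m l) t})" using witness by blast
  ultimately have inf: "infinite (D v0)" by (meson finite_UN_I finite_near finite_subset)
  obtain l where "l \<in> VB \<omega>" "D v0 = C l" using D_ne[OF v0(1,2)] by blast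
  then show ?thesis using inf unfolding gperc_def C_def EB_def by auto
qed

end

section \<open>Laws of the coupled configurations\<close>

context coupling
begin

definition em_coords :: "int \<times> int \<Rightarrow> idx set" where
  "em_coords s = Slot s ` em_cells m R s \<union> ((\<lambda>z. Pos (Em s z 0)) ` em_cells m R s \<union> Mark ` em_marks m R K
      s)"

lemma countable_em [simp]: "countable (em_cells m R s)" "countable (em_marks m R K s)"
  using finite_em_marks m(1) by (auto intro: countable_finite)

lemma fr0_le_1: "f r0 \<le> 1"
  using f_bounds[of r0] r0 by simp

lemma owner_em_marks: "e \<in> em_marks m R K s \<Longrightarrow> owner e = Some s"
  by (simp add: em_marks_def)

lemma pred_emu [measurable]: "Measurable.pred \<Omega> (emu s)"
  unfolding emu_def by measurable

lemma depends_on_emu: "depends_on (em_coords s) (emu s)"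
  by (rule depends_onI) (simp add: emu_def em_coords_def)

lemma prob_poisson_ge_1:
  assumes "0 < a"
  shows "measure_pmf.prob (poisson_pmf a) {1..} = 1 - exp (- a)"
proof -
  have "{1..} = UNIV - {0::nat}" by auto
  then show ?thesis
    using measure_pmf.prob_compl[of "{0}" "poisson_pmf a"] assms by (simp add: measure_pmf_single)
qed

lemma prob_emu: "P.prob {\<omega> \<in> space \<Omega>. emu s \<omega>} = em_prob m R K (f r0) del s"
proof -
  let ?Z = "em_cells m R s" and ?M = "em_marks m R K s"
  let ?a = "\<lambda>\<omega>. \<forall>z\<in>?Z. 1 \<le> dec (\<omega> (Slot s z))" and ?b = "\<lambda>\<omega>. \<forall>z\<in>?Z. \<omega> (Pos (Em s z 0)) \<in> cell m z"
    and ?c = "\<lambda>\<omega>. \<forall>e\<in>?M. fst (\<omega> (Mark e)) < f r0"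
  have "P.prob {\<omega> \<in> space \<Omega>. ?a \<omega>} = (\<Prod>z\<in>?Z. P.prob {\<omega> \<in> space \<Omega>. 1 \<le> dec (\<omega> (Slot s z))})"
    by (rule prob_ball_depends_on[where J = "\<lambda>z. {Slot s z}"])
      (use m(1) in \<open>auto simp: disjoint_family_on_def intro!: depends_onI\<close>)
  also have "\<dots> = (1 - exp (- del)) ^ card ?Z"
    using prob_dec[of "Slot s _" "poisson_pmf del" "{1..}"] prob_poisson_ge_1[OF del] by simp
  finally have a: "P.prob {\<omega> \<in> space \<Omega>. ?a \<omega>} = (1 - exp (- del)) ^ card ?Z" .
  have "P.prob {\<omega> \<in> space \<Omega>. ?b \<omega>} = (\<Prod>z\<in>?Z. P.prob {\<omega> \<in> space \<Omega>. \<omega> (Pos (Em s z 0)) \<in> cell m z})"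
    by (rule prob_ball_depends_on[where J = "\<lambda>z. {Pos (Em s z 0)}"])
      (use m(1) in \<open>auto simp: disjoint_family_on_def intro!: depends_onI\<close>)
  also have "\<dots> = (1 / (real_of_int m)\<^sup>2) ^ card ?Z"
    using prob_Pos_cell[OF m(1), of _ "Em s _ 0"] by simp
  finally have b: "P.prob {\<omega> \<in> space \<Omega>. ?b \<omega>} = (1 / (real_of_int m)\<^sup>2) ^ card ?Z" .
  have "P.prob {\<omega> \<in> space \<Omega>. ?c \<omega>} = (\<Prod>e\<in>?M. P.prob {\<omega> \<in> space \<Omega>. fst (\<omega> (Mark e)) < f r0})"
    by (rule prob_ball_depends_on[where J = "\<lambda>e. {Mark e}"])
      (use finite_em_marks[OF m(1)] in \<open>auto simp: disjoint_family_on_def intro!: depends_onI\<close>)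
  also have "\<dots> = f r0 ^ card ?M"
    using prob_unif_less[of "Mark _" "f r0"] r0 fr0_le_1 by simp
  finally have c: "P.prob {\<omega> \<in> space \<Omega>. ?c \<omega>} = f r0 ^ card ?M" .
  have bc: "P.prob {\<omega> \<in> space \<Omega>. ?b \<omega> \<and> ?c \<omega>} = P.prob {\<omega> \<in> space \<Omega>. ?b \<omega>} * P.prob {\<omega> \<in> space \<Omega>. ?c \<omega>}"
  proof (rule prob_conj_depends_on[of "(\<lambda>z. Pos (Em s z 0)) ` ?Z" "Mark ` ?M"])
    show "Measurable.pred \<Omega> ?b" "Measurable.pred \<Omega> ?c" by measurable
    show "depends_on ((\<lambda>z. Pos (Em s z 0)) ` ?Z) ?b" "depends_on (Mark ` ?M) ?c"
      by (rule depends_onI, simp)+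
  qed auto
  have abc: "P.prob {\<omega> \<in> space \<Omega>. ?a \<omega> \<and> (?b \<omega> \<and> ?c \<omega>)} = P.prob {\<omega> \<in> space \<Omega>. ?a \<omega>} *
      P.prob {\<omega> \<in> space \<Omega>. ?b \<omega> \<and> ?c \<omega>}"
  proof (rule prob_conj_depends_on[of "Slot s ` ?Z" "(\<lambda>z. Pos (Em s z 0)) ` ?Z \<union> Mark ` ?M"])
    show "Measurable.pred \<Omega> ?a" "Measurable.pred \<Omega> (\<lambda>\<omega>. ?b \<omega> \<and> ?c \<omega>)" by measurable
    show "depends_on (Slot s ` ?Z) ?a" "depends_on ((\<lambda>z. Pos (Em s z 0)) ` ?Z \<union> Mark ` ?M) (\<lambda>\<omega>. ?b \<omega> \<and>
        ?c \<omega>)"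
      by (rule depends_onI, simp)+
  qed auto
  show ?thesis unfolding emu_def abc a bc b c by (simp only: em_prob_def[of m R K "f r0" del s])
qed

lemma em_prob_pos: "0 < em_prob m R K (f r0) del s"
  unfolding em_prob_def using del m(1) r0 by (intro mult_pos_pos zero_less_power) auto

lemma NA_measurable [measurable]: "NA s \<in> measurable \<Omega> (count_space UNIV)"
  unfolding NA_def coupled_count_def by measurable

lemma distr_NA: "distr \<Omega> (count_space UNIV) (NA s) = measure_pmf (poisson_pmf lam)"
  unfolding NA_def
proof (rule distr_coupled_count[where JN = "{Cnt s}" and JG = "em_coords s" and JZ =
    "{Zet s}", OF lam em_prob_pos tail])
  show "distr \<Omega> (count_space UNIV) (\<lambda>\<omega>. dec (\<omega> (Cnt s))) = measure_pmf (poisson_pmf lam)"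
    "distr \<Omega> (count_space UNIV) (\<lambda>\<omega>. dec (\<omega> (Zet s))) = measure_pmf (dense_pmf lam K (em_prob m R K (f r0)
        del s))"
    by (simp_all add: distr_dec distr_enc_pmf)
qed (rule depends_on_emu prob_emu | (auto intro!: depends_onI simp: em_coords_def; fail))+

lemma prob_Half: "P.prob {\<omega>. 1 \<le> dec (\<omega> (Half v w))} = sqrt q"
proof -
  have "P.prob {\<omega>. dec (\<omega> (Half v w)) \<in> {1..}} = measure_pmf.prob (map_pmf of_bool (bernoulli_pmf (sqrt
      q))) {1::nat..}"
    by (rule prob_dec) simp
  also have "\<dots> = measure_pmf.prob (bernoulli_pmf (sqrt q)) {True}"
    by (auto simp: measure_map_pmf vimage_def intro: arg_cong[where f = "measure_pmf.prob _"])
  also have "\<dots> = sqrt q" using q by (simp add: measure_pmf_single)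
  finally show ?thesis by simp
qed

text \<open>Of the two orders of a pair only one receives the coupled mark; the other order and the
  diagonal use \<open>Junk\<close>, so distinct entries have disjoint coordinates.\<close>

definition coords_UA :: "label \<times> label \<Rightarrow> idx set" where
  "coords_UA e = (if to_nat (fst e) < to_nat (snd e)
    then {Mark (gkey (bs (fst e)) (bs (snd e))), Half (fst e) (snd e), Half (snd e) (fst e)} else {Junk
        e})"

lemma UA_measurable [measurable]: "UA e \<in> borel_measurable \<Omega>"
  unfolding UA_def by measurable

lemma depends_on_UA: "depends_on (coords_UA e) (UA e)"
  by (rule depends_onI) (auto simp: UA_def coords_UA_def)

lemma distr_UA: "distr \<Omega> borel (UA e) = unif01"
proof (cases "to_nat (fst e) < to_nat (snd e)")
  case True
  let ?v = "fst e" and ?w = "snd e" and ?k = "gkey (bs (fst e)) (bs (snd e))"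
  let ?B = "\<lambda>\<omega>. 1 \<le> dec (\<omega> (Half ?v ?w)) \<and> 1 \<le> dec (\<omega> (Half ?w ?v))"
  have ne: "?v \<noteq> ?w" using True by auto
  have "P.prob {\<omega> \<in> space \<Omega>. ?B \<omega>} = P.prob {\<omega> \<in> space \<Omega>. 1 \<le> dec (\<omega> (Half ?v ?w))} *
      P.prob {\<omega> \<in> space \<Omega>. 1 \<le> dec (\<omega> (Half ?w ?v))}"
  proof (rule prob_conj_depends_on[of "{Half ?v ?w}" "{Half ?w ?v}"])
    show "depends_on {Half ?v ?w} (\<lambda>\<omega>. 1 \<le> dec (\<omega> (Half ?v ?w)))" "depends_on {Half ?w ?v} (\<lambda>\<omega>. 1 \<le>
        dec (\<omega> (Half ?w ?v)))"
      by (rule depends_onI, simp)+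
    show "Measurable.pred \<Omega> (\<lambda>\<omega>. 1 \<le> dec (\<omega> (Half ?v ?w)))" "Measurable.pred \<Omega> (\<lambda>\<omega>. 1 \<le>
        dec (\<omega> (Half ?w ?v)))"
      by measurable
  qed (use ne in simp)
  then have PB: "P.prob {\<omega> \<in> space \<Omega>. ?B \<omega>} = q" using q prob_Half by simp
  have "distr \<Omega> borel (\<lambda>\<omega>. if ?B \<omega> then q * fst (\<omega> (Mark ?k)) else q + (1 - q) * fst (\<omega> (Mark ?k))) =
      unif01"
  proof (rule distr_uniform_mixture[where J = "{Mark ?k}" and J' =
      "{Half ?v ?w, Half ?w ?v}", OF q _ _ _ _ _ _ PB])
    show "distr \<Omega> borel (\<lambda>\<omega>. fst (\<omega> (Mark ?k))) = unif01" by (rule distr_unif_coord) simp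
    show "depends_on {Mark ?k} (\<lambda>\<omega>. fst (\<omega> (Mark ?k)))" "depends_on {Half ?v ?w, Half ?w ?v} ?B"
      by (rule depends_onI, simp)+
    show "(\<lambda>\<omega>. fst (\<omega> (Mark ?k))) \<in> borel_measurable \<Omega>" "Measurable.pred \<Omega> ?B" by measurable
  qed simp
  moreover have "UA e = (\<lambda>\<omega>. if ?B \<omega> then q * fst (\<omega> (Mark ?k)) else q + (1 - q) * fst (\<omega> (Mark ?k)))"
    using True by (intro ext) (simp add: UA_def)
  ultimately show ?thesis by simp
next
  case False
  then have "UA e = (\<lambda>\<omega>. fst (\<omega> (Junk e)))" by (intro ext) (simp add: UA_def)
  then show ?thesis using distr_unif_coord[of "Junk e"] by simp
qed

text \<open>The counts \<open>NA\<close> look at marks through the emulator events, but all those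
  marks have an owner, while the marks behind \<open>UA\<close> join two base labels and have none.
  For different squares the owners differ. This is why modifying the counts preserves the law of the
  model.\<close>

lemma coupled_law_A:
  "distr \<Omega> (RCM_space lam) (\<lambda>\<omega>. (\<lambda>s. NA s \<omega>, plain_X \<omega>, \<lambda>e. UA e \<omega>)) = RCM_space lam" (is ?A)
  "(\<lambda>\<omega>. (\<lambda>s. NA s \<omega>, plain_X \<omega>, \<lambda>e. UA e \<omega>)) \<in> \<Omega> \<rightarrow>\<^sub>M RCM_space lam" (is ?B)
proof -
  have X: "distr \<Omega> borel (\<lambda>\<omega>. plain_X \<omega> v) = square_unif (fst v)" for v
    using distr_Pos[of "bs v"] by (simp add: plain_X_def)
  have depN: "depends_on ({Cnt s, Zet s} \<union> em_coords s) (NA s)" for s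
  proof (rule depends_onI)
    fix \<omega> \<omega>' :: "idx \<Rightarrow> real \<times> real" assume eq: "\<And>i. i \<in> {Cnt s, Zet s} \<union> em_coords s \<Longrightarrow> \<omega> i = \<omega>' i"
    have "emu s \<omega> = emu s \<omega>'" by (rule depends_onD[OF depends_on_emu]) (use eq in blast)
    then show "NA s \<omega> = NA s \<omega>'" using eq[of "Cnt s"] eq[of "Zet s"] by (simp add: NA_def)
  qed
  have depX: "depends_on {Pos (bs v)} (\<lambda>\<omega>. plain_X \<omega> v)" for v
    by (rule depends_onI) (simp add: plain_X_def)
  have dN: "disjoint_family (\<lambda>s. {Cnt s, Zet s} \<union> em_coords s)"
    unfolding disjoint_family_on_def em_coords_def by (auto dest!: owner_em_marks)
  have dX: "disjoint_family (\<lambda>v. {Pos (bs v)})" by (auto simp: disjoint_family_on_def prod_eq_iff)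
  have dU: "disjoint_family coords_UA"
    unfolding disjoint_family_on_def
  proof (intro ballI impI)
    fix e e' :: "label \<times> label" assume "e \<noteq> e'"
    then have ne: "fst e \<noteq> fst e' \<or> snd e \<noteq> snd e'" by (simp add: prod_eq_iff)
    have bs: "bs a = bs b \<longleftrightarrow> a = b" for a b :: label by (auto simp: prod_eq_iff)
    show "coords_UA e \<inter> coords_UA e' = {}"
    proof (cases "to_nat (fst e) < to_nat (snd e) \<and> to_nat (fst e') < to_nat (snd e')")
      case True
      then have sw: "\<not> (fst e = snd e' \<and> snd e = fst e')" by auto
      then have "gkey (bs (fst e)) (bs (snd e)) \<noteq> gkey (bs (fst e')) (bs (snd e'))"
        unfolding gkey_eq_iff bs using ne by blast
      moreover have "Half (fst e) (snd e) \<noteq> Half (fst e') (snd e')" "Half (fst e) (snd e) \<noteq> Half (snd e')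
          (fst e')"
        "Half (snd e) (fst e) \<noteq> Half (fst e') (snd e')" "Half (snd e) (fst e) \<noteq> Half (snd e') (fst e')"
        using ne sw by auto
      ultimately show ?thesis using True unfolding coords_UA_def by simp
    next
      case False
      then show ?thesis using \<open>e \<noteq> e'\<close> unfolding coords_UA_def by (simp split: if_splits)
    qed
  qed
  have own: "owner (gkey (bs v) (bs w)) = None" for v w by (simp add: gkey_def)
  have dNU: "({Cnt s, Zet s} \<union> em_coords s) \<inter> coords_UA e = {}" for s e
  proof -
    have "gkey (bs (fst e)) (bs (snd e)) \<notin> em_marks m R K s"
      using own owner_em_marks by (metis option.distinct(1))
    then have "Mark (gkey (bs (fst e)) (bs (snd e))) \<notin> Mark ` em_marks m R K s" by blast
    then show ?thesis by (simp add: coords_UA_def em_coords_def image_iff)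
  qed
  note L = distr_RCM[of NA lam "\<lambda>s. {Cnt s, Zet s} \<union> em_coords s" "\<lambda>v \<omega>. plain_X \<omega> v" "\<lambda>v. {Pos (bs
      v)}" UA coords_UA,
      OF NA_measurable distr_NA depN plain_measurable(2) X depX UA_measurable distr_UA depends_on_UA dN dX
          dU _ dNU]
  show ?A by (rule L(1)) (auto simp: em_coords_def coords_UA_def)
  show ?B by (rule L(2)) (auto simp: em_coords_def coords_UA_def)
qed

section \<open>Intensity and law of the comparison graph\<close>

definition eta :: real where
  "eta = (1 - sqrt q) ^ (nat (2 * R + 1) ^ 2 * K)"

text \<open>Slots sorted by the square in which their points lie rather than by the emulator they
  serve: t receives points from every emulator whose block contains it.\<close>

definition slots :: "int \<times> int \<Rightarrow> ((int \<times> int) \<times> (int \<times> int)) set" where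
  "slots t = {s. near R t s} \<times> cells_of t"

text \<open>What killing leaves of \<open>lam\<close>, plus \<open>del\<close> for each slot located
  in a given square.\<close>

definition lamB :: real where
  "lamB = (1 - eta) * lam + real (nat (2 * R + 1) ^ 2 * nat m ^ 2) * del"

lemma finite_slots [simp]: "finite (slots t)"
  unfolding slots_def using finite_cells_of[OF m(1)] by simp

lemma card_slots: "card (slots t) = nat (2 * R + 1) ^ 2 * nat m ^ 2"
  unfolding slots_def using card_near[OF R(2)] card_cells_of[OF m(1)]
      by (simp add: card_cartesian_product)

lemma pred_kill [measurable]: "Measurable.pred \<Omega> (kill v)"
proof -
  have [simp]: "countable ({t. near R (fst v) t} \<times> {..<K})" by (intro countable_finite) simp
  show ?thesis unfolding kill_def by measurable
qed

lemma depends_on_kill: "depends_on (range (Half v)) (kill v)"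
  by (rule depends_onI) (simp add: kill_def)

lemma eta_bounds: "0 < eta" "eta < 1"
proof -
  have s: "0 < sqrt q" "sqrt q < 1" using q by (auto simp: real_sqrt_lt_1_iff)
  then show "0 < eta" unfolding eta_def by simp
  have "0 < nat (2 * R + 1) ^ 2 * K" using K R(2) by simp
  then show "eta < 1" unfolding eta_def using s by (intro power_less_one_iff[THEN iffD2]) auto
qed

lemma prob_not_kill: "P.prob {\<omega> \<in> space \<Omega>. \<not> kill v \<omega>} = 1 - eta"
proof -
  let ?S = "{t. near R (fst v) t} \<times> {..<K}"
  have "P.prob {\<omega> \<in> space \<Omega>. kill v \<omega>} = (\<Prod>w\<in>?S. P.prob {\<omega> \<in> space \<Omega>. dec (\<omega> (Half v w)) = 0})"
    unfolding kill_def
    by (rule prob_ball_depends_on[where J = "\<lambda>w. {Half v w}"]; (measurable)?)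
      (auto simp: disjoint_family_on_def intro!: depends_onI)
  also have "\<dots> = (\<Prod>w\<in>?S. 1 - sqrt q)"
  proof (rule prod.cong[OF refl])
    fix w
    have "P.prob {\<omega>. \<not> 1 \<le> dec (\<omega> (Half v w))} = 1 - P.prob {\<omega>. 1 \<le> dec (\<omega> (Half v w))}"
      by (rule prob_compl_pred) measurable
    moreover have "{\<omega>. \<not> 1 \<le> dec (\<omega> (Half v w))} = {\<omega> \<in> space \<Omega>. dec (\<omega> (Half v w)) = 0}" by auto
    ultimately show "P.prob {\<omega> \<in> space \<Omega>. dec (\<omega> (Half v w)) = 0} = 1 - sqrt q" using prob_Half by simp
  qed
  also have "\<dots> = eta" unfolding eta_def using card_near[OF R(2)] by (simp add: card_cartesian_product)
  finally show ?thesis using prob_compl_pred[OF pred_kill, of v] by simp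
qed

definition kept :: "int \<times> int \<Rightarrow> (idx \<Rightarrow> real \<times> real) \<Rightarrow> nat" where
  "kept t \<omega> = card {k \<in> {..<dec (\<omega> (Cnt t))}. \<not> kill (t, k) \<omega>}"

lemma distr_kept:
  "kept t \<in> measurable \<Omega> (count_space UNIV)"
  "distr \<Omega> (count_space UNIV) (kept t) = measure_pmf (poisson_pmf ((1 - eta) * lam))"
proof -
  have p: "0 < 1 - eta" "1 - eta \<le> 1" using eta_bounds by auto
  have law: "distr \<Omega> (count_space UNIV) (\<lambda>\<omega>. dec (\<omega> (Cnt t))) = measure_pmf (poisson_pmf lam)"
    by (simp add: distr_dec distr_enc_pmf)
  have dep: "depends_on (range (Half (t, k))) (\<lambda>\<omega>. \<not> kill (t, k) \<omega>)" for k
    using depends_on_compose[OF depends_on_kill[of "(t, k)"], where h = Not] by simp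
  have disj: "disjoint_family (\<lambda>k. range (Half (t, k)))" by (auto simp: disjoint_family_on_def)
  have meas: "Measurable.pred \<Omega> (\<lambda>\<omega>. \<not> kill (t, k) \<omega>)" "(\<lambda>\<omega>. dec (\<omega> (Cnt t))) \<in> measurable \<Omega> (count_space
      UNIV)" for k
    by measurable
  have depN: "depends_on {Cnt t} (\<lambda>\<omega>. dec (\<omega> (Cnt t)))" by (rule depends_onI) simp
  have dN: "{Cnt t} \<inter> range (Half (t, k)) = {}" for k by auto
  note L = distr_poisson_thinning[OF lam p meas(2) depN law disj dN meas(1) dep prob_not_kill]
  show "kept t \<in> measurable \<Omega> (count_space UNIV)"
    "distr \<Omega> (count_space UNIV) (kept t) = measure_pmf (poisson_pmf ((1 - eta) * lam))"
    unfolding kept_def using L by auto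
qed

definition base_coords :: "int \<times> int \<Rightarrow> idx set" where
  "base_coords t = {Cnt t} \<union> (\<Union>k. range (Half (t, k)))"

lemma depends_on_kept: "depends_on (base_coords t) (kept t)"
proof (rule depends_onI)
  fix \<omega> \<omega>' :: "idx \<Rightarrow> real \<times> real" assume eq: "\<And>i. i \<in> base_coords t \<Longrightarrow> \<omega> i = \<omega>' i"
  have "kill (t, k) \<omega> = kill (t, k) \<omega>'" for k
    by (rule depends_onD[OF depends_on_kill]) (use eq in \<open>auto simp: base_coords_def\<close>)
  then show "kept t \<omega> = kept t \<omega>'" using eq[of "Cnt t"] by (simp add: kept_def base_coords_def)
qed

definition slot_count :: "((int \<times> int) \<times> (int \<times> int)) set \<Rightarrow> (idx \<Rightarrow> real \<times> real) \<Rightarrow> nat" where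
  "slot_count S \<omega> = (\<Sum>x\<in>S. dec (\<omega> (Slot (fst x) (snd x))))"

definition cntB :: "int \<times> int \<Rightarrow> (idx \<Rightarrow> real \<times> real) \<Rightarrow> nat" where
  "cntB t \<omega> = kept t \<omega> + slot_count (slots t) \<omega>"

lemma distr_kept_slots:
  assumes "finite S"
  shows "(\<lambda>\<omega>. kept t \<omega> + slot_count S \<omega>) \<in> measurable \<Omega> (count_space UNIV) \<and>
    distr \<Omega> (count_space UNIV) (\<lambda>\<omega>. kept t \<omega> + slot_count S \<omega>) =
      measure_pmf (poisson_pmf ((1 - eta) * lam + real (card S) * del))"
  using assms
proof (induction S)
  case empty
  then show ?case using distr_kept by (simp add: slot_count_def)
next
  case (insert x S)
  let ?Y = "\<lambda>\<omega>. kept t \<omega> + slot_count S \<omega>" and ?Z = "\<lambda>\<omega>. dec (\<omega> (Slot (fst x) (snd x)))"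
  have eq: "(\<lambda>\<omega>. kept t \<omega> + slot_count (insert x S) \<omega>) = (\<lambda>\<omega>. ?Y \<omega> + ?Z \<omega>)"
    using insert.hyps by (auto simp: slot_count_def)
  have Y: "?Y \<in> measurable \<Omega> (count_space UNIV)"
    "distr \<Omega> (count_space UNIV) ?Y = measure_pmf (poisson_pmf ((1 - eta) * lam + real (card S) * del))"
    using insert.IH by auto
  have Z: "?Z \<in> measurable \<Omega> (count_space UNIV)" by measurable
  have lawZ: "distr \<Omega> (count_space UNIV) ?Z = measure_pmf (poisson_pmf del)" by (simp add: distr_dec
      distr_enc_pmf)
  have pos: "0 < (1 - eta) * lam + real (card S) * del"
    using eta_bounds lam del by (intro add_pos_nonneg) auto
  have depY: "depends_on (base_coords t \<union> (\<lambda>x. Slot (fst x) (snd x)) ` S) ?Y"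
  proof (rule depends_onI)
    fix \<omega> \<omega>' :: "idx \<Rightarrow> real \<times> real"
    assume e: "\<And>i. i \<in> base_coords t \<union> (\<lambda>x. Slot (fst x) (snd x)) ` S \<Longrightarrow> \<omega> i = \<omega>' i"
    have "kept t \<omega> = kept t \<omega>'" by (rule depends_onD[OF depends_on_kept]) (use e in blast)
    moreover have "slot_count S \<omega> = slot_count S \<omega>'" unfolding slot_count_def
        by (intro sum.cong refl) (use e in auto)
    ultimately show "?Y \<omega> = ?Y \<omega>'" by simp
  qed
  have depZ: "depends_on {Slot (fst x) (snd x)} ?Z" by (rule depends_onI) simp
  have disj: "(base_coords t \<union> (\<lambda>x. Slot (fst x) (snd x)) ` S) \<inter> {Slot (fst x) (snd x)} = {}"
    using insert.hyps by (auto simp: base_coords_def prod_eq_iff)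
  have "distr \<Omega> (count_space UNIV) (\<lambda>\<omega>. ?Y \<omega> + ?Z \<omega>) = measure_pmf (poisson_pmf ((1 - eta) * lam +
      real (card S) * del + del))"
    by (rule distr_poisson_add[OF pos del disj Y(1) depY Z depZ Y(2) lawZ])
  moreover have "(1 - eta) * lam + real (card S) * del + del = (1 - eta) * lam +
      real (card (insert x S)) * del"
    using insert.hyps by (simp add: algebra_simps)
  ultimately show ?case unfolding eq using Y(1) Z by (auto intro!: measurable_count_space_const)
qed

lemma distr_cntB:
  "cntB t \<in> measurable \<Omega> (count_space UNIV)"
  "distr \<Omega> (count_space UNIV) (cntB t) = measure_pmf (poisson_pmf lamB)"
  using distr_kept_slots[OF finite_slots, of t t] unfolding cntB_def[abs_def] lamB_def card_slots by auto

lemma distr_cntB_family: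
  "distr \<Omega> (PiM UNIV (\<lambda>_. count_space UNIV)) (\<lambda>\<omega> t. cntB t \<omega>) =
      PiM UNIV (\<lambda>_. measure_pmf (poisson_pmf lamB))"
proof -
  have dep: "depends_on (base_coords t \<union> (\<lambda>x. Slot (fst x) (snd x)) ` slots t) (cntB t)" for t
  proof (rule depends_onI)
    fix \<omega> \<omega>' :: "idx \<Rightarrow> real \<times> real"
    assume e: "\<And>i. i \<in> base_coords t \<union> (\<lambda>x. Slot (fst x) (snd x)) ` slots t \<Longrightarrow> \<omega> i = \<omega>' i"
    have "kept t \<omega> = kept t \<omega>'" by (rule depends_onD[OF depends_on_kept]) (use e in blast)
    moreover have "slot_count (slots t) \<omega> = slot_count (slots t) \<omega>'"
      unfolding slot_count_def by (intro sum.cong refl) (use e in auto)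
    ultimately show "cntB t \<omega> = cntB t \<omega>'" by (simp add: cntB_def)
  qed
  have disj: "disjoint_family (\<lambda>t. base_coords t \<union> (\<lambda>x. Slot (fst x) (snd x)) ` slots t)"
    unfolding disjoint_family_on_def base_coords_def slots_def cells_of_def by auto
  show ?thesis
    by (subst distr_family[OF disj distr_cntB(1) dep]) (simp add: distr_cntB(2))
qed

text \<open>Counts by actual location, as \<open>relabel_null\<close> requires; the symmetry of
  \<open>near\<close> exchanges the square of the point and the square of the emulator.\<close>

lemma card_VB:
  "finite {l \<in> VB \<omega>. lab_square m l = t}" "card {l \<in> VB \<omega>. lab_square m l = t} = cntB t \<omega>"
proof -
  let ?B = "Base t ` {k \<in> {..<dec (\<omega> (Cnt t))}. \<not> kill (t, k) \<omega>}"
  let ?E = "\<lambda>x. Em (fst x) (snd x) ` {..<dec (\<omega> (Slot (fst x) (snd x)))}"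
  have eq: "{l \<in> VB \<omega>. lab_square m l = t} = ?B \<union> (\<Union>x\<in>slots t. ?E x)"
  proof (intro set_eqI iffI)
    fix l assume "l \<in> {l \<in> VB \<omega>. lab_square m l = t}"
    then have l: "l \<in> VB \<omega>" "lab_square m l = t" by auto
    show "l \<in> ?B \<union> (\<Union>x\<in>slots t. ?E x)"
    proof (cases l)
      case (Base s k)
      then show ?thesis using l by (auto simp: VB_def)
    next
      case (Em s z i)
      then have "z \<in> em_cells m R s" "i < dec (\<omega> (Slot s z))" "cell_square m z = t" using l
          by (auto simp: VB_def)
      then have "(s, z) \<in> slots t" "l \<in> ?E (s, z)" using Em near_sym
          by (auto simp: slots_def cells_of_def em_cells_def)
      then show ?thesis by blast
    qed
  next
    fix l assume "l \<in> ?B \<union> (\<Union>x\<in>slots t. ?E x)"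
    then consider k where "l = Base t k" "k < dec (\<omega> (Cnt t))" "\<not> kill (t, k) \<omega>"
      | s z i where "(s, z) \<in> slots t" "l = Em s z i" "i < dec (\<omega> (Slot s z))" by fastforce
    then show "l \<in> {l \<in> VB \<omega>. lab_square m l = t}"
    proof cases
      case (1 k)
      then have "l \<in> VB \<omega>" unfolding VB_def by blast
      then show ?thesis using 1 by simp
    next
      case (2 s z i)
      then have "near R s (cell_square m z)" "cell_square m z = t" using near_sym[of R t s]
          by (auto simp: slots_def cells_of_def)
      moreover from this have "l \<in> VB \<omega>" using 2 unfolding VB_def em_cells_def by blast
      ultimately show ?thesis using 2 by simp
    qed
  qed
  have finE: "finite (\<Union>x\<in>slots t. ?E x)" by simp
  show "finite {l \<in> VB \<omega>. lab_square m l = t}" unfolding eq using finE by simp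
  have "card {l \<in> VB \<omega>. lab_square m l = t} = card ?B + card (\<Union>x\<in>slots t. ?E x)"
    unfolding eq by (rule card_Un_disjoint) (use finE in auto)
  also have "card ?B = kept t \<omega>" unfolding kept_def by (rule card_image) (auto simp: inj_on_def)
  also have "card (\<Union>x\<in>slots t. ?E x) = (\<Sum>x\<in>slots t. card (?E x))"
    by (rule card_UN_disjoint) (auto simp: prod_eq_iff)
  also have "\<dots> = slot_count (slots t) \<omega>"
    unfolding slot_count_def by (intro sum.cong refl) (simp add: card_image inj_on_def)
  finally show "card {l \<in> VB \<omega>. lab_square m l = t} = cntB t \<omega>" by (simp add: cntB_def)
qed

lemma pred_VB [measurable]: "Measurable.pred \<Omega> (\<lambda>\<omega>. l \<in> VB \<omega>)"
proof (cases l)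
  case (Base s k)
  have "(\<lambda>\<omega>. l \<in> VB \<omega>) = (\<lambda>\<omega>. k < dec (\<omega> (Cnt s)) \<and> \<not> kill (s, k) \<omega>)" by (cases s) (auto simp: VB_def
      Base)
  then show ?thesis by simp
next
  case (Em s z i)
  have "(\<lambda>\<omega>. l \<in> VB \<omega>) = (\<lambda>\<omega>. z \<in> em_cells m R s \<and> i < dec (\<omega> (Slot s z)))" by (cases s; cases z) (auto
      simp: VB_def Em)
  then show ?thesis by simp
qed

text \<open>Condition on the vertex set. It is determined by coordinates other than positions and
  marks, so these remain independent of it. By Fubini the null event of the model holds for almost
  every count configuration; \<open>relabel_null\<close> moves it to the given vertex set, and
  integrating over the vertex set concludes.\<close>

lemma AE_VB_no_percolation:
  assumes null: "AE \<omega> in RCM_space lamB. \<not> RCM_percolates f \<omega>"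
  shows "AE \<omega> in \<Omega>. \<not> gperc f (VB \<omega>) (\<lambda>l. \<omega> (Pos l)) (\<lambda>e. fst (\<omega> (Mark e)))"
proof -
  let ?SN = "PiM UNIV (\<lambda>_ :: int \<times> int. count_space (UNIV :: nat set))"
  let ?AL = "PiM UNIV (\<lambda>v::label. square_unif (fst v))" and ?BL = "PiM UNIV (\<lambda>_::label \<times> label. unif01)"
  let ?AB = "PiM UNIV (\<lambda>l. square_unif (lab_square m l))" and ?BB = "PiM UNIV (\<lambda>_::lab \<times> lab. unif01)"
  let ?N = "?AB \<Otimes>\<^sub>M ?BB"
  interpret CN: prob_space "PiM UNIV (\<lambda>_ :: int \<times> int. measure_pmf (poisson_pmf lamB))"
    by (intro prob_space_PiM measure_pmf.prob_space_axioms)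
  interpret XU: prob_space "?AL \<Otimes>\<^sub>M ?BL"
    by (intro prob_space_pair prob_space_PiM prob_square_unif prob_unif01)
  interpret PR: pair_sigma_finite "PiM UNIV (\<lambda>_ :: int \<times> int. measure_pmf (poisson_pmf lamB))" "?AL \<Otimes>\<^sub>M
      ?BL" ..
  interpret N: prob_space ?N
    by (intro prob_space_pair prob_space_PiM prob_square_unif prob_unif01)
  have "AE c in PiM UNIV (\<lambda>_ :: int \<times> int. measure_pmf (poisson_pmf lamB)). AE y in ?AL \<Otimes>\<^sub>M ?BL. \<not>
      RCM_percolates f (c, y)"
    using null unfolding RCM_space_def by (rule PR.AE_pair)
  then have "AE c in distr \<Omega> ?SN (\<lambda>\<omega> t. cntB t \<omega>). AE y in ?AL \<Otimes>\<^sub>M ?BL. \<not> RCM_percolates f (c, y)"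
    by (simp only: distr_cntB_family)
  moreover have "(\<lambda>\<omega> t. cntB t \<omega>) \<in> \<Omega> \<rightarrow>\<^sub>M ?SN" using distr_cntB(1) by (auto intro: measurable_PiM_single')
  ultimately have "AE \<omega> in \<Omega>. AE y in ?AL \<Otimes>\<^sub>M ?BL. \<not> RCM_percolates f (\<lambda>t. cntB t \<omega>, y)"
    by (rule AE_distrD[rotated])
  then have AE_V: "AE \<omega> in \<Omega>. AE y in ?N. \<not> gperc f (VB \<omega>) (fst y) (snd y)"
  proof eventually_elim
    case (elim \<omega>)
    show ?case
      by (rule relabel_null[OF f_antitone card_VB(1)]) (use elim in \<open>simp add: RCM_percolates_gperc
          card_VB(2)\<close>)
  qed
  let ?SV = "PiM UNIV (\<lambda>_ :: lab. count_space (UNIV :: bool set))"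
  define Y where "Y \<omega> = (\<lambda>l. l \<in> VB \<omega>)" for \<omega>
  define Z where "Z \<omega> = (\<lambda>l. \<omega> (Pos l), \<lambda>e. fst (\<omega> (Mark e)))" for \<omega> :: "idx \<Rightarrow> real \<times> real"
  have Y: "Y \<in> \<Omega> \<rightarrow>\<^sub>M ?SV" unfolding Y_def by (rule measurable_PiM_single') auto
  have mX: "(\<lambda>\<omega> l. \<omega> (Pos l)) \<in> \<Omega> \<rightarrow>\<^sub>M PiM UNIV (\<lambda>_ :: lab. borel)" by (rule measurable_PiM_single') auto
  have mU: "(\<lambda>\<omega> e. fst (\<omega> (Mark e))) \<in> \<Omega> \<rightarrow>\<^sub>M PiM UNIV (\<lambda>_ :: lab \<times> lab. borel)" by (rule
      measurable_PiM_single') auto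
  have depX: "depends_on (range Pos) (\<lambda>\<omega> l. \<omega> (Pos l))" by (rule depends_onI) auto
  have depU: "depends_on (range Mark) (\<lambda>\<omega> e. fst (\<omega> (Mark e)))" by (rule depends_onI) auto
  have lX: "distr \<Omega> (PiM UNIV (\<lambda>_. borel)) (\<lambda>\<omega> l. \<omega> (Pos l)) = ?AB"
    by (subst distr_family[where J = "\<lambda>l. {Pos l}"])
      (auto simp: disjoint_family_on_def distr_Pos intro!: depends_onI)
  have lU: "distr \<Omega> (PiM UNIV (\<lambda>_. borel)) (\<lambda>\<omega> e. fst (\<omega> (Mark e))) = ?BB"
    by (subst distr_family[where J = "\<lambda>e. {Mark e}"])
      (auto simp: disjoint_family_on_def distr_unif_coord intro!: depends_onI)
  have lZ': "distr \<Omega> (PiM UNIV (\<lambda>_. borel) \<Otimes>\<^sub>M PiM UNIV (\<lambda>_. borel)) Z = ?N"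
    unfolding Z_def lX[symmetric] lU[symmetric]
    by (rule distr_pair[OF _ mX depX mU depU]) auto
  have sN: "sets (PiM UNIV (\<lambda>_ :: lab. borel) \<Otimes>\<^sub>M PiM UNIV (\<lambda>_ :: lab \<times> lab. borel)) = sets ?N"
    unfolding lZ'[symmetric] by simp
  have Z: "Z \<in> \<Omega> \<rightarrow>\<^sub>M ?N"
    using measurable_Pair[OF mX mU] unfolding Z_def by (subst measurable_cong_sets[OF refl sN[symmetric]])
  have lZ: "distr \<Omega> ?N Z = ?N"
    by (subst (2) lZ'[symmetric]) (rule distr_cong; simp add: sN)
  \<comment> \<open>Killing looks only at half-edges, towards active and inactive labels alike;
    hence the vertex set reveals nothing about positions or marks.\<close>
  have depY: "depends_on (- (range Pos \<union> range Mark)) Y"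
  proof (rule depends_onI)
    fix \<omega> \<omega>' :: "idx \<Rightarrow> real \<times> real" assume e: "\<And>i. i \<in> - (range Pos \<union> range Mark) \<Longrightarrow> \<omega> i = \<omega>' i"
    have "kill v \<omega> = kill v \<omega>'" for v by (rule depends_onD[OF depends_on_kill]) (use e in auto)
    moreover have "\<omega> (Cnt s) = \<omega>' (Cnt s)" "\<omega> (Slot s z) = \<omega>' (Slot s z)" for s z using e by auto
    ultimately show "Y \<omega> = Y \<omega>'" by (simp add: Y_def VB_def)
  qed
  have depZ: "depends_on (range Pos \<union> range Mark) Z"
    unfolding Z_def by (rule depends_on_pair[OF depX depU])
  have joint: "distr \<Omega> (?SV \<Otimes>\<^sub>M ?N) (\<lambda>\<omega>. (Y \<omega>, Z \<omega>)) = distr \<Omega> ?SV Y \<Otimes>\<^sub>M ?N"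
  proof -
    have "- (range Pos \<union> range Mark) \<inter> (range Pos \<union> range Mark) = {}" by blast
    from distr_pair[OF this Y depY Z depZ] show ?thesis by (simp only: lZ)
  qed
  have meas: "Measurable.pred (?SV \<Otimes>\<^sub>M ?N) (\<lambda>x. gperc f {l. fst x l} (fst (snd x)) (snd (snd x)))"
  proof (rule pred_gperc[OF f_antitone, where W = UNIV])
    show "Measurable.pred (?SV \<Otimes>\<^sub>M ?N) (\<lambda>x. v \<in> {l. fst x l})" for v by simp
    have "(\<lambda>x. fst (snd x) v) \<in> ?SV \<Otimes>\<^sub>M ?N \<rightarrow>\<^sub>M square_unif (lab_square m v)" for v by simp
    then show "(\<lambda>x. fst (snd x) v) \<in> borel_measurable (?SV \<Otimes>\<^sub>M ?N)" for v
        by (simp cong: measurable_cong_sets)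
    have "(\<lambda>x. snd (snd x) (gkey v w)) \<in> ?SV \<Otimes>\<^sub>M ?N \<rightarrow>\<^sub>M unif01" for v w :: lab by simp
    then show "(\<lambda>x. snd (snd x) (gkey v w)) \<in> borel_measurable (?SV \<Otimes>\<^sub>M ?N)" for v w :: lab
        by (simp cong: measurable_cong_sets)
  qed simp
  let ?B = "{x \<in> space (?SV \<Otimes>\<^sub>M ?N). gperc f {l. fst x l} (fst (snd x)) (snd (snd x))}"
  have B: "?B \<in> sets (?SV \<Otimes>\<^sub>M ?N)" using meas by simp
  have B': "?B \<in> sets (distr \<Omega> ?SV Y \<Otimes>\<^sub>M ?N)" using B by (simp cong: sets_pair_measure_cong)
  \<comment> \<open>Fubini for the independent pair: for almost every vertex set the section of the
    percolation event is null.\<close>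
  have "emeasure (distr \<Omega> (?SV \<Otimes>\<^sub>M ?N) (\<lambda>\<omega>. (Y \<omega>, Z \<omega>))) ?B = (\<integral>\<^sup>+x. emeasure ?N (Pair x -` ?B) \<partial>distr \<Omega>
      ?SV Y)"
    unfolding joint by (rule N.emeasure_pair_measure_alt[OF B'])
  also have "\<dots> = (\<integral>\<^sup>+\<omega>. emeasure ?N (Pair (Y \<omega>) -` ?B) \<partial>\<Omega>)"
    by (rule nn_integral_distr[OF Y]) (use N.measurable_emeasure_Pair[OF B] in simp)
  also have "\<dots> = (\<integral>\<^sup>+\<omega>. 0 \<partial>\<Omega>)"
  proof (rule nn_integral_cong_AE)
    show "AE \<omega> in \<Omega>. emeasure ?N (Pair (Y \<omega>) -` ?B) = 0"
      using AE_V
    proof eventually_elim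
      case (elim \<omega>)
      have "AE y in ?N. y \<notin> Pair (Y \<omega>) -` ?B"
        using elim by (rule AE_mp) (auto intro!: AE_I2 simp: Y_def)
      moreover have "Pair (Y \<omega>) -` ?B \<in> sets ?N" by (rule sets_Pair1[OF B])
      ultimately have "N.prob (Pair (Y \<omega>) -` ?B) = 0" using N.prob_eq_0 by blast
      then show ?case by (simp only: N.emeasure_eq_measure ennreal_0)
    qed
  qed
  finally have 0: "emeasure (distr \<Omega> (?SV \<Otimes>\<^sub>M ?N) (\<lambda>\<omega>. (Y \<omega>, Z \<omega>))) ?B = 0" by simp
  have YZ: "(\<lambda>\<omega>. (Y \<omega>, Z \<omega>)) \<in> \<Omega> \<rightarrow>\<^sub>M ?SV \<Otimes>\<^sub>M ?N" using Y Z by simp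
  have "AE x in distr \<Omega> (?SV \<Otimes>\<^sub>M ?N) (\<lambda>\<omega>. (Y \<omega>, Z \<omega>)). x \<notin> ?B"
    by (rule AE_not_in) (use 0 B in \<open>auto simp: null_sets_def\<close>)
  then have "AE \<omega> in \<Omega>. (Y \<omega>, Z \<omega>) \<notin> ?B" by (rule AE_distrD[OF YZ])
  then show ?thesis
  proof (rule AE_mp, intro AE_I2 impI)
    fix \<omega> assume "\<omega> \<in> space \<Omega>" "(Y \<omega>, Z \<omega>) \<notin> ?B"
    then show "\<not> gperc f (VB \<omega>) (\<lambda>l. \<omega> (Pos l)) (\<lambda>e. fst (\<omega> (Mark e)))"
      using measurable_space[OF YZ] by (auto simp: Y_def Z_def)
  qed
qed

lemma AE_Zet: "AE \<omega> in \<Omega>. \<forall>s. dec (\<omega> (Zet s)) = 0 \<or> K < dec (\<omega> (Zet s))"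
  unfolding AE_all_countable
proof
  fix s
  let ?p = "dense_pmf lam K (em_prob m R K (f r0) del s)"
  have law: "distr \<Omega> (count_space UNIV) (\<lambda>\<omega>. dec (\<omega> (Zet s))) = measure_pmf ?p"
    by (simp add: distr_dec distr_enc_pmf)
  have "AE n in measure_pmf ?p. n = 0 \<or> K < n"
    using set_dense_pmf[OF lam] by (auto simp: AE_measure_pmf_iff)
  then have "AE n in distr \<Omega> (count_space UNIV) (\<lambda>\<omega>. dec (\<omega> (Zet s))). n = 0 \<or> K < n" by (simp only: law)
  then show "AE \<omega> in \<Omega>. dec (\<omega> (Zet s)) = 0 \<or> K < dec (\<omega> (Zet s))"
    by (rule AE_distrD[rotated]) measurable
qed

lemma AE_Mark: "AE \<omega> in \<Omega>. \<forall>e. 0 \<le> fst (\<omega> (Mark e))"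
  unfolding AE_all_countable using AE_unif_nonneg by simp

lemma coupled_null:
  assumes "AE \<omega> in RCM_space lamB. \<not> RCM_percolates f \<omega>"
  shows "AE \<omega> in RCM_space lam. \<not> RCM_percolates (\<lambda>r. q * f r) \<omega>"
proof -
  have "antitone_nonneg (\<lambda>r. q * f r)" using f_antitone q by (simp add: antitone_nonneg_def)
  then have [measurable]: "Measurable.pred (RCM_space lam) (RCM_percolates (\<lambda>r. q * f r))"
    by (rule pred_RCM_percolates)
  have "AE \<omega> in \<Omega>. \<not> RCM_percolates (\<lambda>r. q * f r) (\<lambda>s. NA s \<omega>, plain_X \<omega>, \<lambda>e. UA e \<omega>)"
    using AE_VB_no_percolation[OF assms] AE_Pos AE_Mark AE_Zet
  proof eventually_elim
    case (elim \<omega>)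
    then show ?case using percolation_transfer[of \<omega>] unfolding RCM_percolates_gperc by auto
  qed
  then have "AE \<omega> in distr \<Omega> (RCM_space lam) (\<lambda>\<omega>. (\<lambda>s. NA s \<omega>, plain_X \<omega>, \<lambda>e. UA e \<omega>)). \<not> RCM_percolates
      (\<lambda>r. q * f r) \<omega>"
    by (subst AE_distr_iff[OF coupled_law_A(2)]) measurable
  then show ?thesis by (simp only: coupled_law_A(1))
qed

end

section \<open>Strict comparison\<close>

text \<open>Exponential tilting: the weight of n under \<open>lam\<close> is
  \<open>exp (lam * (x - 1)) * (1 / x) ^ n\<close> times its weight under \<open>lam * x\<close>. As
  x is free, the tail decays faster than any geometric rate.\<close>

lemma poisson_upper_tail:
  assumes lam: "0 < lam" and x: "1 < x"
  shows "measure_pmf.prob (poisson_pmf lam) {K<..} \<le> exp (lam * (x - 1)) * (1 / x) ^ Suc K"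
proof -
  have UN: "{K<..} = (\<Union>j. {Suc K + j})" using less_iff_Suc_add by auto
  have sums: "(\<lambda>j. pmf (poisson_pmf mu) (Suc K + j)) sums measure_pmf.prob (poisson_pmf mu) {K<..}" for mu
  proof -
    have "(\<lambda>j. measure_pmf.prob (poisson_pmf mu) {Suc K + j}) sums measure_pmf.prob (poisson_pmf mu) (\<Union>j.
        {Suc K + j})"
      by (rule measure_pmf.finite_measure_UNION) (auto simp: disjoint_family_on_def)
    then show ?thesis by (simp add: UN pmf.rep_eq)
  qed
  have mux: "0 < lam * x" using lam x by simp
  have le: "pmf (poisson_pmf lam) (Suc K + j) \<le> exp (lam * (x - 1)) * (1 / x) ^ Suc K *
      pmf (poisson_pmf (lam * x)) (Suc K + j)" for j
  proof -
    let ?n = "Suc K + j"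
    have rearrange: "a * b * (c / d * e) = b * c / d * (a * e)" for a b c d e :: real by simp
    have "pmf (poisson_pmf lam) ?n = exp (lam * (x - 1)) * (1 / x) ^ ?n * pmf (poisson_pmf (lam * x)) ?n"
    proof -
      have "exp (lam * (x - 1)) * exp (- (lam * x)) = exp (- lam)" by (simp add: exp_add[symmetric]
          algebra_simps)
      moreover have "(1 / x) ^ ?n * (lam * x) ^ ?n = lam ^ ?n" using x
          by (simp add: power_mult_distrib[symmetric])
      ultimately have "exp (lam * (x - 1)) * (1 / x) ^ ?n * ((lam * x) ^ ?n / fact ?n * exp (- (lam *
          x))) =
          lam ^ ?n / fact ?n * exp (- lam)"
        by (simp only: rearrange)
      then show ?thesis using lam mux by simp
    qed
    also have "\<dots> \<le> exp (lam * (x - 1)) * (1 / x) ^ Suc K * pmf (poisson_pmf (lam * x)) ?n"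
      using x by (intro mult_right_mono mult_left_mono power_decreasing) auto
    finally show ?thesis .
  qed
  have "measure_pmf.prob (poisson_pmf lam) {K<..} \<le> exp (lam * (x - 1)) * (1 / x) ^ Suc K *
      measure_pmf.prob (poisson_pmf (lam * x)) {K<..}"
    by (rule sums_le[OF le sums sums_mult[OF sums]])
  also have "\<dots> \<le> exp (lam * (x - 1)) * (1 / x) ^ Suc K * 1"
    using x by (intro mult_left_mono) auto
  finally show ?thesis by simp
qed

text \<open>A lower bound linear in x, uniformly up to b. Since \<open>del\<close> is proportional
  to \<open>\<eta>\<close>, this keeps the occurrence of \<open>\<eta>\<close> in the emulator
  probability a pure power.\<close>

lemma one_minus_exp_ge:
  fixes x :: real
  assumes "0 < x" "x \<le> b"
  shows "x / (1 + b) \<le> 1 - exp (- x)"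
proof -
  have "exp (- x) \<le> 1 / (1 + x)"
    using exp_ge_add_one_self[of x] assms by (simp add: exp_minus field_simps)
  moreover have "x / (1 + b) \<le> x / (1 + x)" using assms by (intro divide_left_mono mult_pos_pos) auto
  moreover have "1 - 1 / (1 + x) = x / (1 + x)" using assms by (simp add: field_simps)
  ultimately show ?thesis by linarith
qed

text \<open>\<open>k0\<close> bounds the occupation probability of a slot from below, and the
  exponent of c comes from \<open>card_em_marks\<close>, a larger exponent being worse because c is
  at most 1.\<close>

lemma em_prob_lower:
  assumes m: "0 < m" and R: "0 \<le> R" and c: "0 < c" "c \<le> 1" and del: "0 < del" "del \<le> b" and k0:
      "0 \<le> k0" "k0 \<le> del / (1 + b)"
  defines "n \<equiv> nat (2 * R + 1) ^ 2 * nat m ^ 2"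
  shows "(k0 / (real_of_int m)\<^sup>2) ^ n * c ^ (n * (nat (2 * R + 1) ^ 2 * K + nat (4 * R + 1) ^ 2 * n)) \<le>
      em_prob m R K c del s"
proof -
  have "k0 \<le> 1 - exp (- del)" using one_minus_exp_ge[OF del] k0 by linarith
  then have 1: "k0 ^ n \<le> (1 - exp (- del)) ^ n" using k0 by (intro power_mono)
  have 2: "c ^ (n * (nat (2 * R + 1) ^ 2 * K + nat (4 * R + 1) ^ 2 * n)) \<le> c ^ card (em_marks m R K s)"
    using c card_em_marks[OF m R, of K s] unfolding n_def by (intro power_decreasing) auto
  have "(k0 / (real_of_int m)\<^sup>2) ^ n * c ^ (n * (nat (2 * R + 1) ^ 2 * K + nat (4 * R + 1) ^ 2 * n)) =
      k0 ^ n * ((1 / (real_of_int m)\<^sup>2) ^ n * c ^ (n * (nat (2 * R + 1) ^ 2 * K + nat (4 * R + 1) ^ 2 *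
          n)))"
    by (simp add: power_divide)
  also have "\<dots> \<le> (1 - exp (- del)) ^ n * ((1 / (real_of_int m)\<^sup>2) ^ n * c ^ card (em_marks m R K s))"
    using 1 2 k0 c del by (intro mult_mono mult_nonneg_nonneg zero_le_power) auto
  also have "\<dots> = em_prob m R K c del s"
    unfolding em_prob_def n_def by (simp only: card_em_cells[OF m R])
  finally show ?thesis .
qed

text \<open>All constants including K, and so \<open>\<eta>\<close>, are fixed from L0 and L1 before
  \<open>lam\<close> is given; only \<open>del\<close> depends on \<open>lam\<close>.\<close>

lemma strict_comparison:
  fixes f :: "real \<Rightarrow> real"
  assumes q: "0 < q" "q < 1"
    and f_bounds: "\<And>r. 0 \<le> r \<Longrightarrow> 0 \<le> f r \<and> f r \<le> 1"
    and f_antitone: "antitone_nonneg f"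
    and r0: "0 < r0" "0 < f r0"
    and f_support: "\<And>r. 0 \<le> r \<Longrightarrow> 0 < f r \<Longrightarrow> r \<le> A"
    and L: "0 < L0" "L0 \<le> L1"
  shows "\<exists>\<eta>. 0 < \<eta> \<and> \<eta> < 1 \<and> (\<forall>lam. L0 \<le> lam \<longrightarrow> lam \<le> L1 \<longrightarrow>
    (AE \<omega> in RCM_space (lam * (1 - \<eta> / 2)). \<not> RCM_percolates f \<omega>) \<longrightarrow>
    (AE \<omega> in RCM_space lam. \<not> RCM_percolates (\<lambda>r. q * f r) \<omega>))"
proof -
  define R where "R = max 0 \<lceil>A + 1\<rceil>"
  define m where "m = max 1 \<lceil>4 / r0\<rceil>"
  define c where "c = f r0"
  define D where "D = nat (2 * R + 1) ^ 2"
  define D' where "D' = nat (4 * R + 1) ^ 2"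
  define n where "n = D * nat m ^ 2"
  have R: "A + 1 \<le> real_of_int R" "0 \<le> R" unfolding R_def by linarith+
  have m: "0 < m" unfolding m_def by linarith
  have "4 / r0 \<le> real_of_int m" unfolding m_def by linarith
  then have m4: "4 / real_of_int m \<le> r0" using r0 m by (simp add: field_simps)
  have c: "0 < c" "c \<le> 1" using r0 f_bounds[of r0] by (auto simp: c_def)
  have D: "0 < D" using R by (simp add: D_def)
  have n: "0 < n" using D m by (simp add: n_def)
  define u where "u = 1 - sqrt q"
  have u: "0 < u" "u < 1" using q by (auto simp: u_def)
  \<comment> \<open>The loss of the emulator bound per unit of K: \<open>\<eta> ^ n\<close>
    contributes \<open>(u ^ D) ^ n\<close>, and the marks to the base labels of D squares contribute
    \<open>(c ^ n) ^ D\<close>.\<close>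
  define \<rho> where "\<rho> = (u ^ D) ^ n * (c ^ n) ^ D"
  have \<rho>: "0 < \<rho>" "\<rho> \<le> 1"
    unfolding \<rho>_def using u c by (auto intro!: mult_le_one power_le_one)
  \<comment> \<open>Chosen so that \<open>\<eta> * k1\<close> is at most
    \<open>del / (1 + L1)\<close> for the \<open>del\<close> below, using that \<open>lam\<close> is
    at least L0.\<close>
  define k1 where "k1 = L0 / (2 * real n * (1 + L1))"
  have k1: "0 < k1" unfolding k1_def using L n by simp
  \<comment> \<open>The part of the emulator bound that does not depend on K.\<close>
  define C1 where "C1 = (k1 / (real_of_int m)\<^sup>2) ^ n * c ^ (n * (D' * n))"
  have C1: "0 < C1" unfolding C1_def using k1 m c by simp
  \<comment> \<open>With this tilt the tail decays at rate \<open>\<rho> / 2\<close>, so a factor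
    \<open>(1 / 2) ^ K\<close> remains to beat the constants.\<close>
  define x where "x = 2 / \<rho>"
  have x: "1 < x" unfolding x_def using \<rho> by simp
  have "(\<lambda>k. exp (L1 * x) * (1 / 2 :: real) ^ k) \<longlonglongrightarrow> exp (L1 * x) * 0"
    by (intro tendsto_mult tendsto_const LIMSEQ_realpow_zero) auto
  then have "eventually (\<lambda>k. exp (L1 * x) * (1 / 2 :: real) ^ k < C1) sequentially"
    using C1 by (intro order_tendstoD(2)) auto
  then obtain K0 where K0: "\<And>k. k \<ge> K0 \<Longrightarrow> exp (L1 * x) * (1 / 2 :: real) ^ k < C1"
    by (auto simp: eventually_sequentially)
  define K where "K = Suc K0"
  define \<eta> where "\<eta> = u ^ (D * K)"
  have \<eta>: "0 < \<eta>" "\<eta> < 1" unfolding \<eta>_def using u D by (auto simp: K_def power_less_one_iff)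
  have "AE \<omega> in RCM_space lam. \<not> RCM_percolates (\<lambda>r. q * f r) \<omega>"
    if lam: "L0 \<le> lam" "lam \<le> L1" and null: "AE \<omega> in RCM_space (lam *
        (1 - \<eta> / 2)). \<not> RCM_percolates f \<omega>" for lam
  proof -
    have lam0: "0 < lam" using lam L by linarith
    \<comment> \<open>A square contains n slots, so the added intensity \<open>n * del\<close>
      equals \<open>\<eta> * lam / 2\<close>, half of what killing removes.\<close>
    define del where "del = \<eta> * lam / (2 * real n)"
    have del: "0 < del" unfolding del_def using \<eta> lam0 n by simp
    have "\<eta> * lam \<le> 1 * L1" using \<eta> lam lam0 by (intro mult_mono) auto
    moreover have "L1 \<le> L1 * (2 * real n)" using L n by (simp add: mult_le_cancel_left1)
    ultimately have "\<eta> * lam \<le> L1 * (2 * real n)" by linarith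
    then have del_le: "del \<le> L1" unfolding del_def using n by (simp add: divide_le_eq)
    have k0: "\<eta> * k1 \<le> del / (1 + L1)"
    proof -
      have "\<eta> * k1 = \<eta> * L0 / (2 * real n) / (1 + L1)" by (simp add: k1_def)
      also have "\<dots> \<le> del / (1 + L1)"
        unfolding del_def using \<eta> lam L n by (intro divide_right_mono mult_left_mono) auto
      finally show ?thesis .
    qed
    have tail: "measure_pmf.prob (poisson_pmf lam) {K<..} \<le> exp (- lam) *
        em_prob m R K (f r0) del s" for s
    proof -
      have "C1 * \<rho> ^ K = (\<eta> * k1 / (real_of_int m)\<^sup>2) ^ n * c ^ (n * (D * K + D' * n))"
        unfolding C1_def \<rho>_def \<eta>_def
        by (simp add: power_mult_distrib power_divide power_add power_mult[symmetric] distrib_left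
            mult_ac)
      also have "\<dots> \<le> em_prob m R K c del s"
        unfolding n_def D_def D'_def
        by (rule em_prob_lower[OF m R(2) c del del_le]) (use \<eta> k1 k0 in auto)
      finally have em: "C1 * \<rho> ^ K \<le> em_prob m R K c del s" .
      \<comment> \<open>The factor \<open>exp lam\<close> compensates the probability
        \<open>exp (- lam)\<close> of an empty square, in which alone an emulator is converted into
        a dense count.\<close>
      have "exp lam * measure_pmf.prob (poisson_pmf lam) {K<..} \<le> exp lam * (exp (lam * (x - 1)) *
          (1 / x) ^ Suc K)"
        by (intro mult_left_mono poisson_upper_tail lam0 x) auto
      also have "\<dots> = exp (lam * x) * (\<rho> / 2) ^ Suc K"
        by (simp add: exp_add[symmetric] algebra_simps x_def)
      also have "\<dots> \<le> exp (L1 * x) * (\<rho> / 2) ^ K"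
        using lam x \<rho> by (intro mult_mono power_decreasing) (auto intro: mult_right_mono)
      also have "\<dots> = exp (L1 * x) * (1 / 2) ^ K * \<rho> ^ K" by (simp add: power_divide)
      also have "\<dots> \<le> C1 * \<rho> ^ K"
        using K0[of K] \<rho> by (intro mult_right_mono) (auto simp: K_def)
      finally have "exp lam * measure_pmf.prob (poisson_pmf lam) {K<..} \<le> em_prob m R K c del s" using em
          by linarith
      then show ?thesis unfolding c_def by (simp add: exp_minus field_simps)
    qed
    interpret coupling f q r0 A lam del m R K
      by (rule coupling.intro) (use q f_bounds f_antitone r0 f_support R m m4 lam0 del tail in \<open>auto simp:
          K_def\<close>)
    have "lamB = lam * (1 - \<eta> / 2)"
    proof -
      have "real (nat (2 * R + 1) ^ 2 * nat m ^ 2) * del = \<eta> * lam / 2"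
        using n unfolding del_def n_def D_def by simp
      moreover have "eta = \<eta>" unfolding eta_def \<eta>_def u_def D_def ..
      ultimately show ?thesis unfolding lamB_def by (simp add: algebra_simps)
    qed
    then have "AE \<omega> in RCM_space lamB. \<not> RCM_percolates f \<omega>" using null by (simp only:)
    then show ?thesis by (rule coupled_null)
  qed
  then show ?thesis using \<eta> by blast
qed

theorem theorem3:
  fixes f :: "real \<Rightarrow> real" and q0 :: real
  assumes "0 < q0" and "q0 < 1"
    and "\<And>r. 0 \<le> r \<Longrightarrow> 0 \<le> f r \<and> f r \<le> 1"
    and "\<And>r s. 0 \<le> r \<Longrightarrow> r \<le> s \<Longrightarrow> f s \<le> f r"
    and "{a. 0 \<le> a \<and> f a > 0} \<noteq> {}"
    and "bdd_above {a. 0 \<le> a \<and> f a > 0}"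
    and "0 < Sup {a. 0 \<le> a \<and> f a > 0}"
  shows "RCM_critical (\<lambda>r. q0 * f r) > RCM_critical f"
proof -
  let ?g = "\<lambda>r. q0 * f r"
  define A where "A = Sup {a. 0 \<le> a \<and> f a > 0}"
  have f_antitone: "antitone_nonneg f" using assms(4) by (simp add: antitone_nonneg_def)
  have g_antitone: "antitone_nonneg ?g" using assms(1,4) by (simp add: antitone_nonneg_def)
  have supp: "r \<le> A" if "0 \<le> r" "0 < f r" for r
    unfolding A_def using that assms(6) by (intro cSup_upper) auto
  obtain r0 where r0: "0 < r0" "0 < f r0"
    using less_cSupD[OF assms(5,7)] by auto
  have fr0: "f r0 \<le> 1" using assms(3)[of r0] r0 by simp
  have gr0: "0 < q0 * f r0" "q0 * f r0 \<le> 1" using assms(1,2) r0 fr0 by (auto intro: mult_le_one)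
  let ?S = "\<lambda>g. {lam. 0 < lam \<and> (AE \<omega> in RCM_space lam. \<not> RCM_percolates g \<omega>)}"
  have crit: "RCM_critical g = Sup (?S g)" if "antitone_nonneg g" for g
    unfolding RCM_critical_def RCM_null_iff_AE[OF that] ..
  \<comment> \<open>The supremum of reals bounds its set only if the set is bounded, so the
    supercritical regime enters for both connection functions.\<close>
  have bdd: "bdd_above (?S g)" if g: "antitone_nonneg g" "0 < g r0" "g r0 \<le> 1" for g
  proof -
    obtain \<Lambda> where \<Lambda>: "\<And>lam. lam \<ge> \<Lambda> \<Longrightarrow> \<not> (AE \<omega> in RCM_space lam. \<not> RCM_percolates g \<omega>)"
      using RCM_supercritical[OF g(1) r0(1) g(2,3)] by blast
    show ?thesis
    proof (rule bdd_aboveI[of _ \<Lambda>], rule ccontr)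
      fix lam assume "lam \<in> ?S g" "\<not> lam \<le> \<Lambda>"
      then show False using \<Lambda>[of lam] by auto
    qed
  qed
  define R where "R = max 0 \<lceil>A + 1\<rceil>"
  have R: "A + 1 \<le> real_of_int R" "0 \<le> R" unfolding R_def by linarith+
  \<comment> \<open>Half of the threshold in \<open>RCM_subcritical\<close>; it yields a positive
    lower end for the interval of intensities.\<close>
  define lam0 where "lam0 = 1 / (2 * real (nat (2 * R + 1) ^ 2))"
  have D: "0 < real (nat (2 * R + 1) ^ 2)" using R(2) by simp
  have lam0: "0 < lam0" "lam0 * real (nat (2 * R + 1) ^ 2) < 1" unfolding lam0_def using D by auto
  have S0: "lam0 \<in> ?S f"
    using RCM_subcritical[of f A R lam0] supp R lam0 by auto
  define lc where "lc = RCM_critical f"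
  have lc: "lam0 \<le> lc"
    unfolding lc_def crit[OF f_antitone]
    by (rule cSup_upper[OF S0 bdd[OF f_antitone r0(2) fr0]])
  \<comment> \<open>The upper end \<open>2 * lc\<close> suffices because \<open>\<eta> < 1\<close>
    makes \<open>1 / (1 - \<eta> / 2)\<close> less than 2.\<close>
  obtain \<eta> where \<eta>: "0 < \<eta>" "\<eta> < 1" and comp: "\<And>lam. lam0 \<le> lam \<Longrightarrow> lam \<le> 2 * lc \<Longrightarrow>
      (AE \<omega> in RCM_space (lam * (1 - \<eta> / 2)). \<not> RCM_percolates f \<omega>) \<Longrightarrow>
      (AE \<omega> in RCM_space lam. \<not> RCM_percolates ?g \<omega>)"
    using strict_comparison[OF assms(1,2,3) f_antitone r0 supp, of lam0 "2 * lc"] lc lam0(1) by auto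
  have "lc * (1 - \<eta> / 2) < lc" using lc lam0 \<eta> by simp
  then obtain lam where lam: "lam \<in> ?S f" "lc * (1 - \<eta> / 2) < lam"
    using less_cSupD[of "?S f" "lc * (1 - \<eta> / 2)"] S0 unfolding lc_def crit[OF f_antitone] by blast
  have lam_le: "lam \<le> lc"
    unfolding lc_def crit[OF f_antitone] by (rule cSup_upper[OF lam(1) bdd[OF f_antitone r0(2) fr0]])
  \<comment> \<open>A null intensity for f within the factor \<open>1 - \<eta> / 2\<close> of the
    critical value is scaled up by that factor, which carries it strictly beyond
    \<open>lc\<close>.\<close>
  define lam' where "lam' = lam / (1 - \<eta> / 2)"
  have gt: "lc < lam'" unfolding lam'_def using lam(2) \<eta> by (simp add: field_simps)
  have "lam * 1 \<le> lc * (2 * (1 - \<eta> / 2))"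
    using lam_le lc lam0 \<eta> by (intro mult_mono) auto
  then have le: "lam' \<le> 2 * lc" unfolding lam'_def using \<eta> by (simp add: field_simps)
  have eq: "lam' * (1 - \<eta> / 2) = lam" unfolding lam'_def using \<eta> by simp
  have "AE \<omega> in RCM_space lam'. \<not> RCM_percolates ?g \<omega>"
  proof (rule comp)
    show "lam0 \<le> lam'" "lam' \<le> 2 * lc" using gt lc le by auto
    show "AE \<omega> in RCM_space (lam' * (1 - \<eta> / 2)). \<not> RCM_percolates f \<omega>"
      unfolding eq using lam(1) by blast
  qed
  then have "lam' \<in> ?S ?g" using gt lc lam0 by simp
  then have "lam' \<le> RCM_critical ?g"
    unfolding crit[OF g_antitone] by (rule cSup_upper) (use bdd[OF g_antitone] gr0 in simp)
  then show ?thesis using gt unfolding lc_def by linarith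
qed

end
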